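(* Let $X$ be a Banach space, $1\le\xi<\omega_1$ and $n\in\mathbb{N}\cup\{0\}$. (a) If $\#\bigl(\mathrm{SP}_{1,w}(X)/\!\approx_\xi\bigr)=n$, $S\in\mathcal{SS}(X)$ and $T_1,\dots,T_n\in\mathcal{SS}_\xi(X)$, then $T_nT_{n-1}\cdots T_1S$ is compact. Moreover, if $\ell_1$ does not isomorphically embed in $X$, then $T_nT_{n-1}\cdots T_1$ is compact. (b) If $\#\bigl(\mathrm{SP}_{1,w}(X)/\!\approx\bigr)=n$ and $T_1,\dots,T_{n+1}\in\mathcal{SS}(X)$, then $T_{n+1}T_n\cdots T_1$ is compact. Moreover, if $\ell_1$ does not isomorphically embed in $X$, then $T_nT_{n-1}\cdots T_1$ is compact. (For $n=0$ the conclusion is understood to mean that every operator in $\mathcal{SS}(X)$ is compact.)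
   Context: $\mathbb{N}=\{1,2,\dots\}$; $\mathcal{L}(X)$ is the space of bounded linear operators on $X$; $\#$ denotes cardinality; $[x_i]_{i\in F}$ is the closed linear span of $\{x_i\}_{i\in F}$. For finite sets $A,B\subseteq\mathbb{N}$, $A<B$ means $\max A<\min B$, and $n\le A$ means $n\le\min A$ (the empty set satisfies all such relations). Schreier families. For families $\mathcal{F},\mathcal{G}$ of finite subsets of $\mathbb{N}$ put $\mathcal{F}[\mathcal{G}]=\{\bigcup_{i=1}^n G_i : n\in\mathbb{N},\ G_1<\dots<G_n,\ G_i\in\mathcal{G}\text{ for } i\le n,\ \{\min G_i\}_{i=1}^n\in\mathcal{F}\}$. Let $\mathcal{S}_0=\{\{n\}:n\in\mathbb{N}\}\cup\{\varnothing\}$, $\mathcal{S}_1=\{F\subseteq\mathbb{N}\text{ finite}: \#F\le\min F\}$ (including $\varnothing$), $\mathcal{S}_{\xi+1}=\mathcal{S}_1[\mathcal{S}_\xi]$, and for a countable limit ordinal $\xi$ fix a sequence of ordinals $\xi_n\nearrow\xi$ and let $\mathcal{S}_\xi=\{F: n\le F\text{ and }F\in\mathcal{S}_{\xi_n}\text{ for some }n\in\mathbb{N}\}$. Operators. $\mathcal{SS}(X)$ is the set of strictly singular operators $T\in\mathcal{L}(X)$, i.e. those whose restriction to any infinite-dimensional subspace is not an isomorphism onto its image. $T\in\mathcal{L}(X)$ is $\mathcal{S}_\xi$-strictly singular, $T\in\mathcal{SS}_\xi(X)$, if for every $\varepsilon>0$ and every basic sequence $(x_n)$ in $X$ there exist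 $F\in\mathcal{S}_\xi$ and $z\in[x_i]_{i\in F}\setminus\{0\}$ with $\|Tz\|\le\varepsilon\|z\|$. Sequences. Write $a\overset{C}{\approx}b$ if $\frac1C a\le b\le Ca$. A sequence is seminormalized if its norms are bounded above and bounded away from $0$. A seminormalized basic sequence $(x_n)$ in $X$ is Schreier spreading if there is $1\le C<\infty$ such that for all $F=\{f_1<\dots<f_n\}$, $G=\{g_1<\dots<g_n\}$ in $\mathcal{S}_1$ and scalars $(a_i)_{i=1}^n$, $\|\sum_{i=1}^n a_ix_{f_i}\|\overset{C}{\approx}\|\sum_{i=1}^n a_ix_{g_i}\|$. $\mathrm{SP}_{1,w}(X)$ is the set of seminormalized weakly null basic sequences in $X$ that are Schreier spreading. On it, two equivalence relations are considered: $(x_n)\approx_\xi(y_n)$ if there is $1\le K<\infty$ with $\|\sum_{i\in F}a_ix_i\|\overset{K}{\approx}\|\sum_{i\in F}a_iy_i\|$ for all $F\in\mathcal{S}_\xi$ and scalars $(a_i)_{i\in F}$; and $(x_n)\approx(y_n)$ if there is $1\le K<\infty$ with $\|\sum a_nx_n\|\overset{K}{\approx}\|\sum a_ny_n\|$ for all finitely supported scalar sequences $(a_n)$. *)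

theory Defs
  imports "HOL-Analysis.Analysis"
begin

section \<open>Banach spaces over the real or complex numbers\<close>

text \<open>
  A scalar field is the real or the complex numbers. The library's Banach spaces are real; a Banach
  space over a scalar field \<open>'k\<close> is one of these together with a compatible scalar
  multiplication \<open>scl\<close>. For \<open>'k = real\<close> the only possibility is \<open>scl = scaleR\<close>.
\<close>

class real_or_complex = real_normed_field +
  assumes real_or_complex:
    "(\<forall>z. \<exists>a. z = a *\<^sub>R 1) \<or>
     (\<exists>i. i * i = - 1 \<and> (\<forall>z. \<exists>a b. z = a *\<^sub>R 1 + b *\<^sub>R i) \<and>
       (\<forall>a b. norm (a *\<^sub>R 1 + b *\<^sub>R i) = sqrt (a\<^sup>2 + b\<^sup>2)))"

instance real :: real_or_complex
proof
  show "(\<forall>z::real. \<exists>a. z = a *\<^sub>R 1) \<or>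
     (\<exists>i::real. i * i = - 1 \<and> (\<forall>z. \<exists>a b. z = a *\<^sub>R 1 + b *\<^sub>R i) \<and>
       (\<forall>a b. norm (a *\<^sub>R 1 + b *\<^sub>R i) = sqrt (a\<^sup>2 + b\<^sup>2)))"
    by auto
qed

instance complex :: real_or_complex
proof
  have "\<exists>a b. z = a *\<^sub>R 1 + b *\<^sub>R \<i>" for z
    by (rule exI[of _ "Re z"], rule exI[of _ "Im z"]) (simp add: complex_eq_iff)
  moreover have "norm (a *\<^sub>R 1 + b *\<^sub>R \<i>) = sqrt (a\<^sup>2 + b\<^sup>2)" for a b
    by (simp add: cmod_def)
  ultimately show "(\<forall>z::complex. \<exists>a. z = a *\<^sub>R 1) \<or>
     (\<exists>i::complex. i * i = - 1 \<and> (\<forall>z. \<exists>a b. z = a *\<^sub>R 1 + b *\<^sub>R i) \<and>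
       (\<forall>a b. norm (a *\<^sub>R 1 + b *\<^sub>R i) = sqrt (a\<^sup>2 + b\<^sup>2)))"
    by (intro disjI2 exI[of _ "\<i>"]) auto
qed

locale banach_over = vector_space scl
  for scl :: "'k::real_or_complex \<Rightarrow> 'a::banach \<Rightarrow> 'a" +
  assumes scl_of_real: "scl (of_real r) x = r *\<^sub>R x"
    and norm_scl: "norm (scl c x) = norm c * norm x"

lemma banach_over_real: "banach_over (scaleR :: real \<Rightarrow> 'a::banach \<Rightarrow> 'a)"
  by unfold_locales (auto simp: algebra_simps)

lemma banach_over_complex: "banach_over ((*) :: complex \<Rightarrow> complex \<Rightarrow> complex)"
  by unfold_locales (auto simp: algebra_simps scaleR_conv_of_real norm_mult)

definition bounded_ops :: "('k::real_or_complex \<Rightarrow> 'a::banach \<Rightarrow> 'a) \<Rightarrow> ('a \<Rightarrow> 'a) set" where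
  "bounded_ops scl = {T. Vector_Spaces.linear scl scl T \<and> bounded_linear T}"

definition dual_space :: "('k::real_or_complex \<Rightarrow> 'a::banach \<Rightarrow> 'a) \<Rightarrow> ('a \<Rightarrow> 'k) set" where
  "dual_space scl = {f. Vector_Spaces.linear scl (*) f \<and> bounded_linear f}"

definition compact_op :: "('a::banach \<Rightarrow> 'a) \<Rightarrow> bool" where
  "compact_op T \<longleftrightarrow> compact (closure (T ` cball 0 1))"

primrec op_product :: "(nat \<Rightarrow> 'a \<Rightarrow> 'a) \<Rightarrow> nat \<Rightarrow> 'a \<Rightarrow> 'a" where
  "op_product T 0 = id"
| "op_product T (Suc n) = T (Suc n) \<circ> op_product T n"

text \<open>
  Isomorphic embeddability of the Banach space of absolutely summable scalar sequences, on which
  \<open>\<Sum>n. norm (a n)\<close> is the norm. The map \<open>J\<close> is only relevant on that space.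
\<close>

definition ell1 :: "(nat \<Rightarrow> 'k::real_or_complex) set" where
  "ell1 = {a. summable (\<lambda>n. norm (a n))}"

definition ell1_embeds :: "('k::real_or_complex \<Rightarrow> 'a::banach \<Rightarrow> 'a) \<Rightarrow> bool" where
  "ell1_embeds scl \<longleftrightarrow>
    (\<exists>J. (\<forall>a\<in>ell1. \<forall>b\<in>ell1. J (\<lambda>n. a n + b n) = J a + J b) \<and>
         (\<forall>c. \<forall>a\<in>ell1. J (\<lambda>n. c * a n) = scl c (J a)) \<and>
         (\<exists>m>0. \<exists>M. \<forall>a\<in>ell1. m * (\<Sum>n. norm (a n)) \<le> norm (J a) \<and>
                                norm (J a) \<le> M * (\<Sum>n. norm (a n))))"


section \<open>Schreier families\<close>

text \<open>Sets of positive integers are sets of type \<open>nat set\<close> not containing \<open>0\<close>.\<close>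

definition set_less :: "nat set \<Rightarrow> nat set \<Rightarrow> bool" where
  "set_less A B \<longleftrightarrow> (\<forall>a\<in>A. \<forall>b\<in>B. a < b)"

text \<open>
  The empty set has no minimum and therefore contributes nothing to the set of minima. For lists
  with empty members the order is required for all pairs, not only for neighbours.
\<close>

definition convolution :: "nat set set \<Rightarrow> nat set set \<Rightarrow> nat set set" where
  "convolution \<F> \<G> =
    {\<Union>(set Gs) | Gs. Gs \<noteq> [] \<and> sorted_wrt set_less Gs \<and> set Gs \<subseteq> \<G> \<and>
       Min ` (set Gs - {{}}) \<in> \<F>}"

definition schreier0 :: "nat set set" where
  "schreier0 = {{n} | n. 1 \<le> n} \<union> {{}}"

definition schreier1 :: "nat set set" where
  "schreier1 = {F. finite F \<and> 0 \<notin> F \<and> (F = {} \<or> card F \<le> Min F)}"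

text \<open>
  Countable ordinals are rendered as elements \<open>\<xi>\<close> of an arbitrary well-ordered type with
  \<open>{..<\<xi>}\<close> countable; \<open>\<xi>\<close> stands for the order type of \<open>{..<\<xi>}\<close>.
\<close>

definition ord_zero :: "'o::wellorder \<Rightarrow> bool" where
  "ord_zero \<xi> \<longleftrightarrow> (\<forall>\<eta>. \<xi> \<le> \<eta>)"

definition ord_succ_of :: "'o::wellorder \<Rightarrow> 'o \<Rightarrow> bool" where
  "ord_succ_of \<xi> \<eta> \<longleftrightarrow> \<eta> < \<xi> \<and> (\<forall>\<theta>. \<not> (\<eta> < \<theta> \<and> \<theta> < \<xi>))"

definition ord_limit :: "'o::wellorder \<Rightarrow> bool" where
  "ord_limit \<xi> \<longleftrightarrow> \<not> ord_zero \<xi> \<and> \<not> (\<exists>\<eta>. ord_succ_of \<xi> \<eta>)"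

text \<open>
  \<open>u \<zeta> 1, u \<zeta> 2, \<dots>\<close> is the sequence increasing to the limit ordinal \<open>\<zeta>\<close>; it is fixed for
  all limit ordinals up to \<open>\<xi>\<close>.
\<close>

definition fundamental_sequences :: "('o::wellorder \<Rightarrow> nat \<Rightarrow> 'o) \<Rightarrow> 'o \<Rightarrow> bool" where
  "fundamental_sequences u \<xi> \<longleftrightarrow>
    (\<forall>\<zeta>\<le>\<xi>. ord_limit \<zeta> \<longrightarrow>
       mono_on {1..} (u \<zeta>) \<and> (\<forall>n\<ge>1. u \<zeta> n < \<zeta>) \<and> (\<forall>\<eta><\<zeta>. \<exists>n\<ge>1. \<eta> < u \<zeta> n))"

lemma ord_succ_of_unique: "ord_succ_of \<xi> \<eta> \<Longrightarrow> ord_succ_of \<xi> \<eta>' \<Longrightarrow> \<eta> = \<eta>'"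
  unfolding ord_succ_of_def by (metis linorder_neqE)

text \<open>
  The condition \<open>u \<xi> n < \<xi>\<close> only serves to make the recursion well-founded for arbitrary
  \<open>u\<close>; see \<open>schreier_limit\<close> below.
\<close>

declare conj_cong [fundef_cong]

function schreier :: "('o::wellorder \<Rightarrow> nat \<Rightarrow> 'o) \<Rightarrow> 'o \<Rightarrow> nat set set" where
  "schreier u \<xi> =
    (if ord_zero \<xi> then schreier0
     else if ord_limit \<xi> then
       {F. \<exists>n\<ge>1. u \<xi> n < \<xi> \<and> (\<forall>k\<in>F. n \<le> k) \<and> F \<in> schreier u (u \<xi> n)}
     else convolution schreier1 (schreier u (THE \<eta>. ord_succ_of \<xi> \<eta>)))"
  by pat_completeness auto
termination
proof (relation "inv_image {(x, y). x < y} snd", goal_cases)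
  case 1
  show ?case using wf by (rule wf_inv_image)
next
  case (2 u \<xi> n)
  then show ?case by simp
next
  case (3 u \<xi>)
  then obtain \<eta> where \<eta>: "ord_succ_of \<xi> \<eta>" by (auto simp: ord_limit_def)
  then have "(THE \<eta>. ord_succ_of \<xi> \<eta>) = \<eta>" using ord_succ_of_unique by blast
  moreover have "\<eta> < \<xi>" using \<eta> by (simp add: ord_succ_of_def)
  ultimately show ?case by simp
qed

declare schreier.simps [simp del]

lemma schreier_zero: "ord_zero \<xi> \<Longrightarrow> schreier u \<xi> = schreier0"
  by (subst schreier.simps) simp

lemma schreier_succ:
  assumes "ord_succ_of \<xi> \<eta>"
  shows "schreier u \<xi> = convolution schreier1 (schreier u \<eta>)"
proof -
  have "(THE \<eta>. ord_succ_of \<xi> \<eta>) = \<eta>" using assms ord_succ_of_unique by blast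
  moreover have "\<not> ord_zero \<xi>" "\<not> ord_limit \<xi>"
    using assms by (auto simp: ord_limit_def ord_zero_def ord_succ_of_def not_le)
  ultimately show ?thesis by (subst schreier.simps) simp
qed

lemma schreier_limit:
  assumes "fundamental_sequences u \<xi>" "ord_limit \<zeta>" "\<zeta> \<le> \<xi>"
  shows "schreier u \<zeta> = {F. \<exists>n\<ge>1. (\<forall>k\<in>F. n \<le> k) \<and> F \<in> schreier u (u \<zeta> n)}"
proof -
  have "\<And>n. n \<ge> 1 \<Longrightarrow> u \<zeta> n < \<zeta>" "\<not> ord_zero \<zeta>"
    using assms by (auto simp: fundamental_sequences_def ord_limit_def)
  with assms(2) show ?thesis by (subst schreier.simps) auto
qed

lemma convolution_schreier1_schreier0: "convolution schreier1 schreier0 = schreier1"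
proof (intro equalityI subsetI)
  fix F assume "F \<in> convolution schreier1 schreier0"
  then obtain Gs where Gs: "F = \<Union>(set Gs)" "set Gs \<subseteq> schreier0" "Min ` (set Gs - {{}}) \<in> schreier1"
    unfolding convolution_def by auto
  define X where "X = set Gs - {{}}"
  have "{Min G} = G" if "G \<in> X" for G
  proof -
    have "G \<in> schreier0" "G \<noteq> {}" using that Gs(2) by (auto simp: X_def)
    then obtain n where "G = {n}" by (auto simp: schreier0_def)
    then show ?thesis by simp
  qed
  then have "(\<lambda>G. {Min G}) ` X = X" by simp
  moreover have "\<Union>((\<lambda>G. {Min G}) ` X) = Min ` X" by blast
  moreover have "\<Union>X = F" unfolding Gs(1) X_def by blast
  ultimately have "Min ` X = F" by argo
  then show "F \<in> schreier1" using Gs(3) by (simp add: X_def)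
next
  fix F assume F: "F \<in> schreier1"
  then have fin: "finite F" and pos: "0 \<notin> F" by (auto simp: schreier1_def)
  define Gs where "Gs = {} # map (\<lambda>n. {n}) (sorted_list_of_set F)"
  have set: "set Gs = insert {} ((\<lambda>n. {n}) ` F)" using fin by (simp add: Gs_def)
  have "F = \<Union>(set Gs)" by (simp add: set)
  moreover have "Gs \<noteq> []" by (simp add: Gs_def)
  moreover have "sorted_wrt set_less Gs"
    using strict_sorted_list_of_set[of F] by (simp add: Gs_def set_less_def sorted_wrt_map)
  moreover have "set Gs \<subseteq> schreier0"
    using pos by (auto simp: set schreier0_def Suc_le_eq intro!: gr0I)
  moreover have "Min ` (set Gs - {{}}) \<in> schreier1"
  proof -
    have "set Gs - {{}} = (\<lambda>n. {n}) ` F" unfolding set by blast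
    with F show ?thesis by (simp add: image_image)
  qed
  ultimately show "F \<in> convolution schreier1 schreier0"
    unfolding convolution_def by blast
qed


section \<open>Sequences\<close>

text \<open>
  Sequences are indexed by the positive integers. They are represented by functions on \<open>nat\<close>
  whose value at \<open>0\<close> is ignored by all notions below.
\<close>

definition approx_within :: "real \<Rightarrow> real \<Rightarrow> real \<Rightarrow> bool" where
  "approx_within C a b \<longleftrightarrow> a / C \<le> b \<and> b \<le> C * a"

definition seminormalized :: "(nat \<Rightarrow> 'a::banach) \<Rightarrow> bool" where
  "seminormalized x \<longleftrightarrow> (\<exists>m>0. \<exists>M. \<forall>n\<ge>1. m \<le> norm (x n) \<and> norm (x n) \<le> M)"

definition weakly_null :: "('k::real_or_complex \<Rightarrow> 'a::banach \<Rightarrow> 'a) \<Rightarrow> (nat \<Rightarrow> 'a) \<Rightarrow> bool" where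
  "weakly_null scl x \<longleftrightarrow> (\<forall>f\<in>dual_space scl. (\<lambda>n. f (x n)) \<longlonglongrightarrow> 0)"

definition closed_span :: "('k::real_or_complex \<Rightarrow> 'a::banach \<Rightarrow> 'a) \<Rightarrow> 'a set \<Rightarrow> 'a set" where
  "closed_span scl A = closure (module.span scl A)"

text \<open>
  A basic sequence is a Schauder basis of its closed linear span; \<open>a n\<close> is the coefficient of
  \<open>x (Suc n)\<close>.
\<close>

definition basic_sequence :: "('k::real_or_complex \<Rightarrow> 'a::banach \<Rightarrow> 'a) \<Rightarrow> (nat \<Rightarrow> 'a) \<Rightarrow> bool" where
  "basic_sequence scl x \<longleftrightarrow>
    (\<forall>y\<in>closed_span scl (x ` {1..}). \<exists>!a. (\<lambda>n. scl (a n) (x (Suc n))) sums y)"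

text \<open>\<open>sorted_list_of_set F ! i\<close> is the element of \<open>F\<close> in position \<open>i\<close>, counted from \<open>0\<close>.\<close>

definition schreier_spreading :: "('k::real_or_complex \<Rightarrow> 'a::banach \<Rightarrow> 'a) \<Rightarrow> (nat \<Rightarrow> 'a) \<Rightarrow> bool" where
  "schreier_spreading scl x \<longleftrightarrow>
    (\<exists>C\<ge>1. \<forall>F\<in>schreier1. \<forall>G\<in>schreier1. card F = card G \<longrightarrow>
      (\<forall>a. approx_within C
         (norm (\<Sum>i<card F. scl (a i) (x (sorted_list_of_set F ! i))))
         (norm (\<Sum>i<card F. scl (a i) (x (sorted_list_of_set G ! i))))))"

definition SP1w :: "('k::real_or_complex \<Rightarrow> 'a::banach \<Rightarrow> 'a) \<Rightarrow> (nat \<Rightarrow> 'a) set" where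
  "SP1w scl = {x. seminormalized x \<and> weakly_null scl x \<and> basic_sequence scl x \<and>
                  schreier_spreading scl x}"

definition equiv_xi :: "('k::real_or_complex \<Rightarrow> 'a::banach \<Rightarrow> 'a) \<Rightarrow>
    ('o::wellorder \<Rightarrow> nat \<Rightarrow> 'o) \<Rightarrow> 'o \<Rightarrow> ((nat \<Rightarrow> 'a) \<times> (nat \<Rightarrow> 'a)) set" where
  "equiv_xi scl u \<xi> = {(x, y). x \<in> SP1w scl \<and> y \<in> SP1w scl \<and>
    (\<exists>K\<ge>1. \<forall>F\<in>schreier u \<xi>. \<forall>a.
      approx_within K (norm (\<Sum>i\<in>F. scl (a i) (x i))) (norm (\<Sum>i\<in>F. scl (a i) (y i))))}"

definition equiv_seq :: "('k::real_or_complex \<Rightarrow> 'a::banach \<Rightarrow> 'a) \<Rightarrow>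
    ((nat \<Rightarrow> 'a) \<times> (nat \<Rightarrow> 'a)) set" where
  "equiv_seq scl = {(x, y). x \<in> SP1w scl \<and> y \<in> SP1w scl \<and>
    (\<exists>K\<ge>1. \<forall>N a.
      approx_within K (norm (\<Sum>i=1..N. scl (a i) (x i))) (norm (\<Sum>i=1..N. scl (a i) (y i))))}"

lemma equiv_approx:
  assumes "\<And>x y. (x, y) \<in> R \<longleftrightarrow> x \<in> A \<and> y \<in> A \<and>
    (\<exists>K\<ge>1. \<forall>p\<in>P. approx_within K (h x p) (h y p))"
    and h: "\<And>x p. h x p \<ge> 0"
  shows "equiv A R"
proof (rule equivI)
  show "R \<subseteq> A \<times> A" using assms(1) by auto
  show "refl_on A R"
  proof (rule refl_onI)
    fix x assume "x \<in> A"
    moreover have "\<forall>p\<in>P. approx_within 1 (h x p) (h x p)" by (simp add: approx_within_def)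
    ultimately show "(x, x) \<in> R" unfolding assms(1) using order_refl by blast
  qed
  show "sym R"
  proof (rule symI)
    fix x y assume "(x, y) \<in> R"
    then obtain K where K: "x \<in> A" "y \<in> A" "K \<ge> 1" "\<And>p. p \<in> P \<Longrightarrow> approx_within K (h x p) (h y p)"
      unfolding assms(1) by blast
    have "approx_within K (h y p) (h x p)" if "p \<in> P" for p
      using K(4)[OF that] K(3) by (auto simp: approx_within_def field_simps)
    then show "(y, x) \<in> R" unfolding assms(1) using K(1-3) by blast
  qed
  show "trans R"
  proof (rule transI)
    fix x y z assume "(x, y) \<in> R" "(y, z) \<in> R"
    then obtain K L where K: "x \<in> A" "z \<in> A" "K \<ge> 1" "L \<ge> 1"
      "\<And>p. p \<in> P \<Longrightarrow> approx_within K (h x p) (h y p)"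
      "\<And>p. p \<in> P \<Longrightarrow> approx_within L (h y p) (h z p)"
      unfolding assms(1) by blast
    have "approx_within (K * L) (h x p) (h z p)" if "p \<in> P" for p
    proof -
      have xy: "h x p \<le> K * h y p" "h y p \<le> K * h x p" and yz: "h y p \<le> L * h z p" "h z p \<le> L * h y p"
        using K(5,6)[OF that] K(3,4) by (auto simp: approx_within_def field_simps)
      have "h x p \<le> K * (L * h z p)"
        using xy(1) mult_left_mono[OF yz(1), of K] K(3) by linarith
      moreover have "h z p \<le> L * (K * h x p)"
        using yz(2) mult_left_mono[OF xy(2), of L] K(4) by linarith
      ultimately show ?thesis using K(3,4) by (simp add: approx_within_def field_simps)
    qed
    moreover have "K * L \<ge> 1" using K(3,4) mult_mono[of 1 K 1 L] by simp
    ultimately show "(x, z) \<in> R" unfolding assms(1) using K(1,2) by blast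
  qed
qed

lemma equiv_equiv_xi: "equiv (SP1w scl) (equiv_xi scl u \<xi>)"
proof (rule equiv_approx[where P = "schreier u \<xi> \<times> UNIV" and
        h = "\<lambda>x p. norm (\<Sum>i\<in>fst p. scl (snd p i) (x i))"])
  show "(x, y) \<in> equiv_xi scl u \<xi> \<longleftrightarrow> x \<in> SP1w scl \<and> y \<in> SP1w scl \<and>
    (\<exists>K\<ge>1. \<forall>p\<in>schreier u \<xi> \<times> UNIV. approx_within K
      (norm (\<Sum>i\<in>fst p. scl (snd p i) (x i))) (norm (\<Sum>i\<in>fst p. scl (snd p i) (y i))))" for x y
    unfolding equiv_xi_def by simp
qed simp

lemma equiv_equiv_seq: "equiv (SP1w scl) (equiv_seq scl)"
proof (rule equiv_approx[where P = UNIV and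
        h = "\<lambda>x p. norm (\<Sum>i=1..fst p. scl (snd p i) (x i))"])
  show "(x, y) \<in> equiv_seq scl \<longleftrightarrow> x \<in> SP1w scl \<and> y \<in> SP1w scl \<and>
    (\<exists>K\<ge>1. \<forall>p\<in>UNIV. approx_within K
      (norm (\<Sum>i=1..fst p. scl (snd p i) (x i))) (norm (\<Sum>i=1..fst p. scl (snd p i) (y i))))" for x y
    unfolding equiv_seq_def
    by (simp only: split_paired_All mem_Collect_eq case_prod_conv fst_conv snd_conv ball_UNIV)
qed simp


section \<open>Strictly singular operators\<close>

definition infinite_dim_subspace :: "('k::real_or_complex \<Rightarrow> 'a::banach \<Rightarrow> 'a) \<Rightarrow> 'a set \<Rightarrow> bool" where
  "infinite_dim_subspace scl Y \<longleftrightarrow>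
    module.subspace scl Y \<and> \<not> (\<exists>B. finite B \<and> module.span scl B = Y)"

definition SS :: "('k::real_or_complex \<Rightarrow> 'a::banach \<Rightarrow> 'a) \<Rightarrow> ('a \<Rightarrow> 'a) set" where
  "SS scl = {T \<in> bounded_ops scl.
    \<forall>Y. infinite_dim_subspace scl Y \<longrightarrow> \<not> (\<exists>R. homeomorphism Y (T ` Y) T R)}"

definition SS_xi :: "('k::real_or_complex \<Rightarrow> 'a::banach \<Rightarrow> 'a) \<Rightarrow>
    ('o::wellorder \<Rightarrow> nat \<Rightarrow> 'o) \<Rightarrow> 'o \<Rightarrow> ('a \<Rightarrow> 'a) set" where
  "SS_xi scl u \<xi> = {T \<in> bounded_ops scl.
    \<forall>\<epsilon>>0. \<forall>x. basic_sequence scl x \<longrightarrow>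
      (\<exists>F\<in>schreier u \<xi>. \<exists>z\<in>closed_span scl (x ` F) - {0}. norm (T z) \<le> \<epsilon> * norm z)}"

end

theory Submission
  imports Defs "HOL-Library.Ramsey" "HOL-Library.Diagonal_Subsequence"
begin

text \<open>
  The argument is a pigeonhole principle. Suppose that \<open>T\<^sub>n \<cdots> T\<^sub>1\<close> is bounded below along a weakly
  null sequence \<open>y\<close>. Then so are the partial products, and the \<open>n + 1\<close> sequences
  \<open>T\<^sub>j \<cdots> T\<^sub>1 y\<close> with \<open>0 \<le> j \<le> n\<close> are weakly null and seminormalized. After passing to a common
  subsequence all of them are basic and Schreier spreading. If there are only \<open>n\<close> classes, two of
  the sequences are equivalent, say those for \<open>i < j\<close>. Then \<open>T\<^sub>j \<cdots> T\<^sub>i\<^sub>+\<^sub>1\<close>, and with it the factor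
  \<open>T\<^sub>i\<^sub>+\<^sub>1\<close>, is bounded below on the relevant linear combinations of the first of them. For the full
  equivalence this contradicts strict singularity, for \<open>\<approx>\<^sub>\<xi>\<close> it contradicts \<open>S\<^sub>\<xi>\<close>-strict
  singularity (\<open>op_product_not_bounded_below_on_weakly_null\<close>).

  Noncompactness has to be transformed into such a sequence \<open>y\<close>. A noncompact operator maps some
  sequence of the unit ball to a separated one. By Rosenthal's theorem (\<open>Rosenthal_ell1\<close>), applied
  to the images under \<open>S\<close> of that sequence, a subsequence is weakly Cauchy, and then differences of
  its terms serve as \<open>y\<close>, or it dominates the \<open>\<ell>\<^sub>1\<close>-norm. The latter is impossible if \<open>S\<close> is
  strictly singular, since \<open>S\<close> would be bounded below on a copy of \<open>\<ell>\<^sub>1\<close>, and, for \<open>S\<close> the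
  identity, if the space contains no such copy. In the second part of the theorem the innermost
  factor takes the role of \<open>S\<close>.

  The tools come from infinite Ramsey theory and elementary Banach space theory. Rosenthal's
  theorem rests on Nash-Williams' theorem on open partitions (\<open>open_Ramsey\<close>); it is proved over the
  real and the complex field at once by looking at the values of functionals in pairs of small discs.
  Basic subsequences are extracted by Mazur's construction (\<open>basic_subsequence\<close>), which requires
  norming functionals (\<open>norming_functional\<close>), and Schreier spreading ones by the theorem of Ramsey
  in the manner of Brunel and Sucheston (\<open>asymptotically_placed_subsequence\<close>).
\<close>


section \<open>Open sets of infinite subsets of the integers are Ramsey\<close>

definition has_initial_segment_in :: "nat set set \<Rightarrow> nat set \<Rightarrow> bool" where
  "has_initial_segment_in \<U> L \<longleftrightarrow> (\<exists>k. {x\<in>L. x < k} \<in> \<U>)"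

text \<open>
  Accepting is the forcing relation of the combinatorial proof of Nash-Williams' theorem: every
  infinite continuation of \<open>s\<close> inside \<open>M\<close> is caught by \<open>\<U>\<close> at some finite stage.
\<close>

definition accepts :: "nat set set \<Rightarrow> nat set \<Rightarrow> nat set \<Rightarrow> bool" where
  "accepts \<U> M s \<longleftrightarrow> (\<forall>L\<subseteq>M. infinite L \<and> set_less s L \<longrightarrow> has_initial_segment_in \<U> (s \<union> L))"

definition rejects :: "nat set set \<Rightarrow> nat set \<Rightarrow> nat set \<Rightarrow> bool" where
  "rejects \<U> M s \<longleftrightarrow> (\<forall>M'\<subseteq>M. infinite M' \<longrightarrow> \<not> accepts \<U> M' s)"

definition decides :: "nat set set \<Rightarrow> nat set \<Rightarrow> nat set \<Rightarrow> bool" where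
  "decides \<U> M s \<longleftrightarrow> accepts \<U> M s \<or> rejects \<U> M s"

lemma accepts_subset: "accepts \<U> M s \<Longrightarrow> M' \<subseteq> M \<Longrightarrow> accepts \<U> M' s"
  unfolding accepts_def by blast

lemma rejects_subset: "rejects \<U> M s \<Longrightarrow> M' \<subseteq> M \<Longrightarrow> rejects \<U> M' s"
  unfolding rejects_def by blast

lemma decides_subset: "decides \<U> M s \<Longrightarrow> M' \<subseteq> M \<Longrightarrow> decides \<U> M' s"
  unfolding decides_def using accepts_subset rejects_subset by blast

text \<open>
  Only the elements of \<open>M\<close> beyond \<open>s\<close> occur in continuations of \<open>s\<close>. Acceptance and rejection
  therefore survive adding small elements to \<open>M\<close>, which is what allows them to be arranged by a
  diagonal construction.
\<close>

lemma accepts_above: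
  assumes "accepts \<U> {x\<in>M. \<forall>y\<in>s. y < x} s" shows "accepts \<U> M s"
  unfolding accepts_def
proof (intro allI impI)
  fix L assume "L \<subseteq> M" and L: "infinite L \<and> set_less s L"
  then have "L \<subseteq> {x\<in>M. \<forall>y\<in>s. y < x}" by (auto simp: set_less_def)
  then show "has_initial_segment_in \<U> (s \<union> L)" using L assms unfolding accepts_def by blast
qed

lemma infinite_above:
  fixes M :: "nat set" assumes "infinite M" "finite s"
  shows "infinite {x\<in>M. \<forall>y\<in>s. y < x}"
proof -
  have "M \<subseteq> {x\<in>M. \<forall>y\<in>s. y < x} \<union> (\<Union>y\<in>s. {..y})" by (auto simp: not_less)
  then show ?thesis using assms by (meson finite_UN finite_Un finite_atMost finite_subset)
qed

lemma decides_above: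
  assumes "decides \<U> {x\<in>M. \<forall>y\<in>s. y < x} s" "finite s" shows "decides \<U> M s"
proof (cases "accepts \<U> M s")
  case False
  then have rej: "rejects \<U> {x\<in>M. \<forall>y\<in>s. y < x} s"
    using assms(1) accepts_above unfolding decides_def by blast
  have "rejects \<U> M s" unfolding rejects_def
  proof (intro allI impI notI)
    fix M' assume M': "M' \<subseteq> M" "infinite M'" "accepts \<U> M' s"
    define M'' where "M'' = {x\<in>M'. \<forall>y\<in>s. y < x}"
    have "accepts \<U> M'' s" using M'(3) by (rule accepts_subset) (auto simp: M''_def)
    moreover have "infinite M''" unfolding M''_def using M'(2) assms(2) by (rule infinite_above)
    moreover have "M'' \<subseteq> {x\<in>M. \<forall>y\<in>s. y < x}" using M'(1) by (auto simp: M''_def)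
    ultimately show False using rej unfolding rejects_def by blast
  qed
  then show ?thesis by (simp add: decides_def)
qed (simp add: decides_def)

lemma exists_deciding:
  assumes "infinite M" "finite \<S>"
  shows "\<exists>M'\<subseteq>M. infinite M' \<and> (\<forall>s\<in>\<S>. decides \<U> M' s)"
  using assms(2)
proof induction
  case empty
  then show ?case using assms(1) by auto
next
  case (insert s \<S>)
  then obtain M' where M': "M' \<subseteq> M" "infinite M'" "\<forall>s\<in>\<S>. decides \<U> M' s" by blast
  have "\<exists>M''\<subseteq>M'. infinite M'' \<and> decides \<U> M'' s"
  proof (cases "rejects \<U> M' s")
    case True
    then show ?thesis using M'(2) by (auto simp: decides_def)
  next
    case False
    then show ?thesis by (auto simp: decides_def rejects_def)
  qed
  then obtain M'' where M'': "M'' \<subseteq> M'" "infinite M''" "decides \<U> M'' s" by blast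
  then have "\<forall>t\<in>insert s \<S>. decides \<U> M'' t" using M'(3) decides_subset by blast
  then show ?case using M' M'' by blast
qed

text \<open>
  A fusion argument. In a decreasing sequence of infinite sets \<open>f n\<close>, let \<open>f (Suc n)\<close> lie above
  the minimum of \<open>f n\<close> and decide every subset of the integers up to that minimum. The set of
  all these minima decides each of its finite subsets \<open>s\<close>, because its part beyond \<open>Max s\<close> is
  contained in the set that was chosen to decide \<open>s\<close>.
\<close>

lemma exists_deciding_all:
  assumes "infinite N"
  shows "\<exists>M\<subseteq>N. infinite M \<and> (\<forall>s\<subseteq>M. finite s \<longrightarrow> decides \<U> M s)"
proof -
  define P where "P M \<longleftrightarrow> infinite M \<and> M \<subseteq> N \<and> decides \<U> M {}" for M
  define Q where "Q M M' \<longleftrightarrow> M' \<subseteq> M \<and> (\<forall>x\<in>M'. Inf M < x) \<and> (\<forall>s\<subseteq>{..Inf M}. decides \<U> M' s)" for M M'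
  obtain M0 where "M0 \<subseteq> N" "infinite M0" "\<forall>s\<in>{{}}. decides \<U> M0 s"
    using exists_deciding[OF assms, of "{{}}" \<U>] by blast
  then have start: "\<exists>M. P M" unfolding P_def by blast
  have step: "\<exists>M'. P M' \<and> Q M M'" if "P M" for M
  proof -
    have "infinite {x\<in>M. \<forall>y\<in>{Inf M}. y < x}"
      using that by (intro infinite_above) (simp_all add: P_def)
    from exists_deciding[OF this, of "Pow {..Inf M}" \<U>]
    obtain M' where "M' \<subseteq> {x\<in>M. \<forall>y\<in>{Inf M}. y < x}" "infinite M'" "\<forall>s\<in>Pow {..Inf M}. decides \<U> M' s"
      by auto
    then have "P M' \<and> Q M M'" using that unfolding P_def Q_def by auto
    then show ?thesis by blast
  qed
  have "\<exists>f. \<forall>n. P (f n) \<and> Q (f n) (f (Suc n))"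
    using start step by (intro dependent_nat_choice)
  then obtain f where f: "\<And>n. P (f n)" "\<And>n. Q (f n) (f (Suc n))" by auto
  define m where "m n = Inf (f n)" for n
  have mf: "m n \<in> f n" for n
    unfolding m_def using f(1)[of n] by (intro Inf_nat_def1) (auto simp: P_def)
  have dec: "f n \<subseteq> f k" if "k \<le> n" for k n
    by (rule lift_Suc_antimono_le[OF _ that]) (use f(2) in \<open>auto simp: Q_def\<close>)
  have mono: "strict_mono m"
    using f(2) mf by (auto simp: strict_mono_Suc_iff Q_def m_def)
  define M where "M = range m"
  have "M \<subseteq> N" using mf f(1) by (auto simp: M_def P_def)
  moreover have "infinite M" unfolding M_def using mono by (simp add: range_inj_infinite strict_mono_imp_inj_on)
  moreover have "decides \<U> M s" if s: "s \<subseteq> M" "finite s" for s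
  proof (cases "s = {}")
    case True
    have "M \<subseteq> f 0" using dec[of 0] mf by (auto simp: M_def)
    then show ?thesis using f(1)[of 0] True decides_subset unfolding P_def by blast
  next
    case False
    then have Max: "Max s \<in> s" using s by simp
    then have "Max s \<in> M" using s by auto
    then obtain n where n: "Max s = m n" by (auto simp: M_def)
    have "s \<subseteq> {..m n}" using s n[symmetric] by auto
    then have "decides \<U> (f (Suc n)) s" using f(2)[of n] by (simp add: Q_def m_def)
    moreover have "{x\<in>M. \<forall>y\<in>s. y < x} \<subseteq> f (Suc n)"
    proof
      fix x assume x: "x \<in> {x\<in>M. \<forall>y\<in>s. y < x}"
      then obtain k where k: "x = m k" by (auto simp: M_def)
      have "m n < m k" using x k n Max by auto
      then have "Suc n \<le> k" using mono by (simp add: strict_mono_less)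
      then show "x \<in> f (Suc n)" using dec mf k by blast
    qed
    ultimately have "decides \<U> {x\<in>M. \<forall>y\<in>s. y < x} s" by (rule decides_subset)
    then show ?thesis using s(2) by (rule decides_above)
  qed
  ultimately have "M \<subseteq> N \<and> infinite M \<and> (\<forall>s\<subseteq>M. finite s \<longrightarrow> decides \<U> M s)" by auto
  then show ?thesis by (rule exI)
qed

text \<open>
  A continuation \<open>L\<close> of \<open>s\<close> has a least element \<open>m\<close>, and the rest of \<open>L\<close> continues
  \<open>insert m s\<close>. This turns acceptance of all one-point extensions into acceptance of \<open>s\<close>.
\<close>

lemma accepts_one_point:
  assumes "infinite M'" "\<And>m. m \<in> M' \<Longrightarrow> (\<forall>y\<in>s. y < m) \<and> accepts \<U> M (insert m s)" "M' \<subseteq> M"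
  shows "accepts \<U> M' s"
  unfolding accepts_def
proof (intro allI impI)
  fix L assume "L \<subseteq> M'" and "infinite L \<and> set_less s L"
  then have L: "L \<subseteq> M'" "infinite L" by auto
  define m where "m = Inf L"
  have m: "m \<in> L" unfolding m_def using L by (intro Inf_nat_def1) auto
  have le: "m \<le> x" if "x \<in> L" for x unfolding m_def using that by (simp add: cInf_lower)
  have "accepts \<U> M (insert m s)" "\<forall>y\<in>s. y < m" using assms(2) m L(1) by auto
  moreover have "L - {m} \<subseteq> M" "infinite (L - {m})" using L assms(3) by auto
  moreover have "set_less (insert m s) (L - {m})"
    using le \<open>\<forall>y\<in>s. y < m\<close> by (force simp: set_less_def)
  ultimately have "has_initial_segment_in \<U> (insert m s \<union> (L - {m}))" unfolding accepts_def by blast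
  moreover have "insert m s \<union> (L - {m}) = s \<union> L" using m by auto
  ultimately show "has_initial_segment_in \<U> (s \<union> L)" by simp
qed

text \<open>
  Otherwise infinitely many one-point extensions would be accepted, and they would form a subset of
  \<open>M\<close> that accepts \<open>s\<close>.
\<close>

lemma rejects_almost_all:
  assumes "\<And>s. s \<subseteq> M \<Longrightarrow> finite s \<Longrightarrow> decides \<U> M s" "rejects \<U> M s" "s \<subseteq> M" "finite s"
  shows "finite {m\<in>M. \<not> rejects \<U> M (insert m s)}"
proof (rule ccontr)
  assume "infinite {m\<in>M. \<not> rejects \<U> M (insert m s)}"
  then have "infinite {m\<in>{m\<in>M. \<not> rejects \<U> M (insert m s)}. \<forall>y\<in>s. y < m}" (is "infinite ?M'")
    using assms(4) by (rule infinite_above)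
  moreover from this have "accepts \<U> ?M' s"
  proof (rule accepts_one_point)
    fix m assume m: "m \<in> ?M'"
    then have "decides \<U> M (insert m s)" using assms(3,4) by (intro assms(1)) auto
    then show "(\<forall>y\<in>s. y < m) \<and> accepts \<U> M (insert m s)" using m by (auto simp: decides_def)
  qed auto
  moreover have "?M' \<subseteq> M" by auto
  ultimately show False using assms(2) unfolding rejects_def by blast
qed

text \<open>
  Nash-Williams' theorem that open sets of infinite subsets of the integers are Ramsey. Inside a set
  \<open>M\<close> that decides all its finite subsets, either the empty set is accepted, which is the first
  alternative, or it is rejected. Rejection passes to almost all one-point extensions, so that a
  second fusion yields a set all of whose finite subsets are rejected; and a member of \<open>\<U>\<close> cannot
  be rejected, since it is an initial segment of each of its own continuations.
\<close>

theorem open_Ramsey: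
  assumes "infinite N"
  shows "\<exists>M\<subseteq>N. infinite M \<and>
    ((\<forall>L\<subseteq>M. infinite L \<longrightarrow> has_initial_segment_in \<U> L) \<or> (\<forall>s\<subseteq>M. finite s \<longrightarrow> s \<notin> \<U>))"
proof -
  obtain M where M: "M \<subseteq> N" "infinite M" "\<And>s. s \<subseteq> M \<Longrightarrow> finite s \<Longrightarrow> decides \<U> M s"
    using exists_deciding_all[OF assms, of \<U>] by blast
  show ?thesis
  proof (cases "accepts \<U> M {}")
    case True
    then show ?thesis using M by (auto simp: accepts_def set_less_def)
  next
    case False
    then have rej0: "rejects \<U> M {}" using M(3)[of "{}"] by (simp add: decides_def)
    define P :: "(nat \<Rightarrow> nat) \<Rightarrow> nat \<Rightarrow> nat \<Rightarrow> bool" where "P f n k \<longleftrightarrow> k \<in> M \<and> (\<forall>i<n. f i < k) \<and>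
      (\<forall>s\<subseteq>f ` {..<n}. rejects \<U> M s \<longrightarrow> rejects \<U> M (insert k s))" for f n k
    have "\<exists>f. \<forall>n. P f n (f n)"
    proof (rule dependent_wellorder_choice)
      show "P f n k = P g n k" if "\<And>i. i < n \<Longrightarrow> f i = g i" for f g n k
      proof -
        have "f ` {..<n} = g ` {..<n}" using that by auto
        then show ?thesis using that unfolding P_def by auto
      qed
    next
      fix n f assume IH: "\<And>i. i < n \<Longrightarrow> P f i (f i)"
      have sub: "f ` {..<n} \<subseteq> M" using IH by (auto simp: P_def)
      define B where "B = (\<Union>s\<in>{s\<in>Pow (f ` {..<n}). rejects \<U> M s}. {m\<in>M. \<not> rejects \<U> M (insert m s)})"
      have "finite B" unfolding B_def
        using sub by (intro finite_UN_I rejects_almost_all M(3)) (auto dest: finite_subset)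
      moreover have "infinite {x\<in>M. \<forall>y\<in>f ` {..<n}. y < x}" using M(2) by (intro infinite_above) auto
      ultimately have "infinite ({x\<in>M. \<forall>y\<in>f ` {..<n}. y < x} - B)" by auto
      then obtain k where k: "k \<in> {x\<in>M. \<forall>y\<in>f ` {..<n}. y < x} - B"
        using infinite_imp_nonempty by blast
      then have "P f n k" unfolding P_def B_def by auto
      then show "\<exists>k. P f n k" by blast
    qed
    then obtain f where f: "\<And>n. P f n (f n)" by blast
    have mono: "strict_mono f" using f by (auto simp: strict_mono_Suc_iff P_def)
    have rej: "\<forall>s\<subseteq>f ` {..<n}. rejects \<U> M s" for n
    proof (induction n)
      case (Suc n)
      show ?case
      proof (intro allI impI)
        fix s assume s: "s \<subseteq> f ` {..<Suc n}"
        have "s - {f n} \<subseteq> f ` {..<n}" using s by (auto simp: lessThan_Suc)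
        then have "rejects \<U> M (s - {f n})" using Suc by blast
        moreover from this have "rejects \<U> M (insert (f n) (s - {f n}))"
          using \<open>s - {f n} \<subseteq> f ` {..<n}\<close> f[of n] unfolding P_def by blast
        ultimately show "rejects \<U> M s" by (cases "f n \<in> s") (auto simp: insert_absorb)
      qed
    qed (use rej0 in auto)
    have "s \<notin> \<U>" if s: "s \<subseteq> range f" "finite s" for s
    proof
      assume "s \<in> \<U>"
      obtain C where "finite C" "s = f ` C" using finite_subset_image[OF s(2,1)] by blast
      then have "s \<subseteq> f ` {..<Suc (Max C)}" by (auto simp: less_Suc_eq_le)
      then have "rejects \<U> M s" using rej by blast
      moreover have "accepts \<U> M s" unfolding accepts_def
      proof (intro allI impI)
        fix L assume L: "L \<subseteq> M" "infinite L \<and> set_less s L"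
        then have "Inf L \<in> L" "\<forall>x\<in>L. Inf L \<le> x"
          by (auto intro!: Inf_nat_def1 cInf_lower)
        then have "{x \<in> s \<union> L. x < Inf L} = s" using L by (force simp: set_less_def)
        then show "has_initial_segment_in \<U> (s \<union> L)" using \<open>s \<in> \<U>\<close> unfolding has_initial_segment_in_def by metis
      qed
      ultimately show False using M(2) by (auto simp: rejects_def)
    qed
    moreover have "range f \<subseteq> M" using f by (auto simp: P_def)
    moreover have "infinite (range f)" using mono by (simp add: range_inj_infinite strict_mono_imp_inj_on)
    ultimately have "range f \<subseteq> N" "infinite (range f)" "\<forall>s\<subseteq>range f. finite s \<longrightarrow> s \<notin> \<U>"
      using M(1) by auto
    then show ?thesis by blast
  qed
qed


section \<open>Independent sequences of pairs of sets\<close>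

text \<open>
  Rosenthal's combinatorial lemma. Apply the Ramsey theorem to the
  finite sets \<open>H\<close> that admit no point lying alternately in \<open>A h\<close> and \<open>B h\<close> as \<open>h\<close> runs
  through \<open>H\<close>. The oscillation excludes that every infinite set has such an initial segment. So
  there is an infinite set on which all alternating patterns are realised, and prescribed patterns
  on every second element become alternating after the insertion of suitable elements in between.
\<close>

lemma independent_subsequence:
  fixes A B :: "nat \<Rightarrow> 'b set"
  assumes oscillates: "\<And>r::nat \<Rightarrow> nat. strict_mono r \<Longrightarrow> \<exists>t. infinite {n. t \<in> A (r n)} \<and> infinite {n. t \<in> B (r n)}"
  shows "\<exists>r::nat \<Rightarrow> nat. strict_mono r \<and> (\<forall>F N. \<exists>t. \<forall>n<N. t \<in> (if n \<in> F then A (r n) else B (r n)))"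
proof -
  define alternates where "alternates H t \<longleftrightarrow>
    (\<forall>h\<in>H. t \<in> (if even (card {x\<in>H. x < h}) then A h else B h))" for H :: "nat set" and t
  define \<U> where "\<U> = {H. finite H \<and> (\<forall>t. \<not> alternates H t)}"
  obtain M where M: "infinite M" "(\<forall>L\<subseteq>M. infinite L \<longrightarrow> has_initial_segment_in \<U> L) \<or> (\<forall>s\<subseteq>M. finite s \<longrightarrow> s \<notin> \<U>)"
    using open_Ramsey[of UNIV \<U>] by auto
  define m where "m = enumerate M"
  have m: "strict_mono m" "range m = M"
    using M(1) by (simp_all add: m_def strict_mono_enumerate range_enumerate)
  have "\<not> (\<forall>L\<subseteq>M. infinite L \<longrightarrow> has_initial_segment_in \<U> L)"
  proof
    assume hit: "\<forall>L\<subseteq>M. infinite L \<longrightarrow> has_initial_segment_in \<U> L"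
    obtain t where t: "infinite {n. t \<in> A (m n)}" "infinite {n. t \<in> B (m n)}"
      using oscillates[OF m(1)] by blast
    have "\<exists>g. \<forall>n. (t \<in> (if even n then A (m (g n)) else B (m (g n)))) \<and> g n < g (Suc n)"
    proof (rule dependent_nat_choice)
      show "\<exists>x. t \<in> (if even (0::nat) then A (m x) else B (m x))"
        using infinite_imp_nonempty[OF t(1)] by auto
    next
      fix x n :: nat
      have "\<exists>y>x. t \<in> A (m y)" "\<exists>y>x. t \<in> B (m y)"
        using t by (auto simp: infinite_nat_iff_unbounded)
      then show "\<exists>y. t \<in> (if even (Suc n) then A (m y) else B (m y)) \<and> x < y"
        by (cases "even n") auto
    qed
    then obtain g :: "nat \<Rightarrow> nat" where
      g': "\<forall>n. (t \<in> (if even n then A (m (g n)) else B (m (g n)))) \<and> g n < g (Suc n)" by blast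
    then have g: "\<And>n. t \<in> (if even n then A (m (g n)) else B (m (g n)))" "strict_mono g"
      unfolding strict_mono_Suc_iff by blast+
    define f where "f = m \<circ> g"
    have f: "strict_mono f" unfolding f_def using m(1) g(2) by (rule strict_mono_o)
    have "range f \<subseteq> M" using m(2) by (auto simp: f_def)
    moreover have "infinite (range f)"
      using f by (simp add: range_inj_infinite strict_mono_imp_inj_on)
    ultimately obtain k where k: "{x\<in>range f. x < k} \<in> \<U>" using hit unfolding has_initial_segment_in_def by auto
    have "alternates {x\<in>range f. x < k} t" unfolding alternates_def
    proof
      fix h assume "h \<in> {x\<in>range f. x < k}"
      then obtain i where i: "h = f i" "f i < k" by auto
      have "{x\<in>{x\<in>range f. x < k}. x < h} = f ` {..<i}"
        using f i order.strict_trans[OF strict_monoD[OF f] i(2)] by (auto simp: strict_mono_less)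
      moreover have "card (f ` {..<i}) = i"
        using f by (simp add: card_image strict_mono_imp_inj_on inj_on_subset)
      ultimately show "t \<in> (if even (card {x\<in>{x\<in>range f. x < k}. x < h}) then A h else B h)"
        using g(1)[of i] i by (auto simp: f_def split: if_splits)
    qed
    then show False using k by (auto simp: \<U>_def)
  qed
  then have all: "\<exists>t. alternates s t" if "s \<subseteq> M" "finite s" for s
    using M(2) that by (auto simp: \<U>_def)
  define r :: "nat \<Rightarrow> nat" where "r n = m (2 * n + 1)" for n
  have "\<exists>t. \<forall>n<N. t \<in> (if n \<in> F then A (r n) else B (r n))" for F N
  proof -
    have "\<exists>H\<subseteq>m ` {..<2*N}. \<forall>n<N. r n \<in> H \<and> (even (card {x\<in>H. x < r n}) \<longleftrightarrow> n \<in> F)"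
    proof (induction N)
      case (Suc N)
      then obtain H where H: "H \<subseteq> m ` {..<2*N}"
        "\<And>n. n < N \<Longrightarrow> r n \<in> H \<and> (even (card {x\<in>H. x < r n}) \<longleftrightarrow> n \<in> F)" by blast
      \<comment> \<open>The index \<open>m (2 * N)\<close> is inserted exactly if this is needed to bring \<open>r N\<close> into a
        position of the right parity.\<close>
      define E where "E = (if even (card H) \<longleftrightarrow> N \<in> F then {} else {m (2*N)})"
      define H' where "H' = insert (r N) (H \<union> E)"
      have less: "x < m (2*N)" if "x \<in> H" for x using that H(1) m(1) by (auto simp: strict_mono_less)
      have fin: "finite H" using H(1) finite_subset by blast
      have rN: "m (2*N) < r N" using m(1) by (simp add: r_def strict_mono_less)
      have new: "{x\<in>H'. x < r N} = H \<union> E" using less rN by (force simp: H'_def E_def)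
      have "card (H \<union> E) = (if even (card H) \<longleftrightarrow> N \<in> F then card H else Suc (card H))"
        using less[of "m (2*N)"] fin by (auto simp: E_def card_insert_if)
      then have "even (card {x\<in>H'. x < r N}) \<longleftrightarrow> N \<in> F" unfolding new by auto
      moreover have "r n \<in> H' \<and> (even (card {x\<in>H'. x < r n}) \<longleftrightarrow> n \<in> F)" if "n < N" for n
      proof -
        have "r n < m (2*N)" using H(2)[OF that] less by blast
        then have "{x\<in>H'. x < r n} = {x\<in>H. x < r n}" using rN by (auto simp: H'_def E_def)
        then show ?thesis using H(2)[OF that] by (simp add: H'_def)
      qed
      moreover have "r N \<in> H'" by (simp add: H'_def)
      ultimately have "\<forall>n<Suc N. r n \<in> H' \<and> (even (card {x\<in>H'. x < r n}) \<longleftrightarrow> n \<in> F)"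
        by (simp add: less_Suc_eq)
      moreover have "H' \<subseteq> m ` {..<2 * Suc N}" using H(1) by (auto simp: H'_def E_def r_def)
      ultimately show ?case by blast
    qed auto
    then obtain H where H: "H \<subseteq> m ` {..<2*N}"
      "\<And>n. n < N \<Longrightarrow> r n \<in> H \<and> (even (card {x\<in>H. x < r n}) \<longleftrightarrow> n \<in> F)" by blast
    have "finite H" "H \<subseteq> M" using H(1) finite_subset m(2) by blast+
    then obtain t where t: "alternates H t" using all by blast
    have "t \<in> (if n \<in> F then A (r n) else B (r n))" if "n < N" for n
    proof -
      have "t \<in> (if even (card {x\<in>H. x < r n}) then A (r n) else B (r n))"
        using bspec[OF t[unfolded alternates_def], of "r n"] H(2)[OF that] by blast
      then show ?thesis using H(2)[OF that] by simp
    qed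
    then show ?thesis by blast
  qed
  moreover have "strict_mono r" using m(1) by (simp add: r_def strict_mono_Suc_iff strict_mono_less)
  ultimately show ?thesis by blast
qed


section \<open>Nets and sums of scalars\<close>

text \<open>
  Real and imaginary part, with a vanishing imaginary part over the real field. Coordinates of this
  kind give total boundedness and completeness of the scalars without distinguishing the two fields.
\<close>

lemma scalar_parts:
  obtains p q :: "'k::real_or_complex \<Rightarrow> real" and i :: 'k
  where "\<And>z. z = of_real (p z) + of_real (q z) * i" "norm i = 1"
    "\<And>z. \<bar>p z\<bar> \<le> norm z" "\<And>z. \<bar>q z\<bar> \<le> norm z"
    "\<And>z w. \<bar>p z - p w\<bar> \<le> norm (z - w)" "\<And>z w. \<bar>q z - q w\<bar> \<le> norm (z - w)"
proof -
  consider "\<forall>z::'k. \<exists>a. z = a *\<^sub>R 1"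
    | j :: 'k where "\<forall>z. \<exists>a b. z = a *\<^sub>R 1 + b *\<^sub>R j"
       "\<forall>a b. norm (a *\<^sub>R 1 + b *\<^sub>R j) = sqrt (a\<^sup>2 + b\<^sup>2)"
    using real_or_complex by blast
  then show ?thesis
  proof cases
    case 1
    then obtain p where p: "\<And>z::'k. z = p z *\<^sub>R 1" by metis
    then have "\<bar>p z\<bar> \<le> norm z" for z by (metis norm_of_real of_real_def order_refl)
    moreover have "\<bar>p z - p w\<bar> \<le> norm (z - w)" for z w
    proof -
      have "z - w = of_real (p z - p w)"
        using p[of z] p[of w] by (metis of_real_def scaleR_left_diff_distrib)
      then show ?thesis by (metis norm_of_real order_refl)
    qed
    ultimately show ?thesis using p that[of p "\<lambda>_. 0" 1] by (simp add: of_real_def)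
  next
    case 2
    then obtain p q where pq: "\<And>z::'k. z = p z *\<^sub>R 1 + q z *\<^sub>R j" by metis
    have "norm z = sqrt ((p z)\<^sup>2 + (q z)\<^sup>2)" for z using pq[of z] 2(2) by metis
    then have "\<bar>p z\<bar> \<le> norm z" "\<bar>q z\<bar> \<le> norm z" for z
      by (simp_all add: real_sqrt_ge_abs1 real_sqrt_ge_abs2)
    moreover have "\<bar>p z - p w\<bar> \<le> norm (z - w)" "\<bar>q z - q w\<bar> \<le> norm (z - w)" for z w
    proof -
      have "z - w = (p z - p w) *\<^sub>R 1 + (q z - q w) *\<^sub>R j"
        using pq[of z] pq[of w] by (metis scaleR_left_diff_distrib add_diff_add)
      then have "norm (z - w) = sqrt ((p z - p w)\<^sup>2 + (q z - q w)\<^sup>2)" using 2(2) by metis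
      then show "\<bar>p z - p w\<bar> \<le> norm (z - w)" "\<bar>q z - q w\<bar> \<le> norm (z - w)"
        by (simp_all add: real_sqrt_ge_abs1 real_sqrt_ge_abs2)
    qed
    moreover have "norm j = 1" using 2(2)[rule_format, of 0 1] by simp
    ultimately show ?thesis using pq that[of p q j] by (simp add: scaleR_conv_of_real)
  qed
qed

lemma scalar_Cauchy_convergent:
  fixes s :: "nat \<Rightarrow> 'k::real_or_complex"
  assumes "Cauchy s" shows "convergent s"
proof -
  obtain p q :: "'k \<Rightarrow> real" and i :: 'k
    where pq: "\<And>z. z = of_real (p z) + of_real (q z) * i"
      "\<And>z w. \<bar>p z - p w\<bar> \<le> norm (z - w)" "\<And>z w. \<bar>q z - q w\<bar> \<le> norm (z - w)"
    by (rule scalar_parts) blast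
  have Cauchy: "Cauchy (\<lambda>n. h (s n))" if h: "\<And>z w. \<bar>h z - h w\<bar> \<le> norm (z - w)" for h :: "'k \<Rightarrow> real"
  proof (rule metric_CauchyI)
    fix e :: real assume "e > 0"
    then obtain N where "\<forall>m\<ge>N. \<forall>n\<ge>N. dist (s m) (s n) < e" using assms metric_CauchyD by blast
    then show "\<exists>N. \<forall>m\<ge>N. \<forall>n\<ge>N. dist (h (s m)) (h (s n)) < e"
      using h unfolding dist_norm real_norm_def by (meson order_le_less_trans)
  qed
  obtain P where P: "(\<lambda>n. p (s n)) \<longlonglongrightarrow> P"
    using Cauchy[of p] pq(2) by (auto simp: Cauchy_convergent_iff convergent_def)
  obtain Q where Q: "(\<lambda>n. q (s n)) \<longlonglongrightarrow> Q"
    using Cauchy[of q] pq(3) by (auto simp: Cauchy_convergent_iff convergent_def)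
  have "(\<lambda>n. of_real (p (s n)) + of_real (q (s n)) * i) \<longlonglongrightarrow> of_real P + of_real Q * i"
    by (intro tendsto_intros P Q)
  then have "s \<longlonglongrightarrow> of_real P + of_real Q * i" using pq(1) by simp
  then show ?thesis by (rule convergentI)
qed

lemma real_interval_net:
  assumes "\<eta> > 0" shows "\<exists>\<Lambda>. finite \<Lambda> \<and> (\<forall>x::real. \<bar>x\<bar> \<le> B \<longrightarrow> (\<exists>y\<in>\<Lambda>. \<bar>x - y\<bar> \<le> \<eta>))"
proof -
  have "compact {-B..B}" by simp
  then obtain k where "finite k" "{-B..B} \<subseteq> (\<Union>x\<in>k. ball x \<eta>)"
    using assms unfolding compact_eq_totally_bounded by blast
  moreover have "\<exists>y\<in>k. \<bar>x - y\<bar> \<le> \<eta>" if "\<bar>x\<bar> \<le> B" for x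
  proof -
    have "x \<in> {-B..B}" using that by auto
    then have "x \<in> (\<Union>x\<in>k. ball x \<eta>)" using \<open>{-B..B} \<subseteq> _\<close> by blast
    then obtain y where "y \<in> k" "dist y x < \<eta>" by auto
    then show ?thesis by (intro bexI[of _ y]) (simp_all add: dist_real_def abs_minus_commute)
  qed
  ultimately show ?thesis by blast
qed

lemma scalar_net:
  assumes "\<eta> > 0"
  shows "\<exists>\<Lambda>. finite \<Lambda> \<and> (\<forall>z::'k::real_or_complex. norm z \<le> B \<longrightarrow> (\<exists>w\<in>\<Lambda>. norm (z - w) \<le> \<eta>))"
proof -
  obtain p q :: "'k \<Rightarrow> real" and i :: 'k
    where pq: "\<And>z. z = of_real (p z) + of_real (q z) * i" "norm i = 1"
      "\<And>z. \<bar>p z\<bar> \<le> norm z" "\<And>z. \<bar>q z\<bar> \<le> norm z"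
    by (rule scalar_parts) blast
  obtain \<Lambda> where L: "finite \<Lambda>" "\<And>x::real. \<bar>x\<bar> \<le> B \<Longrightarrow> \<exists>y\<in>\<Lambda>. \<bar>x - y\<bar> \<le> \<eta>/2"
    using real_interval_net[of "\<eta>/2" B] assms by auto
  let ?N = "(\<lambda>(a, b). of_real a + of_real b * i) ` (\<Lambda> \<times> \<Lambda>)"
  have "\<exists>w\<in>?N. norm (z - w) \<le> \<eta>" if "norm z \<le> B" for z
  proof -
    have "\<bar>p z\<bar> \<le> B" "\<bar>q z\<bar> \<le> B" using pq(3,4)[of z] that by linarith+
    then obtain a b where ab: "a \<in> \<Lambda>" "b \<in> \<Lambda>" "\<bar>p z - a\<bar> \<le> \<eta>/2" "\<bar>q z - b\<bar> \<le> \<eta>/2"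
      using L(2) by blast
    have "z - (of_real a + of_real b * i) = of_real (p z - a) + of_real (q z - b) * i"
      using pq(1)[of z] by (simp add: algebra_simps)
    then have "norm (z - (of_real a + of_real b * i)) \<le> \<bar>p z - a\<bar> + \<bar>q z - b\<bar>"
      using norm_triangle_ineq[of "of_real (p z - a)" "of_real (q z - b) * i"] pq(2)
      by (simp only: norm_mult norm_of_real mult_1_right)
    then show ?thesis using ab by force
  qed
  then show ?thesis using L(1) by (intro exI[of _ ?N]) auto
qed

text \<open>
  This takes the place of the compactness of balls in finite-dimensional spaces, both in Mazur's
  construction and in the colouring argument for Schreier spreading sequences.
\<close>

lemma coefficient_net:
  assumes "\<eta> > 0"
  shows "\<exists>A. finite A \<and> (\<forall>a::nat \<Rightarrow> 'k::real_or_complex. (\<forall>i<n. norm (a i) \<le> B) \<longrightarrow>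
    (\<exists>b\<in>A. \<forall>i<n. norm (a i - b i) \<le> \<eta>))"
proof -
  obtain \<Lambda> where L: "finite \<Lambda>" "\<And>z::'k. norm z \<le> B \<Longrightarrow> \<exists>w\<in>\<Lambda>. norm (z - w) \<le> \<eta>"
    using scalar_net[OF assms, of B] by blast
  then obtain g where g: "\<And>z::'k. norm z \<le> B \<Longrightarrow> g z \<in> \<Lambda> \<and> norm (z - g z) \<le> \<eta>" by metis
  have "\<exists>b\<in>{..<n} \<rightarrow>\<^sub>E \<Lambda>. \<forall>i<n. norm (a i - b i) \<le> \<eta>" if "\<forall>i<n. norm (a i) \<le> B" for a :: "nat \<Rightarrow> 'k"
    using that g by (intro bexI[of _ "restrict (g \<circ> a) {..<n}"]) auto
  then show ?thesis using L(1) by (intro exI[of _ "{..<n} \<rightarrow>\<^sub>E \<Lambda>"] conjI finite_PiE) auto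
qed

lemma real_subset_sum:
  fixes r :: "'i \<Rightarrow> real"
  assumes "finite I"
  shows "\<exists>E\<subseteq>I. (\<Sum>i\<in>I. \<bar>r i\<bar>) \<le> 2 * \<bar>\<Sum>i\<in>E. r i\<bar>"
proof -
  define P where "P = {i\<in>I. r i \<ge> 0}"
  have "(\<Sum>i\<in>I. \<bar>r i\<bar>) = (\<Sum>i\<in>I - P. \<bar>r i\<bar>) + (\<Sum>i\<in>P. \<bar>r i\<bar>)"
    using assms by (intro sum.subset_diff) (auto simp: P_def)
  also have "(\<Sum>i\<in>I - P. \<bar>r i\<bar>) = - (\<Sum>i\<in>I - P. r i)"
    unfolding sum_negf[symmetric] by (intro sum.cong) (auto simp: P_def)
  also have "(\<Sum>i\<in>P. \<bar>r i\<bar>) = (\<Sum>i\<in>P. r i)" by (intro sum.cong) (auto simp: P_def)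
  finally have "(\<Sum>i\<in>I. \<bar>r i\<bar>) \<le> 2 * \<bar>\<Sum>i\<in>P. r i\<bar> \<or> (\<Sum>i\<in>I. \<bar>r i\<bar>) \<le> 2 * \<bar>\<Sum>i\<in>I - P. r i\<bar>"
    by linarith
  moreover have "P \<subseteq> I" "I - P \<subseteq> I" by (auto simp: P_def)
  ultimately show ?thesis by blast
qed

text \<open>
  The real and the imaginary parts of a family of scalars split into positive and negative ones. One
  of the four subfamilies carries at least a quarter of the sum of the absolute values, and there is
  no cancellation in it.
\<close>

lemma scalar_subset_sum:
  fixes b :: "'i \<Rightarrow> 'k::real_or_complex"
  assumes "finite I"
  shows "\<exists>E\<subseteq>I. (\<Sum>i\<in>I. norm (b i)) \<le> 4 * norm (\<Sum>i\<in>E. b i)"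
proof -
  consider "\<forall>z::'k. \<exists>a. z = a *\<^sub>R 1"
    | j :: 'k where "\<forall>z. \<exists>a b. z = a *\<^sub>R 1 + b *\<^sub>R j"
       "\<forall>a b. norm (a *\<^sub>R 1 + b *\<^sub>R j) = sqrt (a\<^sup>2 + b\<^sup>2)"
    using real_or_complex by blast
  then show ?thesis
  proof cases
    case 1
    then obtain p where p: "\<And>z::'k. z = p z *\<^sub>R 1" by metis
    have n: "norm (r *\<^sub>R (1::'k)) = \<bar>r\<bar>" for r by simp
    obtain E where E: "E \<subseteq> I" "(\<Sum>i\<in>I. \<bar>p (b i)\<bar>) \<le> 2 * \<bar>\<Sum>i\<in>E. p (b i)\<bar>"
      using real_subset_sum[OF assms, of "\<lambda>i. p (b i)"] by blast
    have "norm (b i) = \<bar>p (b i)\<bar>" for i by (metis n p)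
    moreover have "(\<Sum>i\<in>E. b i) = (\<Sum>i\<in>E. p (b i)) *\<^sub>R 1"
      unfolding scaleR_left.sum using p by (intro sum.cong) auto
    ultimately have "(\<Sum>i\<in>I. norm (b i)) \<le> 4 * norm (\<Sum>i\<in>E. b i)" using E(2) by (simp add: n)
    then show ?thesis using E(1) by blast
  next
    case 2
    then obtain p q where pq: "\<And>z::'k. z = p z *\<^sub>R 1 + q z *\<^sub>R j" by metis
    have n: "norm (b i) \<le> \<bar>p (b i)\<bar> + \<bar>q (b i)\<bar>" for i
      by (metis pq 2(2) sqrt_sum_squares_le_sum_abs)
    have sum: "norm (\<Sum>i\<in>E. b i) = sqrt ((\<Sum>i\<in>E. p (b i))\<^sup>2 + (\<Sum>i\<in>E. q (b i))\<^sup>2)" for E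
    proof -
      have "(\<Sum>i\<in>E. b i) = (\<Sum>i\<in>E. p (b i) *\<^sub>R 1 + q (b i) *\<^sub>R j)" using pq by (intro sum.cong) auto
      also have "\<dots> = (\<Sum>i\<in>E. p (b i)) *\<^sub>R 1 + (\<Sum>i\<in>E. q (b i)) *\<^sub>R j"
        by (simp only: sum.distrib scaleR_left.sum)
      finally show ?thesis using 2(2) by simp
    qed
    have le: "\<bar>\<Sum>i\<in>E. p (b i)\<bar> \<le> norm (\<Sum>i\<in>E. b i)" "\<bar>\<Sum>i\<in>E. q (b i)\<bar> \<le> norm (\<Sum>i\<in>E. b i)" for E
      unfolding sum by (simp_all add: real_sqrt_ge_abs1 real_sqrt_ge_abs2)
    have "(\<Sum>i\<in>I. norm (b i)) \<le> (\<Sum>i\<in>I. \<bar>p (b i)\<bar>) + (\<Sum>i\<in>I. \<bar>q (b i)\<bar>)"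
      unfolding sum.distrib[symmetric] by (intro sum_mono n)
    moreover obtain E where "E \<subseteq> I" "(\<Sum>i\<in>I. \<bar>p (b i)\<bar>) \<le> 2 * \<bar>\<Sum>i\<in>E. p (b i)\<bar>"
      using real_subset_sum[OF assms, of "\<lambda>i. p (b i)"] by blast
    moreover obtain E' where "E' \<subseteq> I" "(\<Sum>i\<in>I. \<bar>q (b i)\<bar>) \<le> 2 * \<bar>\<Sum>i\<in>E'. q (b i)\<bar>"
      using real_subset_sum[OF assms, of "\<lambda>i. q (b i)"] by blast
    ultimately have "(\<Sum>i\<in>I. norm (b i)) \<le> 4 * norm (\<Sum>i\<in>E. b i) \<or>
        (\<Sum>i\<in>I. norm (b i)) \<le> 4 * norm (\<Sum>i\<in>E'. b i)"
      using le(1)[of E] le(2)[of E'] by linarith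
    then show ?thesis using \<open>E \<subseteq> I\<close> \<open>E' \<subseteq> I\<close> by blast
  qed
qed


section \<open>The Hahn--Banach theorem\<close>

definition sublinear :: "('a::real_vector \<Rightarrow> real) \<Rightarrow> bool" where
  "sublinear p \<longleftrightarrow> (\<forall>x y. p (x + y) \<le> p x + p y) \<and> (\<forall>t\<ge>0. \<forall>x. p (t *\<^sub>R x) \<le> t * p x)"

lemma sublinear_zero: assumes "sublinear p" shows "p 0 = 0"
proof -
  have "p (0 + 0) \<le> p 0 + p 0" "p (0 *\<^sub>R 0) \<le> 0 * p 0"
    using assms unfolding sublinear_def by blast+
  then show ?thesis by simp
qed

lemma sublinear_uminus: assumes "sublinear p" shows "- p (- x) \<le> p x"
proof -
  have "p (x + - x) \<le> p x + p (- x)" using assms unfolding sublinear_def by blast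
  then show ?thesis using sublinear_zero[OF assms] by simp
qed

text \<open>
  This covers the two infima that are needed: along a chain of sublinear functionals, and over
  translates of a single one.
\<close>

lemma sublinear_Inf:
  fixes q :: "'i \<Rightarrow> 'a::real_vector \<Rightarrow> real"
  assumes "I \<noteq> {}"
    and below: "\<And>i x. i \<in> I \<Longrightarrow> l x \<le> q i x"
    and sub: "\<And>i j x y. i \<in> I \<Longrightarrow> j \<in> I \<Longrightarrow> \<exists>k\<in>I. q k (x + y) \<le> q i x + q j y"
    and hom: "\<And>i t x. i \<in> I \<Longrightarrow> t \<ge> 0 \<Longrightarrow> \<exists>k\<in>I. q k (t *\<^sub>R x) \<le> t * q i x"
    and zero: "\<And>e. e > 0 \<Longrightarrow> \<exists>k\<in>I. q k 0 < e"
  shows "sublinear (\<lambda>x. INF i\<in>I. q i x)" "\<And>i x. i \<in> I \<Longrightarrow> (INF i\<in>I. q i x) \<le> q i x"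
proof -
  let ?u = "\<lambda>x. INF i\<in>I. q i x"
  show le: "?u x \<le> q i x" if "i \<in> I" for i x
    using that below by (intro cINF_lower bdd_belowI2[of _ "l x"]) auto
  have "?u (x + y) \<le> ?u x + ?u y" for x y
  proof -
    have "?u (x + y) \<le> q i x + q j y" if ij: "i \<in> I" "j \<in> I" for i j
      using sub[OF ij] le order_trans by blast
    then have "?u (x + y) - q i x \<le> q j y" if "i \<in> I" "j \<in> I" for i j
      using that by (simp add: algebra_simps)
    then have "?u (x + y) - q i x \<le> ?u y" if "i \<in> I" for i
      using assms(1) that by (intro cINF_greatest)
    then have "?u (x + y) - ?u y \<le> q i x" if "i \<in> I" for i
      using that by (simp add: algebra_simps)
    then have "?u (x + y) - ?u y \<le> ?u x" using assms(1) by (intro cINF_greatest)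
    then show ?thesis by simp
  qed
  moreover have "?u (t *\<^sub>R x) \<le> t * ?u x" if "t \<ge> 0" for t x
  proof (cases "t = 0")
    case True
    have "?u 0 \<le> 0"
    proof (rule field_le_epsilon)
      fix e :: real assume "e > 0"
      then show "?u 0 \<le> 0 + e" using zero[of e] le[of _ 0] by force
    qed
    then show ?thesis using True by simp
  next
    case False
    have "?u (t *\<^sub>R x) \<le> t * q i x" if "i \<in> I" for i
      using hom[OF that \<open>t \<ge> 0\<close>] le order_trans by blast
    then have "?u (t *\<^sub>R x) / t \<le> ?u x"
      using assms(1) False that by (intro cINF_greatest) (auto simp: field_simps)
    then show ?thesis using False that by (simp add: field_simps)
  qed
  ultimately show "sublinear ?u" unfolding sublinear_def by blast
qed

text \<open>
  The functional \<open>q x = (INF t\<in>{0..}. p (x + t *\<^sub>R z) - t * p z)\<close>. Taking \<open>t = 0\<close> gives \<open>q \<le> p\<close>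
  and \<open>t = 1\<close> gives the value at \<open>- z\<close>.
\<close>

lemma sublinear_lowering:
  fixes p :: "'a::real_vector \<Rightarrow> real"
  assumes "sublinear p"
  shows "\<exists>q. sublinear q \<and> (\<forall>x. q x \<le> p x) \<and> q (- z) \<le> - p z"
proof -
  define r where "r t x = p (x + t *\<^sub>R z) - t * p z" for t x
  have p: "p (x + y) \<le> p x + p y" "t \<ge> 0 \<Longrightarrow> p (t *\<^sub>R x) \<le> t * p x" for t x y
    using assms unfolding sublinear_def by blast+
  have "- p (- x) \<le> r t x" if "t \<ge> 0" for t x
  proof (cases "t = 0")
    case True then show ?thesis using sublinear_uminus[OF assms] by (simp add: r_def)
  next
    case False
    have "p z \<le> inverse t * p (t *\<^sub>R z)" using p(2)[of "inverse t" "t *\<^sub>R z"] that False by simp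
    then have "t * p z \<le> p (t *\<^sub>R z)" using that False by (simp add: field_simps)
    also have "\<dots> \<le> p (x + t *\<^sub>R z) + p (- x)" using p(1)[of "x + t *\<^sub>R z" "- x"] by simp
    finally show ?thesis by (simp add: r_def)
  qed
  moreover have "\<exists>k\<in>{0..}. r k (x + y) \<le> r s x + r t y" if "s \<in> {0..}" "t \<in> {0..}" for s t x y
    using that p(1)[of "x + s *\<^sub>R z" "y + t *\<^sub>R z"]
    by (intro bexI[of _ "s + t"]) (simp_all add: r_def algebra_simps)
  moreover have "\<exists>k\<in>{0..}. r k (t *\<^sub>R x) \<le> t * r s x" if "s \<in> {0..}" "t \<ge> 0" for s t x
    using that p(2)[of t "x + s *\<^sub>R z"]
    by (intro bexI[of _ "t * s"]) (simp_all add: r_def algebra_simps)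
  moreover have "\<exists>k\<in>{0..}. r k 0 < e" if "e > 0" for e
    using that sublinear_zero[OF assms] by (intro bexI[of _ 0]) (simp_all add: r_def)
  ultimately have "sublinear (\<lambda>x. INF t\<in>{0..}. r t x)"
    and le: "\<And>t x. t \<in> {0..} \<Longrightarrow> (INF t\<in>{0..}. r t x) \<le> r t x"
    using sublinear_Inf[of "{0..}" "\<lambda>x. - p (- x)" r] by auto
  moreover have "(INF t\<in>{0..}. r t x) \<le> p x" for x using le[of 0 x] by (simp add: r_def)
  moreover have "(INF t\<in>{0..}. r t (- z)) \<le> - p z"
    using le[of 1 "- z"] sublinear_zero[OF assms] by (simp add: r_def)
  ultimately show ?thesis by blast
qed

text \<open>
  By Zorn's lemma there is a minimal sublinear functional below \<open>p\<close>. Lowering it in an arbitrary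
  direction \<open>z\<close> does not change it, so that its value at \<open>- z\<close> is minus its value at \<open>z\<close>; and an
  odd sublinear functional is linear.
\<close>

theorem Hahn_Banach_sublinear:
  fixes p :: "'a::real_vector \<Rightarrow> real"
  assumes "sublinear p"
  shows "\<exists>f. linear f \<and> (\<forall>x. f x \<le> p x)"
proof -
  define A where "A = {q. sublinear q \<and> (\<forall>x. q x \<le> p x)}"
  define P where "P a b \<longleftrightarrow> (\<forall>x. b x \<le> a x)" for a b :: "'a \<Rightarrow> real"
  have "\<exists>m\<in>A. \<forall>a\<in>A. P m a \<longrightarrow> a = m"
  proof (rule predicate_Zorn)
    show "partial_order_on A (relation_of P A)"
      by (rule partial_order_on_relation_ofI) (auto simp: P_def fun_eq_iff intro: order_trans antisym)
  next
    fix C assume C: "C \<in> Chains (relation_of P A)"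
    then have CA: "C \<subseteq> A" using Chains_relation_of by blast
    have chain: "P a b \<or> P b a" if "a \<in> C" "b \<in> C" for a b
      using C that by (auto simp: Chains_def relation_of_def)
    show "\<exists>u\<in>A. \<forall>a\<in>C. P a u"
    proof (cases "C = {}")
      case True
      then show ?thesis using assms by (intro bexI[of _ p]) (auto simp: A_def)
    next
      case False
      have q: "q (x + y) \<le> q x + q y" "t \<ge> 0 \<Longrightarrow> q (t *\<^sub>R x) \<le> t * q x"
        "- p (- x) \<le> q x" "q 0 = 0" "q x \<le> p x" if "q \<in> C" for q x y t
      proof -
        have s: "sublinear q" "\<And>x. q x \<le> p x" using that CA by (auto simp: A_def)
        show "q (x + y) \<le> q x + q y" "t \<ge> 0 \<Longrightarrow> q (t *\<^sub>R x) \<le> t * q x"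
          using s(1) unfolding sublinear_def by blast+
        show "- p (- x) \<le> q x" using sublinear_uminus[OF s(1), of x] s(2)[of "- x"] by linarith
        show "q 0 = 0" "q x \<le> p x" using sublinear_zero s by auto
      qed
      have "\<exists>k\<in>C. k (x + y) \<le> a x + b y" if "a \<in> C" "b \<in> C" for a b x y
      proof (cases "P a b")
        case True
        then have "b x \<le> a x" by (simp add: P_def)
        then have "b (x + y) \<le> a x + b y" using q(1)[OF that(2), of x y] by linarith
        then show ?thesis using that by blast
      next
        case False
        then have "a y \<le> b y" using chain[OF that] by (auto simp: P_def)
        then have "a (x + y) \<le> a x + b y" using q(1)[OF that(1), of x y] by linarith
        then show ?thesis using that by blast
      qed
      moreover have hom: "\<exists>k\<in>C. k (t *\<^sub>R x) \<le> t * q x" if "q \<in> C" "t \<ge> 0" for q t x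
        using q(2)[OF that] that(1) by blast
      moreover have "\<exists>k\<in>C. k 0 < e" if "e > 0" for e using False q(4) that by force
      ultimately have "sublinear (\<lambda>x. INF q\<in>C. q x)"
        and le: "\<And>q x. q \<in> C \<Longrightarrow> (INF q\<in>C. q x) \<le> q x"
        using sublinear_Inf[of C "\<lambda>x. - p (- x)" "\<lambda>q. q"] False hom q(3) by auto
      moreover have "(INF q\<in>C. q x) \<le> p x" for x
        using False le q(5) by (meson ex_in_conv order_trans)
      ultimately show ?thesis
        by (intro bexI[of _ "\<lambda>x. INF q\<in>C. q x"]) (auto simp: A_def P_def)
    qed
  qed
  then obtain m where m: "sublinear m" "\<And>x. m x \<le> p x" and min: "\<And>a. a \<in> A \<Longrightarrow> P m a \<Longrightarrow> a = m"
    by (auto simp: A_def)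
  have sub: "m (x + y) \<le> m x + m y" "t \<ge> 0 \<Longrightarrow> m (t *\<^sub>R x) \<le> t * m x" for t x y
    using m(1) unfolding sublinear_def by blast+
  have odd: "m (- z) = - m z" for z
  proof -
    obtain q where q: "sublinear q" "\<And>x. q x \<le> m x" "q (- z) \<le> - m z"
      using sublinear_lowering[OF m(1)] by blast
    have "q \<in> A" using q m(2) unfolding A_def by (auto intro: order_trans)
    then have "q = m" using min q(2) by (auto simp: P_def)
    then have "m (- z) \<le> - m z" using q(3) by simp
    then show ?thesis using sublinear_uminus[OF m(1), of z] by linarith
  qed
  have "linear m"
  proof (rule linearI)
    show "m (x + y) = m x + m y" for x y
      using sub(1)[of x y] sub(1)[of "- x" "- y"] odd[of x] odd[of y] odd[of "x + y"] by simp
    have pos: "m (t *\<^sub>R x) = t * m x" if "t \<ge> 0" for t x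
      using sub(2)[OF that, of x] sub(2)[OF that, of "- x"] odd[of x] odd[of "t *\<^sub>R x"] by simp
    show "m (t *\<^sub>R x) = t *\<^sub>R m x" for t x
    proof (cases "t \<ge> 0")
      case False
      then have "m ((- t) *\<^sub>R x) = (- t) * m x" by (intro pos) simp
      then show ?thesis using odd[of "t *\<^sub>R x"] by simp
    qed (simp add: pos)
  qed
  then show ?thesis using m(2) by blast
qed

text \<open>
  First lower the norm in the direction \<open>e\<close>: every linear functional below the result is at most
  \<open>- norm e\<close> at \<open>- e\<close>.
\<close>

lemma real_norming_functional:
  fixes e :: "'a::real_normed_vector"
  shows "\<exists>g. linear g \<and> (\<forall>x. g x \<le> norm x) \<and> norm e \<le> g e"
proof -
  have "sublinear (norm :: 'a \<Rightarrow> real)" by (simp add: sublinear_def norm_triangle_ineq)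
  from sublinear_lowering[OF this, of e]
  obtain q where q: "sublinear q" "\<And>x :: 'a. q x \<le> norm x" "q (- e) \<le> - norm e" by blast
  obtain g where g: "linear g" "\<And>x. g x \<le> q x" using Hahn_Banach_sublinear[OF q(1)] by blast
  have "norm e \<le> g e" using g(2)[of "- e"] q(3) linear_neg[OF g(1)] by simp
  then show ?thesis using g q(2) order_trans by blast
qed

context banach_over
begin

lemma scl_linearI:
  "(\<And>x y. f (x + y) = f x + f y) \<Longrightarrow> (\<And>c x. f (scl c x) = c * f x) \<Longrightarrow> Vector_Spaces.linear scl (*) f"
  unfolding Vector_Spaces.linear_iff
  using vector_space_axioms by (auto intro!: vector_space.intro simp: algebra_simps)

lemma dual_spaceI:
  fixes f :: "'a \<Rightarrow> 'k"
  assumes "\<And>x y. f (x + y) = f x + f y" "\<And>c x. f (scl c x) = c * f x" "\<And>x. norm (f x) \<le> norm x * K"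
  shows "f \<in> dual_space scl"
proof -
  have "bounded_linear f"
    by (rule bounded_linear_intro[where K = K])
      (use assms in \<open>simp_all add: scl_of_real[symmetric] scaleR_conv_of_real\<close>)
  then show ?thesis using scl_linearI assms(1,2) by (auto simp: dual_space_def)
qed

text \<open>
  Over the complex field, a real functional \<open>g\<close> determines a complex-linear one by \<open>f x = g x - \<i> g (\<i> x)\<close>. It has the same
  norm as \<open>g\<close>, because a unimodular factor makes \<open>f x\<close> real, and then \<open>f x\<close> is a value of \<open>g\<close>.
\<close>

theorem norming_functional:
  "\<exists>f\<in>dual_space scl. (\<forall>x. norm (f x) \<le> norm x) \<and> norm e \<le> norm (f e)"
proof -
  obtain g :: "'a \<Rightarrow> real" where g: "linear g" "\<And>x. g x \<le> norm x" "norm e \<le> g e"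
    using real_norming_functional by blast
  have gabs: "\<bar>g x\<bar> \<le> norm x" for x
    using g(2)[of x] g(2)[of "- x"] linear_neg[OF g(1), of x] by simp
  have add: "g (x + y) = g x + g y" and scale: "g (r *\<^sub>R x) = r * g x" for x y r
    using g(1) by (simp_all add: linear_add linear_scale)
  consider "\<forall>z::'k. \<exists>a. z = a *\<^sub>R 1"
    | j :: 'k where "j * j = -1" "\<forall>z. \<exists>a b. z = a *\<^sub>R 1 + b *\<^sub>R j"
       "\<forall>a b. norm (a *\<^sub>R 1 + b *\<^sub>R j) = sqrt (a\<^sup>2 + b\<^sup>2)"
    using real_or_complex by blast
  then show ?thesis
  proof cases
    case 1
    define f :: "'a \<Rightarrow> 'k" where "f x = of_real (g x)" for x
    have "f (scl c x) = c * f x" for c x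
    proof -
      obtain a where "c = of_real a" using 1 by (metis scaleR_conv_of_real mult_1_right)
      then show ?thesis by (simp add: f_def scl_of_real scale)
    qed
    then have "f \<in> dual_space scl"
      using gabs by (intro dual_spaceI[where K = 1]) (simp_all add: f_def add)
    moreover have "norm e \<le> norm (f e)" using g(3) by (simp add: f_def)
    ultimately show ?thesis using gabs by (intro bexI[of _ f]) (simp_all add: f_def)
  next
    case 2
    define f :: "'a \<Rightarrow> 'k" where "f x = of_real (g x) - j * of_real (g (scl j x))" for x
    have norm_j: "norm (of_real a + of_real b * j) = sqrt (a\<^sup>2 + b\<^sup>2)" for a b
      using 2(3)[rule_format, of a b] by (simp add: scaleR_conv_of_real)
    have norm_f: "norm (f x) = sqrt ((g x)\<^sup>2 + (g (scl j x))\<^sup>2)" for x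
      using norm_j[of "g x" "- g (scl j x)"] by (simp add: f_def mult.commute)
    have f_add: "f (x + y) = f x + f y" for x y
      by (simp add: f_def add scale_right_distrib algebra_simps)
    have f_scale: "f (scl c x) = c * f x" for c x
    proof -
      obtain a b where c: "c = of_real a + of_real b * j"
        using 2(2) by (metis scaleR_conv_of_real mult_1_right)
      have "scl c x = a *\<^sub>R x + b *\<^sub>R scl j x"
        by (simp add: c scale_left_distrib scl_of_real flip: scale_scale)
      moreover have "scl j (scl c x) = a *\<^sub>R scl j x - b *\<^sub>R x"
      proof -
        have "j * c = of_real a * j + of_real b * (j * j)" by (simp add: c algebra_simps)
        then have "j * c = of_real a * j + of_real (- b)" using 2(1) by simp
        then have "scl (j * c) x = a *\<^sub>R scl j x + (- b) *\<^sub>R x"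
          by (simp only: scale_left_distrib scl_of_real flip: scale_scale)
        then show ?thesis by simp
      qed
      ultimately have gs: "g (scl c x) = a * g x + b * g (scl j x)"
        "g (scl j (scl c x)) = a * g (scl j x) - b * g x"
        using add[of "a *\<^sub>R scl j x" "- (b *\<^sub>R x)"] scale[of "- b" x] by (simp_all add: add scale)
      have "c * f x = of_real a * of_real (g x) - j * (of_real a * of_real (g (scl j x)))
          + j * (of_real b * of_real (g x)) - (j * j) * (of_real b * of_real (g (scl j x)))"
        unfolding f_def c by (simp add: algebra_simps)
      then show ?thesis unfolding f_def gs 2(1) by (simp add: algebra_simps)
    qed
    have f_le: "norm (f x) \<le> norm x" for x
    proof (cases "f x = 0")
      case False
      define u where "u = of_real (norm (f x)) / f x"
      have "norm u = 1" using False by (simp add: u_def norm_divide)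
      have "of_real (norm (f x)) = f (scl u x)" using False by (simp add: f_scale u_def)
      then have "of_real (g (scl u x) - norm (f x)) + of_real (- g (scl j (scl u x))) * j = 0"
        by (simp add: f_def[of "scl u x"] mult.commute)
      then have "sqrt ((g (scl u x) - norm (f x))\<^sup>2 + (- g (scl j (scl u x)))\<^sup>2) = 0"
        using norm_j by (metis norm_zero)
      then have "norm (f x) = g (scl u x)" by (simp add: sum_power2_eq_zero_iff)
      also have "\<dots> \<le> norm x" using g(2)[of "scl u x"] \<open>norm u = 1\<close> by (simp add: norm_scl)
      finally show ?thesis .
    qed simp
    have "norm e \<le> \<bar>g e\<bar>" using g(3) by simp
    also have "\<dots> \<le> norm (f e)" unfolding norm_f by (rule real_sqrt_ge_abs1)
    finally show ?thesis
      using f_le dual_spaceI[of f 1] f_add f_scale by (intro bexI[of _ f]) simp_all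
  qed
qed

end


section \<open>Rosenthal's theorem\<close>

lemma infinite_preimage_strict_mono:
  fixes r :: "nat \<Rightarrow> nat"
  assumes "strict_mono r" "infinite {n. Q (r n)}" shows "infinite {n. Q n}"
proof
  assume "finite {n. Q n}"
  then have "finite (r ` {n. Q (r n)})" by (rule finite_subset[rotated]) auto
  moreover have "inj_on r {n. Q (r n)}" using assms(1) strict_mono_imp_inj_on inj_on_subset by blast
  ultimately show False using assms(2) finite_imageD by blast
qed

lemma infinite_tail:
  assumes "infinite {n::nat. Q n}" shows "infinite {n. Q (k + n)}"
proof
  assume "finite {n. Q (k + n)}"
  moreover have "{n. Q n} \<subseteq> {..<k} \<union> (+) k ` {n. Q (k + n)}"
  proof
    fix n assume "n \<in> {n. Q n}"
    then show "n \<in> {..<k} \<union> (+) k ` {n. Q (k + n)}"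
      by (cases "n < k") (auto intro!: image_eqI[of _ _ "n - k"])
  qed
  ultimately have "finite {n. Q n}" using finite_subset by blast
  with assms show False by simp
qed

text \<open>
  Infinitely many terms lie in one disc of the \<open>k\<close>-th net. Only finitely many lie in a disc of this
  net far away from it, hence almost all terms are close to its centre.
\<close>

lemma Cauchy_if_no_two_discs:
  fixes s :: "nat \<Rightarrow> 'k::real_or_complex"
  assumes net: "\<And>k. finite (\<Lambda> k)" "\<And>k n. \<exists>w\<in>\<Lambda> k. norm (s n - w) \<le> 1 / Suc k"
    and discs: "\<And>k z w. z \<in> \<Lambda> k \<Longrightarrow> w \<in> \<Lambda> k \<Longrightarrow> 10 / Suc k \<le> norm (z - w) \<Longrightarrow>
      \<not> (infinite {n. norm (s n - z) \<le> 1 / Suc k} \<and> infinite {n. norm (s n - w) \<le> 1 / Suc k})"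
  shows "Cauchy s"
proof (rule metric_CauchyI)
  fix e :: real assume "e > 0"
  then obtain k where k: "inverse (Suc k) < e / 22" using reals_Archimedean[of "e / 22"] by auto
  define \<eta> where "\<eta> = 1 / real (Suc k)"
  have \<eta>: "\<eta> > 0" "22 * \<eta> < e" using k by (auto simp: \<eta>_def field_simps)
  have "\<exists>z\<in>\<Lambda> k. infinite {n. norm (s n - z) \<le> \<eta>}"
  proof (rule ccontr)
    assume "\<not> ?thesis"
    then have "finite (\<Union>z\<in>\<Lambda> k. {n. norm (s n - z) \<le> \<eta>})" using net(1) by auto
    moreover have "(\<Union>z\<in>\<Lambda> k. {n. norm (s n - z) \<le> \<eta>}) = UNIV" using net(2)[of k] by (auto simp: \<eta>_def)
    ultimately show False by simp
  qed
  then obtain z where z: "z \<in> \<Lambda> k" "infinite {n. norm (s n - z) \<le> \<eta>}" by blast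
  define B where "B = (\<Union>w\<in>{w\<in>\<Lambda> k. 10 * \<eta> \<le> norm (z - w)}. {n. norm (s n - w) \<le> \<eta>})"
  have "finite B" unfolding B_def
  proof (rule finite_UN_I)
    show "finite {n. norm (s n - w) \<le> \<eta>}" if "w \<in> {w\<in>\<Lambda> k. 10 * \<eta> \<le> norm (z - w)}" for w
      using discs[OF z(1), of w] z(2) that by (simp add: \<eta>_def)
  qed (simp add: net(1))
  then obtain N where N: "\<And>n. n \<in> B \<Longrightarrow> n < N" using finite_nat_set_iff_bounded by metis
  have near: "norm (s n - z) < 11 * \<eta>" if "n \<ge> N" for n
  proof -
    obtain w where w: "w \<in> \<Lambda> k" "norm (s n - w) \<le> \<eta>" using net(2)[of k n] by (auto simp: \<eta>_def)
    have "n \<notin> B" using that N[of n] by linarith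
    then have "norm (z - w) < 10 * \<eta>" using w by (auto simp: B_def not_le)
    moreover have "norm (s n - z) \<le> norm (s n - w) + norm (z - w)"
      using norm_triangle_ineq4[of "s n - w" "z - w"] by simp
    ultimately show ?thesis using w(2) by linarith
  qed
  have "dist (s m) (s n) < e" if "m \<ge> N" "n \<ge> N" for m n
  proof -
    have "dist (s m) (s n) \<le> norm (s m - z) + norm (s n - z)"
      using norm_triangle_ineq4[of "s m - z" "s n - z"] by (simp add: dist_norm)
    then show ?thesis using near[OF that(1)] near[OF that(2)] \<eta>(2) by linarith
  qed
  then show "\<exists>N. \<forall>m\<ge>N. \<forall>n\<ge>N. dist (s m) (s n) < e" by blast
qed

context banach_over
begin

definition dual_ball :: "('a \<Rightarrow> 'k) set" where
  "dual_ball = {f\<in>dual_space scl. \<forall>x. norm (f x) \<le> norm x}"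

definition weakly_Cauchy :: "(nat \<Rightarrow> 'a) \<Rightarrow> bool" where
  "weakly_Cauchy x \<longleftrightarrow> (\<forall>f\<in>dual_space scl. Cauchy (\<lambda>n. f (x n)))"

definition dominates_ell1 :: "(nat \<Rightarrow> 'a) \<Rightarrow> bool" where
  "dominates_ell1 x \<longleftrightarrow>
    (\<exists>c>0. \<forall>N a. c * (\<Sum>i<N. norm (a i)) \<le> norm (\<Sum>i<N. scl (a i) (x i)))"

lemma dual_sum:
  assumes "f \<in> dual_space scl"
  shows "f (\<Sum>i\<in>I. scl (a i) (x i)) = (\<Sum>i\<in>I. a i * f (x i))"
proof -
  interpret f: Vector_Spaces.linear scl "(*)" f using assms by (simp add: dual_space_def)
  show ?thesis by (simp add: f.sum f.scale)
qed

lemma dual_scale_in_ball: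
  assumes "f \<in> dual_space scl"
  shows "\<exists>g\<in>dual_ball. \<exists>K. \<forall>x. f x = of_real K * g x"
proof -
  interpret f: Vector_Spaces.linear scl "(*)" f using assms by (simp add: dual_space_def)
  have "bounded_linear f" using assms by (simp add: dual_space_def)
  then obtain K where K: "K > 0" "\<And>x. norm (f x) \<le> norm x * K" using bounded_linear.pos_bounded by blast
  define g where "g x = of_real (1 / K) * f x" for x
  have le: "norm (g x) \<le> norm x" for x
    using K(1) K(2)[of x] by (simp add: g_def norm_mult norm_divide field_simps)
  have "g \<in> dual_space scl"
    by (rule dual_spaceI[where K = 1]) (use le in \<open>auto simp: g_def f.add f.scale algebra_simps\<close>)
  then show ?thesis using le K(1)
    by (intro bexI[of _ g] exI[of _ K]) (auto simp: dual_ball_def g_def)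
qed

text \<open>
  The complex form of Rosenthal's argument, due to Dor: the pairs of half-lines that suffice for real
  functions are replaced by pairs of discs, small in comparison with their distance. On an
  independent subsequence, given coefficients \<open>a\<close>, choose a set \<open>E\<close> of indices on which
  \<open>a i * (z - w)\<close> hardly cancels, a functional \<open>f\<close> that sends the vectors with index in \<open>E\<close> close to
  \<open>z\<close> and the others close to \<open>w\<close>, and a functional \<open>g\<close> that sends all of them close to \<open>w\<close>. The
  difference \<open>f - g\<close> shows that the linear combination is large.
\<close>

lemma two_discs_ell1:
  fixes x :: "nat \<Rightarrow> 'a" and z w :: 'k
  assumes "\<eta> > 0" "10 * \<eta> \<le> norm (z - w)"
    and osc: "\<And>r::nat \<Rightarrow> nat. strict_mono r \<Longrightarrow> \<exists>f\<in>dual_ball.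
      infinite {n. norm (f (x (r n)) - z) \<le> \<eta>} \<and> infinite {n. norm (f (x (r n)) - w) \<le> \<eta>}"
  shows "\<exists>r::nat \<Rightarrow> nat. strict_mono r \<and> dominates_ell1 (x \<circ> r)"
proof -
  define A where "A n = {f\<in>dual_ball. norm (f (x n) - z) \<le> \<eta>}" for n
  define B where "B n = {f\<in>dual_ball. norm (f (x n) - w) \<le> \<eta>}" for n
  have "\<exists>f. infinite {n. f \<in> A (r n)} \<and> infinite {n. f \<in> B (r n)}" if r: "strict_mono r" for r :: "nat \<Rightarrow> nat"
  proof -
    obtain f where "f \<in> dual_ball" "infinite {n. norm (f (x (r n)) - z) \<le> \<eta>}"
        "infinite {n. norm (f (x (r n)) - w) \<le> \<eta>}" using osc[OF r] by blast
    then show ?thesis by (intro exI[of _ f]) (simp add: A_def B_def)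
  qed
  from independent_subsequence[of A B, OF this] obtain r :: "nat \<Rightarrow> nat" where r: "strict_mono r"
    "\<And>F N. \<exists>f. \<forall>n<N. f \<in> (if n \<in> F then A (r n) else B (r n))" by blast
  \<comment> \<open>With \<open>S\<close> the sum of the \<open>norm (a i)\<close> and \<open>v\<close> the combination, the estimates below give
    \<open>10 * \<eta> * S \<le> 4 * (2 * norm v + 2 * \<eta> * S)\<close>, whence the constant.\<close>
  have "\<eta> / 4 * (\<Sum>i<N. norm (a i)) \<le> norm (\<Sum>i<N. scl (a i) (x (r i)))" for N a
  proof -
    define v where "v = (\<Sum>i<N. scl (a i) (x (r i)))"
    define S where "S = (\<Sum>i<N. norm (a i))"
    obtain E where E: "E \<subseteq> {..<N}"
      "(\<Sum>i<N. norm (a i * (z - w))) \<le> 4 * norm (\<Sum>i\<in>E. a i * (z - w))"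
      using scalar_subset_sum[of "{..<N}" "\<lambda>i. a i * (z - w)"] by auto
    obtain f where f: "\<And>n. n < Suc N \<Longrightarrow> f \<in> (if n \<in> E then A (r n) else B (r n))"
      using r(2)[of "Suc N" E] by blast
    obtain g where g: "\<And>n. n < Suc N \<Longrightarrow> g \<in> B (r n)" using r(2)[of "Suc N" "{}"] by auto
    have ball: "f \<in> dual_ball" "g \<in> dual_ball"
      using f[of 0] g[of 0] by (auto simp: A_def B_def split: if_splits)
    define e where "e i = f (x (r i)) - g (x (r i)) - (if i \<in> E then z - w else 0)" for i
    have e: "norm (e i) \<le> 2 * \<eta>" if "i < N" for i
    proof -
      have "norm (f (x (r i)) - (if i \<in> E then z else w)) \<le> \<eta>" "norm (g (x (r i)) - w) \<le> \<eta>"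
        using f[of i] g[of i] that by (auto simp: A_def B_def split: if_splits)
      moreover have "e i = (f (x (r i)) - (if i \<in> E then z else w)) - (g (x (r i)) - w)"
        by (simp add: e_def)
      moreover from this have "norm (e i) \<le> norm (f (x (r i)) - (if i \<in> E then z else w)) + norm (g (x (r i)) - w)"
        by (simp only: norm_triangle_ineq4)
      ultimately show ?thesis by linarith
    qed
    have "f v - g v = (\<Sum>i<N. a i * (f (x (r i)) - g (x (r i))))"
    proof -
      have "f v = (\<Sum>i<N. a i * f (x (r i)))" "g v = (\<Sum>i<N. a i * g (x (r i)))"
        unfolding v_def by (rule dual_sum; use ball in \<open>simp add: dual_ball_def\<close>)+
      then show ?thesis by (simp add: sum_subtractf right_diff_distrib)
    qed
    also have "\<dots> = (\<Sum>i<N. a i * e i) + (\<Sum>i<N. if i \<in> E then a i * (z - w) else 0)"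
      unfolding sum.distrib[symmetric] by (intro sum.cong) (auto simp: e_def algebra_simps)
    also have "(\<Sum>i<N. if i \<in> E then a i * (z - w) else 0) = (\<Sum>i\<in>E. a i * (z - w))"
      using E(1) by (simp add: sum.inter_restrict[symmetric] Int_absorb1)
    finally have "(\<Sum>i\<in>E. a i * (z - w)) = f v - g v - (\<Sum>i<N. a i * e i)" by simp
    then have "norm (\<Sum>i\<in>E. a i * (z - w)) \<le> norm (f v - g v) + norm (\<Sum>i<N. a i * e i)"
      using norm_triangle_ineq4 by metis
    moreover have "norm (f v - g v) \<le> 2 * norm v"
    proof -
      have "norm (f v) \<le> norm v" "norm (g v) \<le> norm v" using ball by (auto simp: dual_ball_def)
      then show ?thesis using norm_triangle_ineq4[of "f v" "g v"] by linarith
    qed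
    moreover have "norm (\<Sum>i<N. a i * e i) \<le> 2 * (\<eta> * S)"
    proof -
      have "norm (\<Sum>i<N. a i * e i) \<le> (\<Sum>i<N. norm (a i) * (2 * \<eta>))"
        using e by (intro sum_norm_le) (simp add: norm_mult mult_left_mono)
      then show ?thesis by (simp add: S_def sum_distrib_left mult_ac)
    qed
    moreover have "10 * (\<eta> * S) \<le> (\<Sum>i<N. norm (a i * (z - w)))"
    proof -
      have "(10 * \<eta>) * norm (a i) \<le> norm (a i * (z - w))" for i
        using mult_right_mono[OF assms(2) norm_ge_zero[of "a i"]] by (simp add: norm_mult mult.commute)
      then have "(\<Sum>i<N. (10 * \<eta>) * norm (a i)) \<le> (\<Sum>i<N. norm (a i * (z - w)))" by (rule sum_mono)
      then show ?thesis by (simp add: S_def sum_distrib_left mult.assoc)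
    qed
    ultimately have "\<eta> * S \<le> 4 * norm v" using E(2) by argo
    then show ?thesis by (simp add: v_def S_def)
  qed
  then have "dominates_ell1 (x \<circ> r)"
    using assms(1) unfolding dominates_ell1_def by (intro exI[of _ "\<eta> / 4"]) auto
  then show ?thesis using r(1) by blast
qed

text \<open>
  Rosenthal's dichotomy. Consider pairs of distant discs of radius \<open>1 / Suc k\<close> whose centres belong
  to a finite net of this mesh; there are countably many of them. If, for one of the
  pairs, there is a subsequence such that along each of its subsequences some functional oscillates
  between the two discs, the previous lemma applies. Otherwise there is a diagonal subsequence along which no functional of the
  dual ball oscillates between the discs of any pair, and all functionals are Cauchy along it.
\<close>

theorem Rosenthal_ell1:
  fixes x :: "nat \<Rightarrow> 'a"
  assumes bounded: "\<And>n. norm (x n) \<le> M"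
  shows "\<exists>r::nat \<Rightarrow> nat. strict_mono r \<and> (weakly_Cauchy (x \<circ> r) \<or> dominates_ell1 (x \<circ> r))"
proof -
  have "\<forall>k. \<exists>\<Lambda>. finite \<Lambda> \<and> (\<forall>z::'k. norm z \<le> M \<longrightarrow> (\<exists>w\<in>\<Lambda>. norm (z - w) \<le> 1 / Suc k))"
    by (intro allI scalar_net) simp
  then obtain \<Lambda> :: "nat \<Rightarrow> 'k set" where net: "\<And>k. finite (\<Lambda> k)"
    "\<And>k z. norm z \<le> M \<Longrightarrow> \<exists>w\<in>\<Lambda> k. norm (z - w) \<le> 1 / Suc k" by metis
  define D where "D = (\<Union>k. {k} \<times> {p\<in>\<Lambda> k \<times> \<Lambda> k. 10 / Suc k \<le> norm (fst p - snd p)})"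
  have cD: "countable D" unfolding D_def using net(1) by (intro countable_UN countable_SIGMA) (auto intro: countable_finite)
  define near where "near s f k z = {n. norm (f (x (s n)) - z) \<le> 1 / real (Suc k)}"
    for s :: "nat \<Rightarrow> nat" and f :: "'a \<Rightarrow> 'k" and k z
  define good where "good p s \<longleftrightarrow> (\<forall>f\<in>dual_ball.
      \<not> (infinite (near s f (fst p) (fst (snd p))) \<and> infinite (near s f (fst p) (snd (snd p)))))"
    for p :: "nat \<times> 'k \<times> 'k" and s
  show ?thesis
  proof (cases "\<forall>p\<in>D. \<forall>s::nat \<Rightarrow> nat. strict_mono s \<longrightarrow> (\<exists>r::nat \<Rightarrow> nat. strict_mono r \<and> good p (s \<circ> r))")
    case False
    then obtain p and s :: "nat \<Rightarrow> nat" where p: "p \<in> D" "strict_mono s"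
      "\<And>r::nat \<Rightarrow> nat. strict_mono r \<Longrightarrow> \<not> good p (s \<circ> r)" by blast
    obtain k z w where kzw: "p = (k, z, w)" by (cases p)
    have "\<exists>r::nat \<Rightarrow> nat. strict_mono r \<and> dominates_ell1 ((x \<circ> s) \<circ> r)"
    proof (rule two_discs_ell1)
      show "10 * (1 / real (Suc k)) \<le> norm (z - w)" using p(1) kzw by (auto simp: D_def)
      show "\<exists>f\<in>dual_ball. infinite {n. norm (f ((x \<circ> s) (r n)) - z) \<le> 1 / real (Suc k)} \<and>
          infinite {n. norm (f ((x \<circ> s) (r n)) - w) \<le> 1 / real (Suc k)}" if "strict_mono r" for r :: "nat \<Rightarrow> nat"
        using p(3)[OF that] kzw by (auto simp: good_def near_def)
    qed simp
    then obtain r :: "nat \<Rightarrow> nat" where "strict_mono r" "dominates_ell1 (x \<circ> (s \<circ> r))" by (auto simp: o_assoc)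
    then show ?thesis using strict_mono_o[OF p(2)] by blast
  next
    case True
    define P where "P j s \<longleftrightarrow> (from_nat_into D j \<in> D \<longrightarrow> good (from_nat_into D j) s)" for j s
    interpret subseqs P
    proof
      fix n and s :: "nat \<Rightarrow> nat" assume s: "strict_mono s"
      show "\<exists>r'. strict_mono r' \<and> P n (s \<circ> r')"
      proof (cases "from_nat_into D n \<in> D")
        case in_D: True
        then show ?thesis using True s unfolding P_def by blast
      next
        case False
        then show ?thesis using s unfolding P_def by blast
      qed
    qed
    have stable: "good p (s \<circ> r)" if "strict_mono r" "good p s" for p s and r :: "nat \<Rightarrow> nat"
      unfolding good_def
    proof (intro ballI)
      fix f assume "f \<in> dual_ball"
      then have *: "\<not> (infinite (near s f (fst p) (fst (snd p))) \<and> infinite (near s f (fst p) (snd (snd p))))"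
        using that(2) by (simp add: good_def)
      have "infinite (near s f k z)" if "infinite (near (s \<circ> r) f k z)" for k z
        using infinite_preimage_strict_mono[OF \<open>strict_mono r\<close>] that by (simp add: near_def)
      then show "\<not> (infinite (near (s \<circ> r) f (fst p) (fst (snd p))) \<and>
          infinite (near (s \<circ> r) f (fst p) (snd (snd p))))"
        using * by blast
    qed
    have holds: "P j (diagseq \<circ> (+) (Suc j))" for j
      by (rule diagseq_holds) (use stable in \<open>auto simp: P_def\<close>)
    have good: "good p diagseq" if "p \<in> D" for p
    proof -
      obtain j where j: "p = from_nat_into D j" using from_nat_into_surj[OF cD \<open>p \<in> D\<close>] by metis
      then have g: "good p (diagseq \<circ> (+) (Suc j))" using holds[of j] that by (simp add: P_def)
      show ?thesis unfolding good_def
      proof (intro ballI)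
        fix f assume "f \<in> dual_ball"
        then have *: "\<not> (infinite (near (diagseq \<circ> (+) (Suc j)) f (fst p) (fst (snd p))) \<and>
            infinite (near (diagseq \<circ> (+) (Suc j)) f (fst p) (snd (snd p))))"
          using g unfolding good_def by blast
        have "infinite (near (diagseq \<circ> (+) (Suc j)) f k z)" if "infinite (near diagseq f k z)" for k z
          using infinite_tail[OF that[unfolded near_def], of "Suc j"] by (simp add: near_def)
        then show "\<not> (infinite (near diagseq f (fst p) (fst (snd p))) \<and>
            infinite (near diagseq f (fst p) (snd (snd p))))" using * by blast
      qed
    qed
    have ball: "Cauchy (\<lambda>n. f (x (diagseq n)))" if f: "f \<in> dual_ball" for f
    proof (rule Cauchy_if_no_two_discs[where \<Lambda> = \<Lambda>])
      show "\<exists>w\<in>\<Lambda> k. norm (f (x (diagseq n)) - w) \<le> 1 / real (Suc k)" for k n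
        using f bounded[of "diagseq n"] by (intro net(2)) (auto simp: dual_ball_def intro: order_trans)
      show "\<not> (infinite {n. norm (f (x (diagseq n)) - z) \<le> 1 / real (Suc k)} \<and>
          infinite {n. norm (f (x (diagseq n)) - w) \<le> 1 / real (Suc k)})"
        if "z \<in> \<Lambda> k" "w \<in> \<Lambda> k" "10 / real (Suc k) \<le> norm (z - w)" for k z w
      proof -
        have "(k, z, w) \<in> D" using that by (auto simp: D_def)
        then show ?thesis using good[of "(k, z, w)"] f by (auto simp: good_def near_def)
      qed
    qed (rule net(1))
    have "Cauchy (\<lambda>n. f (x (diagseq n)))" if f: "f \<in> dual_space scl" for f
    proof -
      obtain g K where "g \<in> dual_ball" "\<And>x. f x = of_real K * g x" using dual_scale_in_ball[OF f] by blast
      then show ?thesis using bounded_linear.Cauchy[OF bounded_linear_mult_right ball] by simp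
    qed
    then have "weakly_Cauchy (x \<circ> diagseq)" by (simp add: weakly_Cauchy_def)
    then show ?thesis using subseq_diagseq by blast
  qed
qed

end


section \<open>Basic sequences\<close>

context banach_over
begin

text \<open>
  Grunblum's inequality: the partial sum projections are bounded by \<open>K\<close>. Together with a lower bound
  for the norms it implies the defining property of basic sequences. In contrast to that property, it
  visibly passes to subsequences.
\<close>

definition basic_with_const :: "real \<Rightarrow> (nat \<Rightarrow> 'a) \<Rightarrow> bool" where
  "basic_with_const K x \<longleftrightarrow> (\<forall>a m n. m \<le> n \<longrightarrow>
    norm (\<Sum>i<m. scl (a i) (x i)) \<le> K * norm (\<Sum>i<n. scl (a i) (x i)))"

lemma basic_with_constD:
  "basic_with_const K x \<Longrightarrow> m \<le> n \<Longrightarrow>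
    norm (\<Sum>i<m. scl (a i) (x i)) \<le> K * norm (\<Sum>i<n. scl (a i) (x i))"
  unfolding basic_with_const_def by blast

lemma coefficient_bound:
  fixes x :: "nat \<Rightarrow> 'a"
  assumes "\<And>m. m \<le> n \<Longrightarrow> norm (\<Sum>i<m. scl (a i) (x i)) \<le> K * norm (\<Sum>i<n. scl (a i) (x i))"
    and "i < n" "\<delta> \<le> norm (x i)"
  shows "norm (a i) * \<delta> \<le> 2 * K * norm (\<Sum>i<n. scl (a i) (x i))"
proof -
  have "norm (a i) * \<delta> \<le> norm (scl (a i) (x i))"
    using assms(3) by (simp add: norm_scl mult_left_mono)
  also have "scl (a i) (x i) = (\<Sum>i<Suc i. scl (a i) (x i)) - (\<Sum>i<i. scl (a i) (x i))" by simp
  also have "norm \<dots> \<le> norm (\<Sum>i<Suc i. scl (a i) (x i)) + norm (\<Sum>i<i. scl (a i) (x i))"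
    by (rule norm_triangle_ineq4)
  finally show ?thesis using assms(1)[of "Suc i"] assms(1)[of i] assms(2) by simp
qed

lemma sum_reindex_strict_mono:
  fixes x :: "nat \<Rightarrow> 'a" and a :: "nat \<Rightarrow> 'k" and \<phi> :: "nat \<Rightarrow> nat"
  assumes "strict_mono \<phi>"
  defines "b \<equiv> \<lambda>j. if j \<in> range \<phi> then a (inv \<phi> j) else 0"
  shows "(\<Sum>j<\<phi> m. scl (b j) (x j)) = (\<Sum>i<m. scl (a i) (x (\<phi> i)))"
proof -
  have inj: "inj \<phi>" using assms(1) by (rule strict_mono_imp_inj_on)
  have "(\<Sum>j<\<phi> m. scl (b j) (x j)) = (\<Sum>j\<in>\<phi> ` {..<m}. scl (b j) (x j))"
  proof (rule sum.mono_neutral_right)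
    show "\<phi> ` {..<m} \<subseteq> {..<\<phi> m}" using assms(1) by (auto simp: strict_mono_less)
    show "\<forall>j\<in>{..<\<phi> m} - \<phi> ` {..<m}. scl (b j) (x j) = 0"
    proof
      fix j assume j: "j \<in> {..<\<phi> m} - \<phi> ` {..<m}"
      then have "j \<notin> range \<phi>" using assms(1) by (auto simp: strict_mono_less)
      then show "scl (b j) (x j) = 0" by (simp add: b_def)
    qed
  qed simp
  also have "\<dots> = (\<Sum>i<m. scl (b (\<phi> i)) (x (\<phi> i)))"
    using inj by (simp add: sum.reindex inj_on_subset)
  also have "\<dots> = (\<Sum>i<m. scl (a i) (x (\<phi> i)))" using inj by (simp add: b_def)
  finally show ?thesis .
qed

lemma basic_with_const_subseq:
  assumes "basic_with_const K x" "strict_mono \<phi>"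
  shows "basic_with_const K (x \<circ> \<phi>)"
  unfolding basic_with_const_def
proof (intro allI impI)
  fix a and m n :: nat assume "m \<le> n"
  then have "\<phi> m \<le> \<phi> n" using assms(2) by (simp add: strict_mono_less_eq)
  from basic_with_constD[OF assms(1) this] sum_reindex_strict_mono[OF assms(2)]
  show "norm (\<Sum>i<m. scl (a i) ((x \<circ> \<phi>) i)) \<le> K * norm (\<Sum>i<n. scl (a i) ((x \<circ> \<phi>) i))"
    unfolding comp_def by metis
qed

lemma span_range_sums:
  fixes z :: "nat \<Rightarrow> 'a"
  assumes "y \<in> span (range z)"
  shows "\<exists>a N. \<forall>n\<ge>N. y = (\<Sum>i<n. scl (a i) (z i))"
  using assms
proof (induction rule: span_induct_alt)
  case base
  show ?case by (intro exI[of _ "\<lambda>_. 0"]) simp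
next
  case (step c v y)
  then obtain j a N where v: "v = z j" and y: "\<And>n. n \<ge> N \<Longrightarrow> y = (\<Sum>i<n. scl (a i) (z i))" by auto
  have "scl c v + y = (\<Sum>i<n. scl (a i + (if i = j then c else 0)) (z i))" if "n \<ge> max N (Suc j)" for n
  proof -
    have "(\<Sum>i<n. scl (a i + (if i = j then c else 0)) (z i)) =
        (\<Sum>i<n. scl (a i) (z i)) + (\<Sum>i<n. if i = j then scl c (z j) else 0)"
      unfolding sum.distrib[symmetric] by (intro sum.cong) (auto simp: scale_left_distrib)
    then show ?thesis using that y[of n] v by (simp add: add.commute)
  qed
  then show ?case by (intro exI[of _ "\<lambda>i. a i + (if i = j then c else 0)"] exI[of _ "max N (Suc j)"]) blast
qed

lemma tendsto_scl:
  fixes v :: 'a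
  assumes "s \<longlonglongrightarrow> c" shows "(\<lambda>k::nat. scl (s k) v) \<longlonglongrightarrow> scl c v"
proof -
  have "norm (scl (s k) v - scl c v) = norm (s k - c) * norm v" for k
    by (simp add: norm_scl flip: scale_left_diff_distrib)
  moreover have "(\<lambda>k. norm (s k - c) * norm v) \<longlonglongrightarrow> 0"
    using tendsto_mult_left_zero[OF tendsto_norm_zero[OF LIM_zero[OF assms]]] .
  ultimately have "(\<lambda>k. norm (scl (s k) v - scl c v)) \<longlonglongrightarrow> 0" by simp
  then have "(\<lambda>k. scl (s k) v - scl c v) \<longlonglongrightarrow> 0" by (rule tendsto_norm_zero_cancel)
  then show ?thesis by (simp add: LIM_zero_iff)
qed

lemma basic_unique_expansion:
  fixes z :: "nat \<Rightarrow> 'a"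
  assumes basic: "basic_with_const K z" and \<delta>: "\<delta> > 0" "\<And>n. \<delta> \<le> norm (z n)"
    and "(\<lambda>n. scl (a n) (z n)) sums y" "(\<lambda>n. scl (b n) (z n)) sums y"
  shows "a = b"
proof
  fix i
  define c where "c n = a n - b n" for n
  have "(\<lambda>n. scl (c n) (z n)) sums (y - y)"
    unfolding c_def scale_left_diff_distrib by (rule sums_diff assms(4,5))+
  then have lim: "(\<lambda>n. 2 * K * norm (\<Sum>i<n. scl (c i) (z i))) \<longlonglongrightarrow> 0"
    unfolding sums_def by (auto intro!: tendsto_mult_right_zero tendsto_norm_zero)
  have "norm (c i) * \<delta> \<le> 2 * K * norm (\<Sum>i<n. scl (c i) (z i))" if "n \<ge> Suc i" for n
    using that \<delta>(2) by (intro coefficient_bound basic_with_constD[OF basic]) auto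
  then have "norm (c i) * \<delta> \<le> 0" by (intro LIMSEQ_le_const[OF lim]) blast
  then show "a i = b i" using \<delta>(1) by (simp add: c_def mult_le_0_iff)
qed

text \<open>
  On the span the coefficients depend on the vector in a Lipschitz continuous way, and the partial
  sums do so uniformly. Both therefore extend to the closure, and the convergence of the expansions,
  trivial on the span, extends as well.
\<close>

lemma basic_expansion_exists:
  fixes z :: "nat \<Rightarrow> 'a"
  assumes basic: "basic_with_const K z" and \<delta>: "\<delta> > 0" "\<And>n. \<delta> \<le> norm (z n)"
    and y: "y \<in> closure (span (range z))"
  shows "\<exists>a. (\<lambda>n. scl (a n) (z n)) sums y"
proof -
  obtain v where v: "\<And>k. v k \<in> span (range z)" "v \<longlonglongrightarrow> y"
    using y unfolding closure_sequential by blast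
  have "\<forall>k. \<exists>a N. \<forall>n\<ge>N. v k = (\<Sum>i<n. scl (a i) (z i))" using span_range_sums[OF v(1)] by blast
  then obtain b N where b: "\<And>k n. n \<ge> N k \<Longrightarrow> v k = (\<Sum>i<n. scl (b k i) (z i))" by metis
  have diff: "(\<Sum>i<n. scl (b k i - b l i) (z i)) = v k - v l" if "n \<ge> max (N k) (N l)" for k l n
    using b[of k n] b[of l n] that by (simp add: scale_left_diff_distrib sum_subtractf)
  have proj: "norm (\<Sum>i<n. scl (b k i - b l i) (z i)) \<le> K * norm (v k - v l)" for k l n
    using basic_with_constD[OF basic, of n "max n (max (N k) (N l))" "\<lambda>i. b k i - b l i"] diff by simp
  have coef: "norm (b k i - b l i) * \<delta> \<le> 2 * K * norm (v k - v l)" for k l i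
  proof -
    define n where "n = max (Suc i) (max (N k) (N l))"
    have "norm (b k i - b l i) * \<delta> \<le> 2 * K * norm (\<Sum>i<n. scl (b k i - b l i) (z i))"
      using \<delta>(2) by (intro coefficient_bound basic_with_constD[OF basic]) (auto simp: n_def)
    then show ?thesis using diff by (simp add: n_def)
  qed
  have K: "K \<ge> 0"
  proof -
    have "norm (z 0) \<le> K * norm (z 0)" using basic_with_constD[OF basic, of 1 1 "\<lambda>_. 1"] by simp
    then have "0 \<le> (K - 1) * norm (z 0)" by (simp add: algebra_simps)
    moreover have "norm (z 0) > 0" using \<delta> by (meson less_le_trans)
    ultimately show ?thesis by (simp add: zero_le_mult_iff)
  qed
  have "Cauchy (\<lambda>k. b k i)" for i
  proof (rule metric_CauchyI)
    fix e :: real assume "e > 0"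
    define e' where "e' = e * \<delta> / (2 * K + 1)"
    have "e' > 0" using \<open>e > 0\<close> \<delta>(1) K by (simp add: e'_def)
    moreover have "Cauchy v" using v(2) by (rule LIMSEQ_imp_Cauchy)
    ultimately obtain k0 where k0: "\<And>k l. k \<ge> k0 \<Longrightarrow> l \<ge> k0 \<Longrightarrow> dist (v k) (v l) < e'"
      using metric_CauchyD by blast
    have "dist (b k i) (b l i) < e" if "k \<ge> k0" "l \<ge> k0" for k l
    proof -
      have "norm (b k i - b l i) * \<delta> \<le> 2 * K * norm (v k - v l)" by (rule coef)
      also have "\<dots> \<le> (2 * K + 1) * norm (v k - v l)" by (intro mult_right_mono) auto
      also have "\<dots> < (2 * K + 1) * e'" using k0[OF that] K by (intro mult_strict_left_mono) (auto simp: dist_norm)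
      also have "\<dots> = e * \<delta>" using K by (simp add: e'_def)
      finally show ?thesis using \<delta>(1) by (simp add: dist_norm)
    qed
    then show "\<exists>M. \<forall>k\<ge>M. \<forall>l\<ge>M. dist (b k i) (b l i) < e" by blast
  qed
  then have "\<exists>c. (\<lambda>k. b k i) \<longlonglongrightarrow> c" for i using scalar_Cauchy_convergent by (auto simp: convergent_def)
  then obtain c where c: "\<And>i. (\<lambda>k. b k i) \<longlonglongrightarrow> c i" by metis
  have close: "norm ((\<Sum>i<n. scl (c i) (z i)) - y) \<le> (K + 1) * norm (y - v k)" if "n \<ge> N k" for n k
  proof -
    have "(\<lambda>l. norm (\<Sum>i<n. scl (b l i - b k i) (z i))) \<longlonglongrightarrow> norm (\<Sum>i<n. scl (c i - b k i) (z i))"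
      by (intro tendsto_norm tendsto_sum tendsto_scl tendsto_diff c tendsto_const)
    moreover have "(\<lambda>l. K * norm (v l - v k)) \<longlonglongrightarrow> K * norm (y - v k)" by (intro tendsto_intros v(2))
    ultimately have "norm (\<Sum>i<n. scl (c i - b k i) (z i)) \<le> K * norm (y - v k)"
      by (rule LIMSEQ_le) (use proj in blast)
    moreover have "(\<Sum>i<n. scl (c i - b k i) (z i)) = (\<Sum>i<n. scl (c i) (z i)) - v k"
      using b[OF that] by (simp add: scale_left_diff_distrib sum_subtractf)
    moreover have "norm ((\<Sum>i<n. scl (c i) (z i)) - y) \<le>
        norm ((\<Sum>i<n. scl (c i) (z i)) - v k) + norm (y - v k)"
      using norm_triangle_ineq4[of "(\<Sum>i<n. scl (c i) (z i)) - v k" "y - v k"] by simp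
    ultimately show ?thesis by (simp add: distrib_right)
  qed
  have "(\<lambda>n. \<Sum>i<n. scl (c i) (z i)) \<longlonglongrightarrow> y"
  proof (rule metric_LIMSEQ_I)
    fix e :: real assume "e > 0"
    then have "e / (K + 1) > 0" using K by simp
    then obtain k where "dist (v k) y < e / (K + 1)"
      using v(2) by (meson lim_sequentially order_refl)
    then have k: "(K + 1) * norm (y - v k) < e"
      using K by (simp add: dist_norm norm_minus_commute field_simps)
    have "dist (\<Sum>i<n. scl (c i) (z i)) y < e" if "n \<ge> N k" for n
      using close[OF that] k by (simp add: dist_norm)
    then show "\<exists>no. \<forall>n\<ge>no. dist (\<Sum>i<n. scl (c i) (z i)) y < e" by blast
  qed
  then show ?thesis unfolding sums_def by blast
qed

lemma basic_sequence_if_basic_with_const: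
  fixes x :: "nat \<Rightarrow> 'a"
  assumes "basic_with_const K x" "\<delta> > 0" "\<And>n. \<delta> \<le> norm (x n)"
  shows "basic_sequence scl x"
proof -
  define z where "z n = x (Suc n)" for n
  have z: "basic_with_const K z"
    using basic_with_const_subseq[OF assms(1), of Suc] by (simp add: z_def[abs_def] comp_def strict_mono_Suc_iff)
  have "x ` {1..} = range z"
    by (auto simp: z_def image_iff) (metis Suc_le_D One_nat_def)
  then show ?thesis unfolding basic_sequence_def closed_span_def
    using basic_expansion_exists[OF z assms(2)] basic_unique_expansion[OF z assms(2)] assms(3)
    by (auto simp: z_def ex1I)
qed

text \<open>
  Mazur's construction of basic sequences. A finite net of the unit sphere of the span of \<open>x\<close> is
  normed by finitely many functionals, and these almost vanish at \<open>y k\<close> for large \<open>k\<close>, so that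
  adding a multiple of \<open>y k\<close> can hardly decrease the norm.
\<close>

lemma Mazur_step:
  fixes x y :: "nat \<Rightarrow> 'a"
  assumes bound: "\<And>a i. i < n \<Longrightarrow> norm (a i) \<le> B * norm (\<Sum>i<n. scl (a i) (x i))"
    and null: "weakly_null scl y" and \<delta>: "\<delta> > 0" "\<And>k. \<delta> \<le> norm (y k)" and r: "r < 1"
  shows "\<exists>k0. \<forall>k\<ge>k0. \<forall>a t. r * norm (\<Sum>i<n. scl (a i) (x i)) \<le>
    norm ((\<Sum>i<n. scl (a i) (x i)) + scl t (y k))"
proof -
  define v where "v a = (\<Sum>i<n. scl (a i) (x i))" for a
  \<comment> \<open>Three errors of this size occur: two in passing to the net and back, one from the value of
    the functional at the multiple of \<open>y k\<close>.\<close>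
  define \<epsilon> where "\<epsilon> = (1 - r) / 3"
  have \<epsilon>: "\<epsilon> > 0" "r = 1 - 3 * \<epsilon>" using r by (simp_all add: \<epsilon>_def diff_divide_distrib)
  define M where "M = 1 + (\<Sum>i<n. norm (x i))"
  have M: "M > 0" unfolding M_def by (smt (verit) sum_nonneg norm_ge_zero)
  obtain A where A: "finite A" "\<And>a :: nat \<Rightarrow> 'k. (\<forall>i<n. norm (a i) \<le> B) \<Longrightarrow>
      \<exists>b\<in>A. \<forall>i<n. norm (a i - b i) \<le> \<epsilon> / M"
    using coefficient_net[of "\<epsilon> / M" n B] \<epsilon>(1) M by (metis divide_pos_pos)
  have "\<exists>f\<in>dual_ball. norm (v b) \<le> norm (f (v b))" for b
    using norming_functional[of "v b"] by (auto simp: dual_ball_def)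
  then obtain f where f: "\<And>b. f b \<in> dual_ball" "\<And>b. norm (v b) \<le> norm (f b (v b))" by metis
  have "eventually (\<lambda>k. norm (f b (y k)) < \<epsilon> * \<delta> / 2) sequentially" for b
  proof -
    have "(\<lambda>k. f b (y k)) \<longlonglongrightarrow> 0" using null f(1) by (auto simp: weakly_null_def dual_ball_def)
    then have "(\<lambda>k. norm (f b (y k))) \<longlonglongrightarrow> 0" by (rule tendsto_norm_zero)
    then show ?thesis by (rule order_tendstoD) (use \<epsilon> \<delta> in auto)
  qed
  then have "eventually (\<lambda>k. \<forall>b\<in>A. norm (f b (y k)) < \<epsilon> * \<delta> / 2) sequentially"
    using A(1) by (simp add: eventually_ball_finite)
  then obtain k0 where k0: "\<And>k b. k \<ge> k0 \<Longrightarrow> b \<in> A \<Longrightarrow> norm (f b (y k)) < \<epsilon> * \<delta> / 2"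
    unfolding eventually_sequentially by blast
  have unit: "r \<le> norm (v a + scl t (y k))" if "k \<ge> k0" "norm (v a) = 1" for k a t
  proof (cases "norm t * \<delta> < 2")
    case False
    have "norm t * \<delta> \<le> norm (scl t (y k))" using \<delta>(2) by (simp add: norm_scl mult_left_mono)
    moreover have "norm (scl t (y k)) \<le> norm (v a + scl t (y k)) + norm (v a)"
      using norm_triangle_ineq4[of "v a + scl t (y k)" "v a"] by simp
    ultimately show ?thesis using False that(2) r by linarith
  next
    case True
    have "norm (a i) \<le> B" if "i < n" for i using bound[OF that, of a] \<open>norm (v a) = 1\<close> by (simp add: v_def)
    then obtain b where b: "b \<in> A" "\<And>i. i < n \<Longrightarrow> norm (a i - b i) \<le> \<epsilon> / M" using A(2) by blast
    have "norm (v a - v b) \<le> \<epsilon>"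
    proof -
      have "v a - v b = (\<Sum>i<n. scl (a i - b i) (x i))"
        by (simp add: v_def scale_left_diff_distrib sum_subtractf)
      also have "norm \<dots> \<le> (\<Sum>i<n. \<epsilon> / M * norm (x i))"
        using b(2) by (intro sum_norm_le) (simp only: norm_scl lessThan_iff mult_right_mono norm_ge_zero)
      also have "\<dots> = \<epsilon> / M * (M - 1)" by (simp add: M_def sum_distrib_left)
      also have "\<dots> \<le> \<epsilon>" using M \<epsilon>(1) by (simp add: field_simps)
      finally show ?thesis .
    qed
    interpret fb: Vector_Spaces.linear scl "(*)" "f b"
      using f(1)[of b] by (simp add: dual_ball_def dual_space_def)
    have le: "norm (f b w) \<le> norm w" for w using f(1)[of b] by (simp add: dual_ball_def)
    have "f b (v b) = f b (v a + scl t (y k)) - f b (v a - v b) - t * f b (y k)"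
      by (simp add: fb.add fb.diff fb.scale)
    then have "norm (f b (v b)) \<le> norm (f b (v a + scl t (y k))) + norm (f b (v a - v b)) + norm (t * f b (y k))"
      using norm_triangle_ineq4[of "f b (v a + scl t (y k)) - f b (v a - v b)" "t * f b (y k)"]
        norm_triangle_ineq4[of "f b (v a + scl t (y k))" "f b (v a - v b)"] by simp
    moreover have "norm (t * f b (y k)) \<le> \<epsilon>"
    proof -
      have "norm (t * f b (y k)) \<le> norm t * (\<epsilon> * \<delta> / 2)"
        unfolding norm_mult using k0[OF that(1) b(1)] by (intro mult_left_mono) auto
      also have "\<dots> = \<epsilon> / 2 * (norm t * \<delta>)" by simp
      also have "\<dots> \<le> \<epsilon> / 2 * 2" using True \<epsilon>(1) by (intro mult_left_mono) auto
      finally show ?thesis by simp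
    qed
    moreover have "norm (v a) \<le> norm (v b) + norm (v a - v b)"
      using norm_triangle_ineq[of "v b" "v a - v b"] by simp
    ultimately show ?thesis
      using f(2)[of b] le[of "v a + scl t (y k)"] le[of "v a - v b"] \<open>norm (v a - v b) \<le> \<epsilon>\<close> that(2) \<epsilon>(2)
      by linarith
  qed
  have "r * norm (v a) \<le> norm (v a + scl t (y k))" if "k \<ge> k0" for k a t
  proof (cases "v a = 0")
    case False
    define s :: 'k where "s = of_real (1 / norm (v a))"
    have s: "norm s = 1 / norm (v a)" by (simp add: s_def norm_divide)
    have "v (\<lambda>i. s * a i) = scl s (v a)" by (simp add: v_def scale_sum_right)
    moreover have "norm (scl s (v a)) = 1" using False by (simp add: norm_scl s)
    ultimately have "r \<le> norm (scl s (v a) + scl (s * t) (y k))"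
      using unit[OF that, of "\<lambda>i. s * a i" "s * t"] by simp
    also have "scl s (v a) + scl (s * t) (y k) = scl s (v a + scl t (y k))"
      by (simp add: scale_right_distrib)
    also have "norm \<dots> = norm (v a + scl t (y k)) / norm (v a)" by (simp add: norm_scl s)
    finally show ?thesis using False by (simp add: field_simps)
  qed simp
  then show ?thesis unfolding v_def by blast
qed

text \<open>
  Weights that decrease from \<open>1\<close> towards \<open>1/2\<close>. Losing the factor
  \<open>basis_weight (Suc n) / basis_weight n < 1\<close> in the step number \<open>n\<close> amounts to losing at most a
  factor \<open>2\<close> in total, since the product telescopes.
\<close>

definition basis_weight :: "nat \<Rightarrow> real" where
  "basis_weight n = (real n + 2) / (2 * (real n + 1))"

lemma basis_weight: "basis_weight n > 0" "basis_weight n \<le> 1" "1 / 2 \<le> basis_weight n"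
  "basis_weight (Suc n) < basis_weight n"
  by (simp_all add: basis_weight_def field_simps)

lemma basic_from_steps:
  fixes x :: "nat \<Rightarrow> 'a"
  assumes "\<And>j. m \<le> j \<Longrightarrow> j < n \<Longrightarrow> basis_weight (Suc j) / basis_weight j * norm (\<Sum>i<j. scl (a i) (x i)) \<le>
      norm (\<Sum>i<Suc j. scl (a i) (x i))" and "m \<le> n"
  shows "norm (\<Sum>i<m. scl (a i) (x i)) \<le> 2 * norm (\<Sum>i<n. scl (a i) (x i))"
proof -
  define g where "g j = norm (\<Sum>i<j. scl (a i) (x i)) / basis_weight j" for j
  have step: "g j \<le> g (Suc j)" if "m \<le> j" "j < n" for j
    using assms(1)[OF that] basis_weight(1)[of j] basis_weight(1)[of "Suc j"]
    by (simp add: g_def field_simps del: sum.lessThan_Suc)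
  have "g m \<le> g n" using assms(2) step
    by (induction rule: dec_induct) (auto intro: order_trans)
  have "norm (\<Sum>i<m. scl (a i) (x i)) \<le> g m"
    using mult_left_mono[OF basis_weight(2)[of m] norm_ge_zero[of "\<Sum>i<m. scl (a i) (x i)"]] basis_weight(1)[of m]
    by (simp add: g_def field_simps)
  also note \<open>g m \<le> g n\<close>
  also have "g n \<le> 2 * norm (\<Sum>i<n. scl (a i) (x i))"
    using mult_left_mono[OF basis_weight(3)[of n] norm_ge_zero[of "\<Sum>i<n. scl (a i) (x i)"]] basis_weight(1)[of n]
    by (simp add: g_def field_simps)
  finally show ?thesis .
qed

text \<open>
  The indices are chosen one after the other by Mazur's step. The coefficient bound that the step
  needs for the vectors chosen so far follows from the estimates of the preceding steps.
\<close>

theorem basic_subsequence: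
  fixes y :: "nat \<Rightarrow> 'a"
  assumes null: "weakly_null scl y" and \<delta>: "\<delta> > 0" "\<And>k. \<delta> \<le> norm (y k)"
  shows "\<exists>\<phi>::nat \<Rightarrow> nat. strict_mono \<phi> \<and> basic_with_const 2 (y \<circ> \<phi>)"
proof -
  define P :: "(nat \<Rightarrow> nat) \<Rightarrow> nat \<Rightarrow> nat \<Rightarrow> bool" where
    "P f n k \<longleftrightarrow> (\<forall>i<n. f i < k) \<and> (\<forall>a t. basis_weight (Suc n) / basis_weight n *
      norm (\<Sum>i<n. scl (a i) (y (f i))) \<le> norm ((\<Sum>i<n. scl (a i) (y (f i))) + scl t (y k)))" for f n k
  have "\<exists>f. \<forall>n. P f n (f n)"
  proof (rule dependent_wellorder_choice)
    show "P f n k = P g n k" if "\<And>i. i < n \<Longrightarrow> f i = g i" for f g n k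
    proof -
      have "(\<Sum>i<n. scl (a i) (y (f i))) = (\<Sum>i<n. scl (a i) (y (g i)))" for a
        using that by (intro sum.cong) auto
      then show ?thesis using that unfolding P_def by auto
    qed
  next
    fix n f assume IH: "\<And>i. i < n \<Longrightarrow> P f i (f i)"
    have bound: "norm (a i) \<le> 4 / \<delta> * norm (\<Sum>i<n. scl (a i) (y (f i)))" if "i < n" for a i
    proof -
      have "norm (a i) * \<delta> \<le> 2 * 2 * norm (\<Sum>i<n. scl (a i) (y (f i)))"
      proof (rule coefficient_bound[OF basic_from_steps that \<delta>(2)])
        fix m j assume "j < n"
        then have "P f j (f j)" by (rule IH)
        then show "basis_weight (Suc j) / basis_weight j * norm (\<Sum>i<j. scl (a i) (y (f i))) \<le>
            norm (\<Sum>i<Suc j. scl (a i) (y (f i)))"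
          unfolding P_def sum.lessThan_Suc by blast
      qed
      then show ?thesis using \<delta>(1) by (simp add: field_simps)
    qed
    have "basis_weight (Suc n) / basis_weight n < 1" using basis_weight(1,4)[of n] by simp
    from Mazur_step[of n _ "\<lambda>i. y (f i)", OF bound null \<delta> this] obtain k0 where
      k0: "\<And>k a t. k \<ge> k0 \<Longrightarrow> basis_weight (Suc n) / basis_weight n *
        norm (\<Sum>i<n. scl (a i) (y (f i))) \<le> norm ((\<Sum>i<n. scl (a i) (y (f i))) + scl t (y k))"
      by blast
    define k where "k = max k0 (Suc (\<Sum>i<n. f i))"
    have "f i < k" if "i < n" for i
      using member_le_sum[of i "{..<n}" f] that by (simp add: k_def less_Suc_eq_le less_max_iff_disj)
    then have "P f n k" using k0[of k] unfolding P_def by (auto simp: k_def)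
    then show "\<exists>k. P f n k" by blast
  qed
  then obtain f where f: "\<And>n. P f n (f n)" by blast
  have "strict_mono f" using f by (auto simp: strict_mono_Suc_iff P_def)
  moreover have "basic_with_const 2 (y \<circ> f)" unfolding basic_with_const_def
  proof (intro allI impI)
    fix a and m n :: nat assume "m \<le> n"
    then show "norm (\<Sum>i<m. scl (a i) ((y \<circ> f) i)) \<le> 2 * norm (\<Sum>i<n. scl (a i) ((y \<circ> f) i))"
      using f by (intro basic_from_steps) (auto simp: P_def)
  qed
  ultimately show ?thesis by blast
qed

end


section \<open>Schreier spreading subsequences\<close>

lemma sorted_list_of_set_image_strict_mono:
  fixes r :: "nat \<Rightarrow> nat"
  assumes "strict_mono r" "finite F"
  shows "sorted_list_of_set (r ` F) = map r (sorted_list_of_set F)"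
proof (rule sorted_distinct_set_unique)
  have "sorted_wrt (<) (map r (sorted_list_of_set F))"
    unfolding sorted_wrt_map using assms(1) strict_sorted_list_of_set[of F]
    by (simp add: strict_mono_less)
  then show "sorted (map r (sorted_list_of_set F))" "distinct (map r (sorted_list_of_set F))"
    by (simp_all add: strict_sorted_iff)
qed (use assms(2) in simp_all)

lemma schreier1_image_strict_mono:
  fixes \<phi> :: "nat \<Rightarrow> nat"
  assumes "strict_mono \<phi>" "F \<in> schreier1"
  shows "\<phi> ` F \<in> schreier1" "card (\<phi> ` F) = card F"
proof -
  have F: "finite F" "0 \<notin> F" "F = {} \<or> card F \<le> Min F" using assms(2) by (auto simp: schreier1_def)
  show card: "card (\<phi> ` F) = card F"
    using assms(1) by (intro card_image) (simp add: strict_mono_imp_inj_on inj_on_subset)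
  have le: "k \<le> \<phi> k" for k using assms(1) by (rule strict_mono_imp_increasing)
  have "0 \<notin> \<phi> ` F"
  proof
    assume "0 \<in> \<phi> ` F"
    then obtain k where "k \<in> F" "\<phi> k = 0" by auto
    then show False using le[of k] F(2) by simp
  qed
  moreover have "card (\<phi> ` F) \<le> Min (\<phi> ` F)" if "F \<noteq> {}"
  proof -
    have "card F \<le> k" if "k \<in> F" for k using F that by (meson Min_le empty_iff order_trans)
    then have "\<forall>k\<in>F. card F \<le> \<phi> k" using le order_trans by blast
    then show ?thesis unfolding card using F(1) that by simp
  qed
  moreover have "finite (\<phi> ` F)" using F(1) by simp
  ultimately show "\<phi> ` F \<in> schreier1" unfolding schreier1_def by blast
qed

context banach_over
begin

definition placed_norm :: "(nat \<Rightarrow> 'a) \<Rightarrow> nat set \<Rightarrow> (nat \<Rightarrow> 'k) \<Rightarrow> real" where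
  "placed_norm x F a = norm (\<Sum>i<card F. scl (a i) (x (sorted_list_of_set F ! i)))"

lemma placed_norm_image:
  assumes "strict_mono r" "finite F"
  shows "placed_norm x (r ` F) a = placed_norm (x \<circ> r) F a"
proof -
  have "card (r ` F) = card F"
    using assms(1) by (intro card_image) (simp add: strict_mono_imp_inj_on inj_on_subset)
  then show ?thesis unfolding placed_norm_def
    using assms by (simp add: sorted_list_of_set_image_strict_mono)
qed

lemma placed_norm_diff:
  assumes "\<And>n. norm (x n) \<le> M" "\<And>i. i < card F \<Longrightarrow> norm (a i - b i) \<le> \<eta>"
  shows "\<bar>placed_norm x F a - placed_norm x F b\<bar> \<le> real (card F) * (\<eta> * M)"
proof -
  let ?x = "\<lambda>i. x (sorted_list_of_set F ! i)"
  have "\<bar>placed_norm x F a - placed_norm x F b\<bar> \<le>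
      norm ((\<Sum>i<card F. scl (a i) (?x i)) - (\<Sum>i<card F. scl (b i) (?x i)))"
    unfolding placed_norm_def by (rule norm_triangle_ineq3)
  also have "\<dots> = norm (\<Sum>i<card F. scl (a i - b i) (?x i))"
    by (simp add: scale_left_diff_distrib sum_subtractf)
  also have "\<dots> \<le> (\<Sum>i<card F. \<eta> * M)"
  proof (rule sum_norm_le)
    fix i assume "i \<in> {..<card F}"
    then show "norm (scl (a i - b i) (?x i)) \<le> \<eta> * M"
      using assms(2)[of i] assms(1) order_trans[OF norm_ge_zero] by (auto simp: norm_scl intro!: mult_mono)
  qed
  finally show ?thesis by simp
qed

text \<open>
  Colour the \<open>n\<close>-element sets by the values of the placed norm at a finite net of coefficient
  vectors, rounded down to multiples of \<open>1/4\<close>. On a homogeneous set, the placed norms of any two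
  sets differ by at most \<open>1/4\<close> on the net. Passing from a given vector to the net costs \<open>1/4\<close> for
  each of the two sets.
\<close>

lemma Ramsey_placed_norm:
  assumes bounded: "\<And>k. norm (x k) \<le> M"
  shows "\<exists>r::nat \<Rightarrow> nat. strict_mono r \<and> (\<forall>(F::nat set) (G::nat set) a. finite F \<longrightarrow> finite G \<longrightarrow> card F = n \<longrightarrow> card G = n \<longrightarrow>
    (\<forall>i<n. norm (a i) \<le> 1) \<longrightarrow> \<bar>placed_norm (x \<circ> r) F a - placed_norm (x \<circ> r) G a\<bar> \<le> 1)"
proof -
  define M' where "M' = max M 1"
  have M': "M' \<ge> 1" "\<And>k. norm (x k) \<le> M'" using bounded by (auto simp: M'_def le_max_iff_disj)
  define \<eta> where "\<eta> = 1 / (4 * (real n + 1) * M')"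
  have \<eta>: "\<eta> > 0" "real n * (\<eta> * M') \<le> 1/4"
  proof -
    show "\<eta> > 0" unfolding \<eta>_def using M'(1) by (intro divide_pos_pos mult_pos_pos) auto
    have "\<eta> * M' = 1 / (4 * (real n + 1))" using M'(1) by (simp add: \<eta>_def)
    then have "real n * (\<eta> * M') = real n / (4 * (real n + 1))" by simp
    also have "\<dots> \<le> 1/4" by (simp add: field_simps)
    finally show "real n * (\<eta> * M') \<le> 1/4" .
  qed
  obtain A where A: "finite A" "\<And>a :: nat \<Rightarrow> 'k. \<forall>i<n. norm (a i) \<le> 1 \<Longrightarrow>
      \<exists>b\<in>A. \<forall>i<n. norm (a i - b i) \<le> \<eta>"
    using coefficient_net[OF \<eta>(1), of n 1] by blast
  define colour where "colour F = (\<lambda>b\<in>A. nat \<lfloor>4 * placed_norm x F b\<rfloor>)" for F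
  define L where "L b = nat \<lfloor>4 * (\<Sum>i<n. norm (b i) * M')\<rfloor>" for b :: "nat \<Rightarrow> 'k"
  have colour: "colour F \<in> PiE A (\<lambda>b. {..L b})" if "card F = n" for F
  proof -
    have "placed_norm x F b \<le> (\<Sum>i<n. norm (b i) * M')" for b
      unfolding placed_norm_def that using M'(2)
      by (intro sum_norm_le) (simp add: norm_scl mult_left_mono)
    then show ?thesis unfolding colour_def L_def by (auto intro!: nat_mono floor_mono)
  qed
  define C where "C = PiE A (\<lambda>b. {..L b})"
  have "finite C" unfolding C_def using A(1) by (intro finite_PiE) auto
  then obtain h where h: "bij_betw h C {0..<card C}" using ex_bij_betw_finite_nat by blast
  have "\<forall>X. X \<subseteq> UNIV \<and> finite X \<and> card X = n \<longrightarrow> h (colour X) < card C"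
    using h colour unfolding C_def by (auto dest!: bij_betwE)
  from Ramsey[OF infinite_UNIV_nat this]
  obtain Y t where Y: "infinite Y" "\<And>X. X \<subseteq> Y \<Longrightarrow> finite X \<Longrightarrow> card X = n \<Longrightarrow> h (colour X) = t" by auto
  define r where "r = enumerate Y"
  have r: "strict_mono r" "range r = Y" using Y(1) by (simp_all add: r_def strict_mono_enumerate range_enumerate)
  have "\<bar>placed_norm (x \<circ> r) F a - placed_norm (x \<circ> r) G a\<bar> \<le> 1"
    if FG: "finite F" "finite G" "card F = n" "card G = n" and a: "\<forall>i<n. norm (a i) \<le> 1" for F G a
  proof -
    obtain b where b: "b \<in> A" "\<And>i. i < n \<Longrightarrow> norm (a i - b i) \<le> \<eta>" using A(2)[OF a] by blast
    have card: "card (r ` F) = n" "card (r ` G) = n"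
      using FG r(1) by (simp_all add: card_image strict_mono_imp_inj_on inj_on_subset)
    have sub: "r ` F \<subseteq> Y" "r ` G \<subseteq> Y" using r(2) by auto
    have "h (colour (r ` F)) = h (colour (r ` G))"
      using Y(2)[OF sub(1) finite_imageI[OF FG(1)] card(1)]
        Y(2)[OF sub(2) finite_imageI[OF FG(2)] card(2)] by simp
    then have "colour (r ` F) = colour (r ` G)"
      by (rule inj_onD[OF bij_betw_imp_inj_on[OF h]])
        (use colour[OF card(1)] colour[OF card(2)] in \<open>simp_all only: C_def\<close>)
    then have "colour (r ` F) b = colour (r ` G) b" by simp
    then have "nat \<lfloor>4 * placed_norm x (r ` F) b\<rfloor> = nat \<lfloor>4 * placed_norm x (r ` G) b\<rfloor>"
      using b(1) by (simp add: colour_def)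
    moreover have "placed_norm x (r ` F) b \<ge> 0" "placed_norm x (r ` G) b \<ge> 0" by (simp_all add: placed_norm_def)
    ultimately have "\<bar>placed_norm x (r ` F) b - placed_norm x (r ` G) b\<bar> \<le> 1/4" by linarith
    moreover have "\<bar>placed_norm x (r ` F) a - placed_norm x (r ` F) b\<bar> \<le> 1/4"
      using placed_norm_diff[of x M' "r ` F" a b \<eta>, OF M'(2)] b(2) \<eta>(2) card by simp
    moreover have "\<bar>placed_norm x (r ` G) a - placed_norm x (r ` G) b\<bar> \<le> 1/4"
      using placed_norm_diff[of x M' "r ` G" a b \<eta>, OF M'(2)] b(2) \<eta>(2) card by simp
    ultimately have "\<bar>placed_norm x (r ` F) a - placed_norm x (r ` G) a\<bar> \<le> 1" by argo
    then show ?thesis using FG r(1) by (simp add: placed_norm_image)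
  qed
  then show ?thesis using r(1) by blast
qed

text \<open>
  Diagonalise over the number of elements. The terms of the diagonal sequence from number \<open>n\<close> on are a
  subsequence of the one that is homogeneous for \<open>n\<close>-element sets, and the Schreier condition says
  precisely that an \<open>n\<close>-element set begins at \<open>n\<close> or later.
\<close>

lemma asymptotically_placed_subsequence:
  assumes bounded: "\<And>k. norm (x k) \<le> M"
  shows "\<exists>\<phi>::nat \<Rightarrow> nat. strict_mono \<phi> \<and> (\<forall>F\<in>schreier1. \<forall>G\<in>schreier1. card F = card G \<longrightarrow>
    (\<forall>a. (\<forall>i<card F. norm (a i) \<le> 1) \<longrightarrow> \<bar>placed_norm (x \<circ> \<phi>) F a - placed_norm (x \<circ> \<phi>) G a\<bar> \<le> 1))"
proof -
  define P where "P n s \<longleftrightarrow> (\<forall>(F::nat set) (G::nat set) a. finite F \<longrightarrow> finite G \<longrightarrow> card F = Suc n \<longrightarrow> card G = Suc n \<longrightarrow>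
    (\<forall>i<Suc n. norm (a i) \<le> 1) \<longrightarrow> \<bar>placed_norm (x \<circ> s) F a - placed_norm (x \<circ> s) G a\<bar> \<le> 1)"
    for n and s :: "nat \<Rightarrow> nat"
  interpret subseqs P
  proof
    fix n and s :: "nat \<Rightarrow> nat" assume "strict_mono s"
    have "norm ((x \<circ> s) k) \<le> M" for k using bounded by simp
    from Ramsey_placed_norm[of "x \<circ> s", OF this, of "Suc n"]
    show "\<exists>r'. strict_mono r' \<and> P n (s \<circ> r')" unfolding P_def o_assoc by blast
  qed
  have holds: "P k (diagseq \<circ> (+) (Suc k))" for k
  proof (rule diagseq_holds)
    fix r s :: "nat \<Rightarrow> nat" and n assume r: "strict_mono r" and P: "P n s"
    show "P n (s \<circ> r)" unfolding P_def
    proof (intro allI impI)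
      fix F G :: "nat set" and a :: "nat \<Rightarrow> 'k"
      assume FG: "finite F" "finite G" "card F = Suc n" "card G = Suc n" "\<forall>i<Suc n. norm (a i) \<le> 1"
      have "card (r ` F) = Suc n" "card (r ` G) = Suc n"
        using FG r by (simp_all add: card_image strict_mono_imp_inj_on inj_on_subset)
      then have "\<bar>placed_norm (x \<circ> s) (r ` F) a - placed_norm (x \<circ> s) (r ` G) a\<bar> \<le> 1"
        using P FG unfolding P_def by blast
      then show "\<bar>placed_norm (x \<circ> (s \<circ> r)) F a - placed_norm (x \<circ> (s \<circ> r)) G a\<bar> \<le> 1"
        using r FG by (simp add: placed_norm_image o_assoc)
    qed
  qed
  have "\<bar>placed_norm (x \<circ> diagseq) F a - placed_norm (x \<circ> diagseq) G a\<bar> \<le> 1"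
    if FG: "F \<in> schreier1" "G \<in> schreier1" "card F = card G" and a: "\<forall>i<card F. norm (a i) \<le> 1" for F G a
  proof (cases "card F")
    case 0
    then show ?thesis using FG(3) by (simp add: placed_norm_def)
  next
    case (Suc k)
    have shift: "\<exists>H. finite H \<and> F = (+) (Suc k) ` H \<and> card H = Suc k"
      if F: "F \<in> schreier1" "card F = Suc k" for F
    proof -
      have fin: "finite F" and "F \<noteq> {}" using F by (auto simp: schreier1_def)
      then have le: "Suc k \<le> i" if "i \<in> F" for i
        using F that Min_le[OF fin that] by (auto simp: schreier1_def)
      have "(+) (Suc k) ` ((\<lambda>i. i - Suc k) ` F) = (\<lambda>i. i) ` F"
        unfolding image_image by (intro image_cong refl le_add_diff_inverse le)
      then have "F = (+) (Suc k) ` ((\<lambda>i. i - Suc k) ` F)" by simp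
      moreover from this have "card ((\<lambda>i. i - Suc k) ` F) = card F"
        using card_image[of "(+) (Suc k)" "(\<lambda>i. i - Suc k) ` F"] by simp
      ultimately show ?thesis using fin F(2) by (intro exI[of _ "(\<lambda>i. i - Suc k) ` F"]) simp
    qed
    obtain F' where F': "finite F'" "F = (+) (Suc k) ` F'" "card F' = Suc k" using shift[OF FG(1) Suc] by blast
    obtain G' where G': "finite G'" "G = (+) (Suc k) ` G'" "card G' = Suc k"
      using shift[OF FG(2) trans[OF FG(3)[symmetric] Suc]] by blast
    have "\<bar>placed_norm (x \<circ> (diagseq \<circ> (+) (Suc k))) F' a - placed_norm (x \<circ> (diagseq \<circ> (+) (Suc k))) G' a\<bar> \<le> 1"
      using holds[of k] F'(1,3) G'(1,3) a[unfolded Suc] unfolding P_def by blast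
    moreover have "strict_mono ((+) (Suc k))" by (simp add: strict_mono_def)
    ultimately show ?thesis
      unfolding F'(2) G'(2) o_assoc using F'(1) G'(1) by (simp only: placed_norm_image)
  qed
  then show ?thesis using subseq_diagseq by blast
qed

lemma placed_coefficient_bound:
  assumes basic: "basic_with_const K x" and \<delta>: "\<delta> > 0" "\<And>n. \<delta> \<le> norm (x n)"
    and F: "finite F" "i < card F"
  shows "norm (a i) * \<delta> \<le> 2 * K * placed_norm x F a"
proof -
  define \<phi> where "\<phi> j = (if j < card F then sorted_list_of_set F ! j else Max F + Suc j)" for j
  have len: "length (sorted_list_of_set F) = card F" by simp
  have "\<phi> j < \<phi> (Suc j)" for j
  proof (cases "Suc j < card F")
    case True
    then show ?thesis using sorted_wrt_nth_less[OF strict_sorted_list_of_set[of F], of j "Suc j"]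
      by (simp add: \<phi>_def)
  next
    case False
    have "sorted_list_of_set F ! j \<le> Max F" if "j < card F"
      using F(1) that nth_mem[of j "sorted_list_of_set F"] by simp
    then show ?thesis using False by (auto simp: \<phi>_def)
  qed
  then have "strict_mono \<phi>" by (simp add: strict_mono_Suc_iff)
  then have b: "basic_with_const K (x \<circ> \<phi>)" using basic by (rule basic_with_const_subseq[rotated])
  have "norm (a i) * \<delta> \<le> 2 * K * norm (\<Sum>i<card F. scl (a i) ((x \<circ> \<phi>) i))"
    by (rule coefficient_bound[OF basic_with_constD[OF b] F(2)]) (auto simp: \<delta>)
  also have "(\<Sum>i<card F. scl (a i) ((x \<circ> \<phi>) i)) = (\<Sum>i<card F. scl (a i) (x (sorted_list_of_set F ! i)))"
    by (intro sum.cong) (auto simp: \<phi>_def)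
  finally show ?thesis by (simp add: placed_norm_def)
qed

text \<open>
  For a basic sequence bounded away from \<open>0\<close>, the coefficients are at most a multiple of the norm of
  the combination. By homogeneity an additive error for coefficients bounded by \<open>1\<close> becomes a
  multiplicative one, however large the additive error is.
\<close>

lemma schreier_spreading_if_placed_norms_close:
  assumes basic: "basic_with_const K x" and K: "K \<ge> 0" and \<delta>: "\<delta> > 0" "\<And>n. \<delta> \<le> norm (x n)"
    and close: "\<And>F G a. F \<in> schreier1 \<Longrightarrow> G \<in> schreier1 \<Longrightarrow> card F = card G \<Longrightarrow>
      \<forall>i<card F. norm (a i) \<le> 1 \<Longrightarrow> \<bar>placed_norm x F a - placed_norm x G a\<bar> \<le> 1"
  shows "schreier_spreading scl x"
proof -
  define C where "C = 1 + 2 * K / \<delta>"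
  have C: "C \<ge> 1" using K \<delta>(1) by (simp add: C_def)
  have le: "placed_norm x G a \<le> C * placed_norm x F a"
    if FG: "F \<in> schreier1" "G \<in> schreier1" "card F = card G" for F G a
  proof -
    define \<mu> where "\<mu> = 2 * K / \<delta> * placed_norm x F a"
    have "finite F" using FG(1) by (simp add: schreier1_def)
    then have a: "norm (a i) \<le> \<mu>" if "i < card F" for i
      using placed_coefficient_bound[OF basic \<delta>, of F i a] that \<delta>(1) by (simp add: \<mu>_def field_simps)
    show ?thesis
    proof (cases "\<mu> > 0")
      case True
      have scaled: "placed_norm x H (\<lambda>i. of_real (1 / \<mu>) * a i) = placed_norm x H a / \<mu>" for H
      proof -
        have "(\<Sum>i<card H. scl (of_real (1 / \<mu>) * a i) (x (sorted_list_of_set H ! i))) =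
            scl (of_real (1 / \<mu>)) (\<Sum>i<card H. scl (a i) (x (sorted_list_of_set H ! i)))"
          by (simp add: scale_sum_right del: of_real_divide)
        then show ?thesis using True unfolding placed_norm_def by (simp add: norm_scl norm_divide)
      qed
      have "\<forall>i<card F. norm (of_real (1 / \<mu>) * a i) \<le> 1" using a True by (simp add: norm_mult norm_divide)
      from close[OF FG this] have "\<bar>placed_norm x F a / \<mu> - placed_norm x G a / \<mu>\<bar> \<le> 1"
        unfolding scaled .
      then have "\<bar>placed_norm x F a - placed_norm x G a\<bar> \<le> \<mu>"
        using True by (simp add: field_simps flip: diff_divide_distrib)
      then show ?thesis by (simp add: C_def \<mu>_def distrib_right)
    next
      case False
      then have "norm (a i) \<le> 0" if "i < card F" for i using a[OF that] by linarith
      then have "placed_norm x G a = 0" "placed_norm x F a = 0" using FG(3) by (simp_all add: placed_norm_def)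
      then show ?thesis by simp
    qed
  qed
  show ?thesis unfolding schreier_spreading_def
  proof (intro exI[of _ C] conjI C ballI impI allI)
    fix F G and a :: "nat \<Rightarrow> 'k" assume FG: "F \<in> schreier1" "G \<in> schreier1" "card F = card G"
    have "placed_norm x F a / C \<le> placed_norm x G a"
      using le[OF FG(2,1) FG(3)[symmetric], of a] C by (simp add: field_simps)
    then show "approx_within C (norm (\<Sum>i<card F. scl (a i) (x (sorted_list_of_set F ! i))))
        (norm (\<Sum>i<card F. scl (a i) (x (sorted_list_of_set G ! i))))"
      using le[OF FG, of a] FG(3) by (simp add: approx_within_def placed_norm_def)
  qed
qed

lemma schreier_spreading_subseq:
  assumes "schreier_spreading scl x" "strict_mono \<phi>"
  shows "schreier_spreading scl (x \<circ> \<phi>)"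
proof -
  obtain C where C: "C \<ge> 1" "\<And>F G a. F \<in> schreier1 \<Longrightarrow> G \<in> schreier1 \<Longrightarrow> card F = card G \<Longrightarrow>
      approx_within C (norm (\<Sum>i<card F. scl (a i) (x (sorted_list_of_set F ! i))))
        (norm (\<Sum>i<card F. scl (a i) (x (sorted_list_of_set G ! i))))"
    using assms(1) unfolding schreier_spreading_def by blast
  show ?thesis unfolding schreier_spreading_def
  proof (intro exI[of _ C] conjI C(1) ballI impI allI)
    fix F G and a :: "nat \<Rightarrow> 'k" assume FG: "F \<in> schreier1" "G \<in> schreier1" "card F = card G"
    have fin: "finite F" "finite G" using FG by (auto simp: schreier1_def)
    have "card (\<phi> ` F) = card (\<phi> ` G)" using schreier1_image_strict_mono(2)[OF assms(2)] FG by simp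
    from C(2)[OF schreier1_image_strict_mono(1)[OF assms(2) FG(1)]
        schreier1_image_strict_mono(1)[OF assms(2) FG(2)] this, of a]
    show "approx_within C (norm (\<Sum>i<card F. scl (a i) ((x \<circ> \<phi>) (sorted_list_of_set F ! i))))
        (norm (\<Sum>i<card F. scl (a i) ((x \<circ> \<phi>) (sorted_list_of_set G ! i))))"
      using fin FG(3) schreier1_image_strict_mono(2)[OF assms(2) FG(1)]
      by (simp add: sorted_list_of_set_image_strict_mono[OF assms(2)])
  qed
qed

end


section \<open>Compact products of strictly singular operators\<close>

lemma finite_if_in_schreier:
  fixes u :: "'o::wellorder \<Rightarrow> nat \<Rightarrow> 'o"
  shows "F \<in> schreier u \<xi> \<Longrightarrow> finite F"
proof (induction \<xi> arbitrary: F rule: less_induct)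
  case (less \<xi>)
  consider "ord_zero \<xi>" | "ord_limit \<xi>" | \<eta> where "ord_succ_of \<xi> \<eta>"
    by (auto simp: ord_limit_def)
  then show ?case
  proof cases
    case 1
    then show ?thesis using less.prems by (auto simp: schreier_zero schreier0_def)
  next
    case 2
    then have "\<not> ord_zero \<xi>" by (simp add: ord_limit_def)
    then have "schreier u \<xi> = {F. \<exists>n\<ge>1. u \<xi> n < \<xi> \<and> (\<forall>k\<in>F. n \<le> k) \<and> F \<in> schreier u (u \<xi> n)}"
      using 2 by (subst schreier.simps) simp
    then show ?thesis using less by blast
  next
    case 3
    then have "\<eta> < \<xi>" by (simp add: ord_succ_of_def)
    then have "finite G" if "G \<in> schreier u \<eta>" for G using less.IH that by blast
    moreover obtain Gs where "F = \<Union>(set Gs)" "set Gs \<subseteq> schreier u \<eta>"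
      using less.prems unfolding schreier_succ[OF 3] convolution_def by blast
    ultimately show ?thesis by auto
  qed
qed

lemma equiv_pigeonhole:
  assumes R: "equiv A R" "finite (A // R)" "card (A // R) = n"
    and y: "\<And>j::nat. j \<le> n \<Longrightarrow> y j \<in> A"
  shows "\<exists>i j. i < j \<and> j \<le> n \<and> (y i, y j) \<in> R"
proof -
  have "(\<lambda>j. R `` {y j}) ` {..n} \<subseteq> A // R" using y by (auto intro: quotientI)
  then have "card ((\<lambda>j. R `` {y j}) ` {..n}) \<le> n" using card_mono[OF R(2)] R(3) by metis
  then have "\<not> inj_on (\<lambda>j. R `` {y j}) {..n}" using card_image by fastforce
  then obtain i j where ij: "i \<le> n" "j \<le> n" "i \<noteq> j" "R `` {y i} = R `` {y j}"
    by (auto simp: inj_on_def)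
  then have "(y i, y j) \<in> R" "(y j, y i) \<in> R"
    using y R(1) eq_equiv_class_iff[OF R(1)] by metis+
  then show ?thesis using ij by (metis linorder_neqE_nat)
qed

lemma separated_sequence_if_not_compact:
  fixes U :: "'a::banach \<Rightarrow> 'a"
  assumes "\<not> compact_op U"
  shows "\<exists>\<delta>>0. \<exists>x::nat \<Rightarrow> 'a. (\<forall>n. norm (x n) \<le> 1) \<and> (\<forall>m n. m < n \<longrightarrow> \<delta> \<le> norm (U (x m) - U (x n)))"
proof -
  define S where "S = U ` cball 0 1"
  have "complete (closure S)" by (simp add: complete_eq_closed)
  then obtain e where e: "e > 0" "\<And>k. finite k \<Longrightarrow> \<not> closure S \<subseteq> (\<Union>x\<in>k. ball x e)"
    using assms unfolding compact_op_def compact_eq_totally_bounded S_def by blast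
  have far: "\<exists>x\<in>cball 0 1. \<forall>p\<in>k. e / 2 \<le> dist p (U x)" if "finite k" for k
  proof (rule ccontr)
    assume "\<not> ?thesis"
    then have "\<exists>p\<in>k. dist p (U x) < e / 2" if "x \<in> cball 0 1" for x using that by (auto simp: not_le)
    then have "S \<subseteq> (\<Union>p\<in>k. cball p (e / 2))" unfolding S_def by fastforce
    then have "closure S \<subseteq> (\<Union>p\<in>k. cball p (e / 2))"
      using that by (intro closure_minimal closed_UN) auto
    also have "\<dots> \<subseteq> (\<Union>p\<in>k. ball p e)" using e(1) by (force simp: dist_norm)
    finally show False using e(2)[OF that] by simp
  qed
  have "\<exists>x. \<forall>n::nat. norm (x n) \<le> 1 \<and> (\<forall>m<n. e / 2 \<le> norm (U (x m) - U (x n)))"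
  proof (rule dependent_wellorder_choice)
    show "\<exists>r. norm r \<le> 1 \<and> (\<forall>m<n. e / 2 \<le> norm (U (f m) - U r))" for n and f :: "nat \<Rightarrow> 'a"
      using far[of "(\<lambda>m. U (f m)) ` {..<n}"] by (auto simp: dist_norm)
  qed auto
  then show ?thesis using e(1) by (intro exI[of _ "e / 2"]) auto
qed

context banach_over
begin

text \<open>
  Sequences of this kind belong to \<open>SP1w\<close>, and the property passes to subsequences, because being
  basic is expressed by Grunblum's inequality. The bounds extend to the term with index \<open>0\<close>, which
  occurs in that inequality.
\<close>

definition spreading_basic :: "(nat \<Rightarrow> 'a) \<Rightarrow> bool" where
  "spreading_basic x \<longleftrightarrow> weakly_null scl x \<and> (\<exists>K\<ge>0. basic_with_const K x) \<and>
    (\<exists>\<delta>>0. \<exists>M. \<forall>n. \<delta> \<le> norm (x n) \<and> norm (x n) \<le> M) \<and> schreier_spreading scl x"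

lemma weakly_null_subseq:
  assumes "weakly_null scl x" "strict_mono \<phi>" shows "weakly_null scl (x \<circ> \<phi>)"
  unfolding weakly_null_def
proof
  fix f assume "f \<in> dual_space scl"
  then have "(\<lambda>n. f (x n)) \<longlonglongrightarrow> 0" using assms(1) by (simp add: weakly_null_def)
  from LIMSEQ_subseq_LIMSEQ[OF this assms(2)] show "(\<lambda>n. f ((x \<circ> \<phi>) n)) \<longlonglongrightarrow> 0" by (simp add: comp_def)
qed

lemma spreading_basic_subseq:
  assumes "spreading_basic x" "strict_mono \<phi>" shows "spreading_basic (x \<circ> \<phi>)"
proof -
  obtain K \<delta> M where "K \<ge> 0" "basic_with_const K x" "\<delta> > 0" "\<forall>n. \<delta> \<le> norm (x n) \<and> norm (x n) \<le> M"
    using assms(1) unfolding spreading_basic_def by blast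
  then have "\<exists>K\<ge>0. basic_with_const K (x \<circ> \<phi>)" "\<exists>\<delta>>0. \<exists>M. \<forall>n. \<delta> \<le> norm ((x \<circ> \<phi>) n) \<and> norm ((x \<circ> \<phi>) n) \<le> M"
    using basic_with_const_subseq assms(2) by auto
  then show ?thesis using assms weakly_null_subseq schreier_spreading_subseq
    unfolding spreading_basic_def by blast
qed

lemma spreading_basic_in_SP1w:
  assumes "spreading_basic x" shows "x \<in> SP1w scl"
proof -
  obtain K \<delta> M where x: "basic_with_const K x" "\<delta> > 0" "\<And>n. \<delta> \<le> norm (x n)" "\<And>n. norm (x n) \<le> M"
    using assms unfolding spreading_basic_def by blast
  have "basic_sequence scl x" using x by (intro basic_sequence_if_basic_with_const)
  moreover have "seminormalized x" using x unfolding seminormalized_def by blast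
  ultimately show ?thesis using assms by (simp add: SP1w_def spreading_basic_def)
qed

theorem spreading_basic_subsequence:
  fixes y :: "nat \<Rightarrow> 'a"
  assumes null: "weakly_null scl y" and y: "\<delta> > 0" "\<And>k. \<delta> \<le> norm (y k)" "\<And>k. norm (y k) \<le> M"
  shows "\<exists>\<phi>::nat \<Rightarrow> nat. strict_mono \<phi> \<and> spreading_basic (y \<circ> \<phi>)"
proof -
  obtain \<psi> :: "nat \<Rightarrow> nat" where \<psi>: "strict_mono \<psi>" "basic_with_const 2 (y \<circ> \<psi>)"
    using basic_subsequence[OF null y(1,2)] by blast
  have "norm ((y \<circ> \<psi>) k) \<le> M" for k using y(3) by simp
  from asymptotically_placed_subsequence[of "y \<circ> \<psi>", OF this]
  obtain \<theta> :: "nat \<Rightarrow> nat" where \<theta>: "strict_mono \<theta>" "\<And>F G a. F \<in> schreier1 \<Longrightarrow> G \<in> schreier1 \<Longrightarrow> card F = card G \<Longrightarrow>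
      \<forall>i<card F. norm (a i) \<le> 1 \<Longrightarrow> \<bar>placed_norm (y \<circ> \<psi> \<circ> \<theta>) F a - placed_norm (y \<circ> \<psi> \<circ> \<theta>) G a\<bar> \<le> 1"
    by blast
  let ?z = "y \<circ> \<psi> \<circ> \<theta>"
  have basic: "basic_with_const 2 ?z" using \<psi>(2) \<theta>(1) by (rule basic_with_const_subseq)
  moreover have "schreier_spreading scl ?z"
    using y by (intro schreier_spreading_if_placed_norms_close[OF basic _ y(1)] \<theta>(2)) auto
  moreover have "weakly_null scl ?z" using null \<psi>(1) \<theta>(1) by (intro weakly_null_subseq)
  moreover have "\<exists>\<delta>>0. \<exists>M. \<forall>n. \<delta> \<le> norm (?z n) \<and> norm (?z n) \<le> M" using y by auto
  moreover have "(2::real) \<ge> 0" by simp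
  ultimately have "spreading_basic ?z" unfolding spreading_basic_def by blast
  then have "spreading_basic (y \<circ> (\<psi> \<circ> \<theta>))" by (simp add: o_assoc)
  then show ?thesis using strict_mono_o[OF \<psi>(1) \<theta>(1)] by blast
qed

lemma common_spreading_basic_subsequence:
  fixes Y :: "nat \<Rightarrow> nat \<Rightarrow> 'a"
  assumes "\<And>j. j \<le> n \<Longrightarrow> weakly_null scl (Y j)"
    and "\<And>j. j \<le> n \<Longrightarrow> \<exists>\<delta>>0. \<exists>M. \<forall>k. \<delta> \<le> norm (Y j k) \<and> norm (Y j k) \<le> M"
  shows "\<exists>\<phi>::nat \<Rightarrow> nat. strict_mono \<phi> \<and> (\<forall>j\<le>n. spreading_basic (Y j \<circ> \<phi>))"
  using assms
proof (induction n)
  case 0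
  obtain \<delta> M where "\<delta> > 0" "\<And>k. \<delta> \<le> norm (Y 0 k)" "\<And>k. norm (Y 0 k) \<le> M"
    using 0(2)[OF order_refl] by blast
  from spreading_basic_subsequence[OF 0(1)[OF order_refl] this]
  obtain \<phi> :: "nat \<Rightarrow> nat" where \<phi>: "strict_mono \<phi>" "spreading_basic (Y 0 \<circ> \<phi>)" by blast
  have "spreading_basic (Y j \<circ> \<phi>)" if "j \<le> 0" for j using \<phi>(2) that by (simp only: le_0_eq)
  then show ?case using \<phi>(1) by blast
next
  case (Suc n)
  have "\<exists>\<phi>::nat \<Rightarrow> nat. strict_mono \<phi> \<and> (\<forall>j\<le>n. spreading_basic (Y j \<circ> \<phi>))"
    by (rule Suc.IH) (use Suc.prems in auto)
  then obtain \<phi> :: "nat \<Rightarrow> nat" where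
    \<phi>: "strict_mono \<phi>" "\<And>j. j \<le> n \<Longrightarrow> spreading_basic (Y j \<circ> \<phi>)" by blast
  obtain \<delta> M where "\<delta> > 0" "\<And>k. \<delta> \<le> norm ((Y (Suc n) \<circ> \<phi>) k)" "\<And>k. norm ((Y (Suc n) \<circ> \<phi>) k) \<le> M"
    using Suc.prems(2)[OF order_refl] by auto
  from spreading_basic_subsequence[OF weakly_null_subseq[OF Suc.prems(1)[OF order_refl] \<phi>(1)] this]
  obtain \<psi> :: "nat \<Rightarrow> nat" where \<psi>: "strict_mono \<psi>" "spreading_basic (Y (Suc n) \<circ> \<phi> \<circ> \<psi>)"
    unfolding comp_def by blast
  have "spreading_basic (Y j \<circ> (\<phi> \<circ> \<psi>))" if "j \<le> Suc n" for j
  proof (cases "j = Suc n")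
    case True then show ?thesis using \<psi>(2) by (simp add: o_assoc)
  next
    case False
    then show ?thesis using spreading_basic_subseq[OF \<phi>(2) \<psi>(1), of j] that by (simp add: o_assoc)
  qed
  then show ?case using strict_mono_o[OF \<phi>(1) \<psi>(1)] by blast
qed

lemma bounded_ops_id: "id \<in> bounded_ops scl"
  unfolding bounded_ops_def Vector_Spaces.linear_iff
  using vector_space_axioms bounded_linear_ident by (simp add: id_def)

lemma bounded_ops_comp: "S \<in> bounded_ops scl \<Longrightarrow> T \<in> bounded_ops scl \<Longrightarrow> T \<circ> S \<in> bounded_ops scl"
  unfolding bounded_ops_def Vector_Spaces.linear_iff
  by (auto simp: comp_def intro: bounded_linear_compose)

lemma op_diff: assumes "T \<in> bounded_ops scl" shows "T (x - y) = T x - T y"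
  using assms by (simp add: bounded_ops_def linear_diff bounded_linear.linear)

lemma op_sum:
  assumes "T \<in> bounded_ops scl"
  shows "T (\<Sum>i\<in>I. scl (a i) (x i)) = (\<Sum>i\<in>I. scl (a i) (T (x i)))"
proof -
  interpret T: Vector_Spaces.linear scl scl T using assms by (simp add: bounded_ops_def)
  show ?thesis by (simp add: T.sum T.scale)
qed

lemma op_bound:
  assumes "T \<in> bounded_ops scl"
  shows "\<exists>B>0. \<forall>x. norm (T x) \<le> B * norm x"
  using assms bounded_linear.pos_bounded[of T] by (auto simp: bounded_ops_def mult.commute)

lemma weakly_null_op:
  assumes "T \<in> bounded_ops scl" "weakly_null scl x" shows "weakly_null scl (T \<circ> x)"
  unfolding weakly_null_def
proof
  fix f assume f: "f \<in> dual_space scl"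
  have "f \<circ> T \<in> dual_space scl"
    using f assms(1) unfolding dual_space_def bounded_ops_def Vector_Spaces.linear_iff
    by (auto simp: comp_def intro: bounded_linear_compose)
  then show "(\<lambda>n. f ((T \<circ> x) n)) \<longlonglongrightarrow> 0" using assms(2) by (auto simp: weakly_null_def)
qed

text \<open>
  The coefficient bound makes \<open>x\<close> injective with linearly independent range, so that its span is
  infinite-dimensional; the lower bound makes the inverse of \<open>T\<close> on that span Lipschitz continuous.
\<close>

lemma not_SS_if_bounded_below:
  fixes x :: "nat \<Rightarrow> 'a"
  assumes T: "T \<in> bounded_ops scl" and "c > 0"
    and coef: "\<And>a n i. i < n \<Longrightarrow> norm (a i) \<le> B * norm (\<Sum>i<n. scl (a i) (x i))"
    and below: "\<And>a n. c * norm (\<Sum>i<n. scl (a i) (x i)) \<le> norm (T (\<Sum>i<n. scl (a i) (x i)))"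
  shows "T \<notin> SS scl"
proof -
  define Y where "Y = span (range x)"
  have inj: "inj x"
  proof (rule linorder_injI)
    fix i j :: nat assume "i < j"
    show "x i \<noteq> x j"
    proof
      assume eq: "x i = x j"
      define a :: "nat \<Rightarrow> 'k" where "a k = (if k = i then 1 else 0) - (if k = j then 1 else 0)" for k
      have "(\<Sum>k<Suc j. scl (a k) (x k)) =
          (\<Sum>k<Suc j. if k = i then x i else 0) - (\<Sum>k<Suc j. if k = j then x j else 0)"
        unfolding sum_subtractf[symmetric] by (intro sum.cong) (auto simp: a_def scale_left_diff_distrib)
      also have "\<dots> = 0" using \<open>i < j\<close> eq by simp
      finally show False using coef[of i "Suc j" a] \<open>i < j\<close> by (simp add: a_def)
    qed
  qed
  have indep: "\<not> dependent (range x)"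
    unfolding independent_explicit_module
  proof (intro allI impI)
    fix t u v assume t: "finite t" "t \<subseteq> range x" "(\<Sum>v\<in>t. scl (u v) v) = 0" "v \<in> t"
    obtain C where C: "finite C" "t = x ` C" using finite_subset_image[OF t(1,2)] by blast
    obtain i where i: "i \<in> C" "v = x i" using t(4) C(2) by blast
    obtain n where n: "C \<subseteq> {..<n}" using C(1) finite_nat_iff_bounded by blast
    define a where "a k = (if k \<in> C then u (x k) else 0)" for k
    have "(\<Sum>k<n. scl (a k) (x k)) = (\<Sum>k\<in>C. scl (u (x k)) (x k))"
      using n by (intro sum.mono_neutral_cong_right) (auto simp: a_def)
    also have "\<dots> = (\<Sum>v\<in>t. scl (u v) v)"
      unfolding C(2) using inj by (simp add: sum.reindex inj_on_subset)
    finally have "norm (a i) \<le> 0" using coef[of i n a] i(1) n t(3) by auto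
    then show "u v = 0" using i by (simp add: a_def)
  qed
  have "infinite_dim_subspace scl Y" unfolding infinite_dim_subspace_def
  proof (intro conjI notI)
    show "subspace Y" by (simp add: Y_def)
    assume "\<exists>D. finite D \<and> span D = Y"
    then obtain D where "finite D" "span D = Y" by blast
    then have "range x \<subseteq> span D" using span_superset by (auto simp: Y_def)
    then have "finite (range x)" using independent_span_bound[OF \<open>finite D\<close> indep] by blast
    then show False using inj range_inj_infinite by blast
  qed
  moreover have low: "c * norm y \<le> norm (T y)" if "y \<in> Y" for y
    using span_range_sums[of y x] that below unfolding Y_def by (metis order_refl)
  have diff: "y - y' \<in> Y" if "y \<in> Y" "y' \<in> Y" for y y' using that by (simp add: Y_def span_diff)
  have injT: "inj_on T Y"
  proof (rule inj_onI)
    fix y y' assume y: "y \<in> Y" "y' \<in> Y" "T y = T y'"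
    have "c * norm (y - y') \<le> 0" using low[OF diff[OF y(1,2)]] y(3) by (simp add: op_diff[OF T])
    then show "y = y'" using \<open>c > 0\<close> by (simp add: mult_le_0_iff)
  qed
  have "homeomorphism Y (T ` Y) T (inv_into Y T)"
    unfolding homeomorphism_def
  proof (intro conjI)
    show "continuous_on Y T" using T by (simp add: bounded_ops_def linear_continuous_on)
    show "continuous_on (T ` Y) (inv_into Y T)"
    proof (rule continuous_onI)
      fix w e assume w: "w \<in> T ` Y" and "e > (0::real)"
      then obtain y where y: "y \<in> Y" "w = T y" by blast
      have "dist (inv_into Y T w') (inv_into Y T w) \<le> e" if w': "w' \<in> T ` Y" "dist w' w < c * e" for w'
      proof -
        obtain y' where y': "y' \<in> Y" "w' = T y'" using w' by blast
        have "c * norm (y' - y) \<le> c * e"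
          using low[OF diff[OF y'(1) y(1)]] w'(2) y y' by (simp add: op_diff[OF T] dist_norm)
        then show ?thesis using \<open>c > 0\<close> y y' injT by (simp add: dist_norm)
      qed
      then show "\<exists>d>0. \<forall>w'\<in>T ` Y. dist w' w < d \<longrightarrow> dist (inv_into Y T w') (inv_into Y T w) \<le> e"
        using \<open>c > 0\<close> \<open>e > 0\<close> by (intro exI[of _ "c * e"]) auto
    qed
  qed (use injT in \<open>auto simp: f_inv_into_f\<close>)
  ultimately show ?thesis unfolding SS_def by blast
qed

lemma span_image_sums:
  assumes "finite F" "y \<in> span (x ` F)" shows "\<exists>a. y = (\<Sum>i\<in>F. scl (a i) (x i))"
  using assms(2)
proof (induction rule: span_induct_alt)
  case base
  show ?case by (intro exI[of _ "\<lambda>_. 0"]) simp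
next
  case (step c v y)
  then obtain j a where j: "j \<in> F" "v = x j" and a: "y = (\<Sum>i\<in>F. scl (a i) (x i))" by blast
  have "(\<Sum>i\<in>F. scl (a i + (if i = j then c else 0)) (x i)) =
      (\<Sum>i\<in>F. scl (a i) (x i)) + (\<Sum>i\<in>F. if i = j then scl c (x j) else 0)"
    unfolding sum.distrib[symmetric] by (intro sum.cong) (auto simp: scale_left_distrib)
  also have "\<dots> = scl c v + y" using j assms(1) a by (simp add: add.commute)
  finally show ?case by metis
qed

lemma SS_xi_small_combination:
  assumes "T \<in> SS_xi scl u \<xi>" "basic_sequence scl x" "\<epsilon> > 0"
  shows "\<exists>F\<in>schreier u \<xi>. \<exists>a. norm (T (\<Sum>i\<in>F. scl (a i) (x i))) < \<epsilon> * norm (\<Sum>i\<in>F. scl (a i) (x i))"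
proof -
  have T: "T \<in> bounded_ops scl" using assms(1) by (simp add: SS_xi_def)
  have "\<exists>F\<in>schreier u \<xi>. \<exists>z\<in>closed_span scl (x ` F) - {0}. norm (T z) \<le> \<epsilon> / 2 * norm z"
    using assms(1,2) half_gt_zero[OF assms(3)] unfolding SS_xi_def by blast
  then obtain F z where F: "F \<in> schreier u \<xi>" and z: "z \<in> closure (span (x ` F))" "z \<noteq> 0"
      "norm (T z) \<le> \<epsilon> / 2 * norm z"
    unfolding closed_span_def by blast
  \<comment> \<open>The given vector lies only in the closure of the span. Doubling the constant makes the
    inequality strict, hence valid on an open set, which meets the span.\<close>
  define W where "W = {w. norm (T w) < \<epsilon> * norm w}"
  have "continuous_on UNIV T" using T by (simp add: bounded_ops_def linear_continuous_on)
  then have "open W" unfolding W_def by (intro open_Collect_less continuous_intros)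
  moreover have "z \<in> W"
  proof -
    have "\<epsilon> / 2 * norm z < \<epsilon> * norm z" using assms(3) z(2) by simp
    then show ?thesis using z(3) by (simp add: W_def)
  qed
  ultimately obtain w where "w \<in> span (x ` F)" "w \<in> W"
    using z(1) closure_iff_nhds_not_empty by (metis disjoint_iff open_Int_closure_eq_empty)
  moreover have "finite F" using F by (rule finite_if_in_schreier)
  ultimately show ?thesis using F span_image_sums unfolding W_def by blast
qed

lemma op_product_in_bounded_ops:
  "(\<And>k. k \<in> {1..j} \<Longrightarrow> T k \<in> bounded_ops scl) \<Longrightarrow> op_product T j \<in> bounded_ops scl"
  by (induction j) (auto intro!: bounded_ops_id bounded_ops_comp)

lemma op_product_factor:
  assumes "i \<le> j" "\<And>k. k \<in> {1..j} \<Longrightarrow> T k \<in> bounded_ops scl"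
  shows "\<exists>Q\<in>bounded_ops scl. op_product T j = Q \<circ> op_product T i"
  using assms
proof (induction rule: dec_induct)
  case base
  then show ?case using bounded_ops_id by (intro bexI[of _ id]) auto
next
  case (step j)
  have "\<And>k. k \<in> {1..j} \<Longrightarrow> T k \<in> bounded_ops scl" using step.prems by auto
  then obtain Q where Q: "Q \<in> bounded_ops scl" "op_product T j = Q \<circ> op_product T i"
    using step.IH by blast
  have "T (Suc j) \<circ> Q \<in> bounded_ops scl" using Q(1) step.prems by (intro bounded_ops_comp) auto
  then show ?case using Q(2) by (intro bexI[of _ "T (Suc j) \<circ> Q"]) (simp_all add: o_assoc)
qed

lemma op_product_Suc_right: "op_product T (Suc n) = op_product (T \<circ> Suc) n \<circ> T 1"
proof (induction n)
  case (Suc n)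
  have "op_product T (Suc (Suc n)) = T (Suc (Suc n)) \<circ> op_product T (Suc n)"
    by (rule op_product.simps(2))
  also have "\<dots> = T (Suc (Suc n)) \<circ> (op_product (T \<circ> Suc) n \<circ> T 1)" by (simp only: Suc)
  also have "\<dots> = op_product (T \<circ> Suc) (Suc n) \<circ> T 1" by (simp add: o_assoc)
  finally show ?case .
qed simp

text \<open>
  The heart of the matter. If the product is bounded below along a weakly null sequence, so are all
  its partial products, and the \<open>n + 1\<close> sequences of images, including the given one, have a common
  subsequence along which all of them are in \<open>SP1w\<close>. Two of them are equivalent, say those for
  \<open>i < j\<close>, and the second is the image of the first under an operator with right factor
  \<open>T (Suc i)\<close>. This is what the hypothesis on \<open>R\<close> excludes.
\<close>

lemma op_product_not_bounded_below_on_weakly_null: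
  fixes y :: "nat \<Rightarrow> 'a"
  assumes R: "equiv (SP1w scl) R" "finite (SP1w scl // R)" "card (SP1w scl // R) = n"
    and T: "\<And>k. k \<in> {1..n} \<Longrightarrow> T k \<in> bounded_ops scl"
    and separates: "\<And>k Q x. k \<in> {1..n} \<Longrightarrow> Q \<in> bounded_ops scl \<Longrightarrow> spreading_basic x \<Longrightarrow> (x, Q \<circ> T k \<circ> x) \<notin> R"
    and y: "weakly_null scl y" "\<And>k. norm (y k) \<le> M"
    and \<delta>: "\<delta> > 0" "\<And>k. \<delta> \<le> norm (op_product T n (y k))"
  shows False
proof -
  define Y where "Y j = op_product T j \<circ> y" for j
  have op: "op_product T j \<in> bounded_ops scl" if "j \<le> n" for j
    using that by (intro op_product_in_bounded_ops T) auto
  have "weakly_null scl (Y j)" if "j \<le> n" for j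
    unfolding Y_def using op[OF that] y(1) by (rule weakly_null_op)
  moreover have "\<exists>\<delta>>0. \<exists>M. \<forall>k. \<delta> \<le> norm (Y j k) \<and> norm (Y j k) \<le> M" if j: "j \<le> n" for j
  proof -
    obtain Q where Q: "Q \<in> bounded_ops scl" "op_product T n = Q \<circ> op_product T j"
      using op_product_factor[of j n T, OF j T] by blast
    obtain B where B: "B > 0" "\<And>x. norm (Q x) \<le> B * norm x" using op_bound[OF Q(1)] by blast
    obtain B' where B': "B' > 0" "\<And>x. norm (op_product T j x) \<le> B' * norm x" using op_bound[OF op[OF j]] by blast
    have "\<delta> / B \<le> norm (Y j k)" for k
      using order_trans[OF \<delta>(2)[of k]] B(2)[of "Y j k"] Q(2) B(1) by (simp add: Y_def field_simps)
    moreover have "norm (Y j k) \<le> B' * M" for k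
      using order_trans[OF B'(2)[of "y k"] mult_left_mono[OF y(2)[of k]]] B'(1) by (simp add: Y_def)
    ultimately show ?thesis using \<delta>(1) B(1) by (intro exI[of _ "\<delta> / B"]) auto
  qed
  ultimately obtain \<phi> :: "nat \<Rightarrow> nat" where \<phi>: "strict_mono \<phi>" "\<And>j. j \<le> n \<Longrightarrow> spreading_basic (Y j \<circ> \<phi>)"
    using common_spreading_basic_subsequence[of n Y] by blast
  obtain i j where ij: "i < j" "j \<le> n" "(Y i \<circ> \<phi>, Y j \<circ> \<phi>) \<in> R"
    using equiv_pigeonhole[OF R, of "\<lambda>j. Y j \<circ> \<phi>"] \<phi>(2) spreading_basic_in_SP1w by blast
  have "Suc i \<le> j" "\<And>k. k \<in> {1..j} \<Longrightarrow> T k \<in> bounded_ops scl" using ij T by auto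
  then obtain Q where Q: "Q \<in> bounded_ops scl" "op_product T j = Q \<circ> op_product T (Suc i)"
    using op_product_factor by blast
  have "Y j \<circ> \<phi> = Q \<circ> T (Suc i) \<circ> (Y i \<circ> \<phi>)" by (simp add: Y_def Q(2) o_assoc)
  then show False using separates[of "Suc i" Q "Y i \<circ> \<phi>"] ij Q(1) \<phi>(2)[of i] by auto
qed

text \<open>
  If the product is not compact, there are points in the unit ball whose images are separated. By
  Rosenthal's dichotomy, applied to their images under \<open>S\<close>, either these contain an
  \<open>\<ell>\<^sub>1\<close>-sequence, or differences of them form a weakly null sequence along which the product of
  the operators \<open>T k\<close> is bounded below, and this was excluded.
\<close>

lemma dominates_ell1_if_not_compact:
  assumes R: "equiv (SP1w scl) R" "finite (SP1w scl // R)" "card (SP1w scl // R) = n"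
    and T: "\<And>k. k \<in> {1..n} \<Longrightarrow> T k \<in> bounded_ops scl" and S: "S \<in> bounded_ops scl"
    and separates: "\<And>k Q x. k \<in> {1..n} \<Longrightarrow> Q \<in> bounded_ops scl \<Longrightarrow> spreading_basic x \<Longrightarrow> (x, Q \<circ> T k \<circ> x) \<notin> R"
    and "\<not> compact_op (op_product T n \<circ> S)"
  shows "\<exists>x::nat \<Rightarrow> 'a. (\<forall>k. norm (x k) \<le> 1) \<and> dominates_ell1 (S \<circ> x)"
proof -
  obtain \<delta> and x :: "nat \<Rightarrow> 'a" where \<delta>: "\<delta> > 0" and x: "\<And>k. norm (x k) \<le> 1"
    "\<And>l k. l < k \<Longrightarrow> \<delta> \<le> norm ((op_product T n \<circ> S) (x l) - (op_product T n \<circ> S) (x k))"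
    using separated_sequence_if_not_compact[OF assms(7)] by blast
  obtain B where B: "B > 0" "\<And>x. norm (S x) \<le> B * norm x" using op_bound[OF S] by blast
  have bounded: "norm ((S \<circ> x) k) \<le> B" for k
    using order_trans[OF B(2)[of "x k"] mult_left_mono[OF x(1)[of k], of B]] B(1) by simp
  obtain r :: "nat \<Rightarrow> nat" where r: "strict_mono r" "weakly_Cauchy (S \<circ> x \<circ> r) \<or> dominates_ell1 (S \<circ> x \<circ> r)"
    using Rosenthal_ell1[of "S \<circ> x", OF bounded] by blast
  show ?thesis
  proof (cases "weakly_Cauchy (S \<circ> x \<circ> r)")
    case True
    define w where "w = S \<circ> x \<circ> r"
    define y where "y k = w (2 * k) - w (2 * k + 1)" for k
    have "weakly_null scl y" unfolding weakly_null_def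
    proof
      fix f assume f: "f \<in> dual_space scl"
      then have "Cauchy (\<lambda>n. f (w n))" using True by (simp add: weakly_Cauchy_def w_def)
      have "f (y k) = f (w (2 * k)) - f (w (2 * k + 1))" for k
        using f by (simp add: y_def dual_space_def linear_diff bounded_linear.linear)
      moreover have "\<exists>N. \<forall>k\<ge>N. norm (f (w (2 * k)) - f (w (2 * k + 1))) < e" if e: "e > 0" for e
      proof -
        obtain N where "\<forall>l\<ge>N. \<forall>k\<ge>N. dist (f (w l)) (f (w k)) < e"
          using metric_CauchyD[OF \<open>Cauchy (\<lambda>n. f (w n))\<close> e] by blast
        then show ?thesis by (intro exI[of _ N]) (auto simp: dist_norm)
      qed
      ultimately show "(\<lambda>k. f (y k)) \<longlonglongrightarrow> 0" by (intro LIMSEQ_I) simp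
    qed
    moreover have "norm (y k) \<le> 2 * B" for k
      using norm_triangle_ineq4[of "w (2 * k)" "w (2 * k + 1)"] bounded[of "r (2 * k)"] bounded[of "r (2 * k + 1)"]
      by (simp add: y_def w_def)
    moreover have "\<delta> \<le> norm (op_product T n (y k))" for k
    proof -
      have "r (2 * k) < r (2 * k + 1)" using r(1) by (simp add: strict_mono_less)
      from x(2)[OF this] show ?thesis
        using op_diff[OF op_product_in_bounded_ops[of n T, OF T]] by (simp add: y_def w_def)
    qed
    ultimately have False
      using op_product_not_bounded_below_on_weakly_null[where T = T and y = y, OF R T separates _ _ \<delta>(1)]
      by blast
    then show ?thesis ..
  next
    case False
    then have "dominates_ell1 (S \<circ> (x \<circ> r))" using r(2) by (simp add: o_assoc)
    then show ?thesis using x(1) by (intro exI[of _ "x \<circ> r"]) auto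
  qed
qed

lemma not_SS_if_image_dominates_ell1:
  fixes x :: "nat \<Rightarrow> 'a"
  assumes S: "S \<in> bounded_ops scl" and x: "\<And>k. norm (x k) \<le> 1" and dom: "dominates_ell1 (S \<circ> x)"
  shows "S \<notin> SS scl"
proof -
  obtain c where c: "c > 0" "\<And>N a. c * (\<Sum>i<N. norm (a i)) \<le> norm (\<Sum>i<N. scl (a i) (S (x i)))"
    using dom unfolding dominates_ell1_def comp_def by blast
  obtain B where B: "B > 0" "\<And>x. norm (S x) \<le> B * norm x" using op_bound[OF S] by blast
  have low: "c * (\<Sum>i<n. norm (a i)) \<le> norm (S (\<Sum>i<n. scl (a i) (x i)))" for a n
    using c(2)[where N = n and a = a] by (simp add: op_sum[OF S])
  show ?thesis
  proof (rule not_SS_if_bounded_below[OF S c(1)])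
    fix a :: "nat \<Rightarrow> 'k" and n
    have "norm (\<Sum>i<n. scl (a i) (x i)) \<le> (\<Sum>i<n. norm (a i))"
      using x by (intro sum_norm_le) (simp add: norm_scl mult_left_le)
    then have "c * norm (\<Sum>i<n. scl (a i) (x i)) \<le> c * (\<Sum>i<n. norm (a i))"
      using c(1) by simp
    then show "c * norm (\<Sum>i<n. scl (a i) (x i)) \<le> norm (S (\<Sum>i<n. scl (a i) (x i)))"
      using low[where a = a and n = n] by linarith
    fix i assume "i < n"
    then have "norm (a i) \<le> (\<Sum>i<n. norm (a i))" by (intro member_le_sum) auto
    then have "c * norm (a i) \<le> B * norm (\<Sum>i<n. scl (a i) (x i))"
      using low[where a = a and n = n] B(2)[of "\<Sum>i<n. scl (a i) (x i)"] c(1)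
      by (smt (verit) mult_left_mono)
    then show "norm (a i) \<le> B / c * norm (\<Sum>i<n. scl (a i) (x i))" using c(1) by (simp add: field_simps)
  qed
qed

lemma ell1_embeds_if_dominates_ell1:
  fixes x :: "nat \<Rightarrow> 'a"
  assumes x: "\<And>k. norm (x k) \<le> 1" and dom: "dominates_ell1 x"
  shows "ell1_embeds scl"
proof -
  obtain c where c: "c > 0" "\<And>N a. c * (\<Sum>i<N. norm (a i)) \<le> norm (\<Sum>i<N. scl (a i) (x i))"
    using dom unfolding dominates_ell1_def by blast
  define J where "J a = (\<Sum>n. scl (a n) (x n))" for a
  have le: "norm (scl (a n) (x n)) \<le> norm (a n)" for a n
    using x by (simp add: norm_scl mult_left_le)
  have norms: "summable (\<lambda>n. norm (scl (a n) (x n)))" and sum: "(\<lambda>n. scl (a n) (x n)) sums J a"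
    if "a \<in> ell1" for a
  proof -
    show "summable (\<lambda>n. norm (scl (a n) (x n)))"
    proof (rule summable_comparison_test'[of "\<lambda>n. norm (a n)" 0])
      show "summable (\<lambda>n. norm (a n))" using that by (simp add: ell1_def)
    qed (simp add: le)
    then show "(\<lambda>n. scl (a n) (x n)) sums J a"
      unfolding J_def by (rule summable_sums[OF summable_norm_cancel])
  qed
  have "J (\<lambda>n. a n + b n) = J a + J b" if "a \<in> ell1" "b \<in> ell1" for a b
  proof -
    have "(\<lambda>n. scl (a n + b n) (x n)) sums (J a + J b)"
      using sums_add[OF sum[OF that(1)] sum[OF that(2)]] by (simp add: scale_left_distrib)
    then show ?thesis unfolding J_def[of "\<lambda>n. a n + b n"] by (rule sums_unique[symmetric])
  qed
  moreover have "J (\<lambda>n. r * a n) = scl r (J a)" if "a \<in> ell1" for r a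
  proof -
    have "bounded_linear (scl r)"
    proof (rule bounded_linear_intro[where K = "norm r"])
      show "scl r (t *\<^sub>R v) = t *\<^sub>R scl r v" for t v
        by (simp add: mult.commute flip: scl_of_real)
    qed (simp_all add: scale_right_distrib norm_scl)
    from bounded_linear.sums[OF this sum[OF that]]
    have "(\<lambda>n. scl (r * a n) (x n)) sums scl r (J a)" by simp
    then show ?thesis unfolding J_def[of "\<lambda>n. r * a n"] by (rule sums_unique[symmetric])
  qed
  moreover have "c * (\<Sum>n. norm (a n)) \<le> norm (J a)" "norm (J a) \<le> 1 * (\<Sum>n. norm (a n))" if a: "a \<in> ell1" for a
  proof -
    have s: "summable (\<lambda>n. norm (a n))" using a by (simp add: ell1_def)
    have "(\<lambda>N. c * (\<Sum>i<N. norm (a i))) \<longlonglongrightarrow> c * (\<Sum>n. norm (a n))"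
      using summable_LIMSEQ[OF s] by (intro tendsto_intros)
    moreover have "(\<lambda>N. norm (\<Sum>i<N. scl (a i) (x i))) \<longlonglongrightarrow> norm (J a)"
      using sum[OF a] by (intro tendsto_norm) (simp add: sums_def)
    ultimately show "c * (\<Sum>n. norm (a n)) \<le> norm (J a)" by (rule LIMSEQ_le) (use c(2) in blast)
    have "norm (J a) \<le> (\<Sum>n. norm (scl (a n) (x n)))" unfolding J_def by (rule summable_norm[OF norms[OF a]])
    also have "\<dots> \<le> (\<Sum>n. norm (a n))" by (rule suminf_le[OF le[of a] norms[OF a] s])
    finally show "norm (J a) \<le> 1 * (\<Sum>n. norm (a n))" by simp
  qed
  ultimately show ?thesis unfolding ell1_embeds_def using c(1) by (intro exI[of _ J]) blast
qed

text \<open>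
  If the images under \<open>S\<close> of vectors in the unit ball dominate the \<open>\<ell>\<^sub>1\<close>-norm, then \<open>S\<close> is bounded
  below on their span, whence it is not strictly singular. For \<open>S = id\<close> the vectors themselves span
  a copy of \<open>\<ell>\<^sub>1\<close>.
\<close>

theorem compact_products:
  assumes R: "equiv (SP1w scl) R" "finite (SP1w scl // R)" "card (SP1w scl // R) = n"
    and T: "\<And>k. k \<in> {1..n} \<Longrightarrow> T k \<in> bounded_ops scl"
    and separates: "\<And>k Q x. k \<in> {1..n} \<Longrightarrow> Q \<in> bounded_ops scl \<Longrightarrow> spreading_basic x \<Longrightarrow> (x, Q \<circ> T k \<circ> x) \<notin> R"
  shows "S \<in> SS scl \<Longrightarrow> compact_op (op_product T n \<circ> S)"
    and "\<not> ell1_embeds scl \<Longrightarrow> compact_op (op_product T n)"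
proof -
  assume S: "S \<in> SS scl"
  then have S': "S \<in> bounded_ops scl" by (simp add: SS_def)
  show "compact_op (op_product T n \<circ> S)"
  proof (rule ccontr)
    assume nc: "\<not> compact_op (op_product T n \<circ> S)"
    obtain x where "\<And>k. norm (x k) \<le> 1" "dominates_ell1 (S \<circ> x)"
      using dominates_ell1_if_not_compact[where T = T and S = S, OF R T S' separates nc] by auto
    from not_SS_if_image_dominates_ell1[OF S' this] show False using S by contradiction
  qed
next
  assume no_ell1: "\<not> ell1_embeds scl"
  show "compact_op (op_product T n)"
  proof (rule ccontr)
    assume "\<not> compact_op (op_product T n)"
    then have nc: "\<not> compact_op (op_product T n \<circ> id)" by simp
    obtain x where "\<And>k. norm (x k) \<le> 1" "dominates_ell1 (id \<circ> x)"
      using dominates_ell1_if_not_compact[where T = T and S = id, OF R T bounded_ops_id separates nc] by auto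
    then have "ell1_embeds scl" unfolding id_comp by (rule ell1_embeds_if_dominates_ell1)
    then show False using no_ell1 by contradiction
  qed
qed

text \<open>
  Equivalence would bound \<open>T\<close> from below on all combinations supported by a member of the Schreier
  family.
\<close>

lemma not_equiv_xi_image_SS_xi:
  assumes T: "T \<in> SS_xi scl u \<xi>" and Q: "Q \<in> bounded_ops scl" and x: "spreading_basic x"
  shows "(x, Q \<circ> T \<circ> x) \<notin> equiv_xi scl u \<xi>"
proof
  assume "(x, Q \<circ> T \<circ> x) \<in> equiv_xi scl u \<xi>"
  then obtain K where K: "K \<ge> 1" "\<And>F a. F \<in> schreier u \<xi> \<Longrightarrow>
      approx_within K (norm (\<Sum>i\<in>F. scl (a i) (x i))) (norm (\<Sum>i\<in>F. scl (a i) ((Q \<circ> T \<circ> x) i)))"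
    unfolding equiv_xi_def by blast
  obtain B where B: "B > 0" "\<And>x. norm (Q x) \<le> B * norm x" using op_bound[OF Q] by blast
  have "basic_sequence scl x" using spreading_basic_in_SP1w[OF x] by (simp add: SP1w_def)
  moreover have "1 / (K * B) > 0" using K(1) B(1) by simp
  ultimately obtain F a where F: "F \<in> schreier u \<xi>"
    "norm (T (\<Sum>i\<in>F. scl (a i) (x i))) < 1 / (K * B) * norm (\<Sum>i\<in>F. scl (a i) (x i))"
    using SS_xi_small_combination[OF T] by blast
  define v where "v = (\<Sum>i\<in>F. scl (a i) (x i))"
  have T': "T \<in> bounded_ops scl" using T by (simp add: SS_xi_def)
  have "Q (T v) = (\<Sum>i\<in>F. scl (a i) ((Q \<circ> T \<circ> x) i))"
    by (simp add: v_def op_sum[OF Q] op_sum[OF T'])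
  then have "norm v / K \<le> norm (Q (T v))" using K(2)[OF F(1), of a] by (simp add: approx_within_def v_def)
  also have "\<dots> \<le> B * norm (T v)" by (rule B(2))
  also have "\<dots> < B * (1 / (K * B) * norm v)" using F(2) B(1) by (intro mult_strict_left_mono) (simp_all add: v_def)
  also have "\<dots> = norm v / K" using B(1) by simp
  finally show False by simp
qed

lemma not_equiv_seq_image_SS:
  assumes T: "T \<in> SS scl" and Q: "Q \<in> bounded_ops scl" and x: "spreading_basic x"
  shows "(x, Q \<circ> T \<circ> x) \<notin> equiv_seq scl"
proof
  assume "(x, Q \<circ> T \<circ> x) \<in> equiv_seq scl"
  then obtain K where K: "K \<ge> 1" "\<And>N a.
      approx_within K (norm (\<Sum>i=1..N. scl (a i) (x i))) (norm (\<Sum>i=1..N. scl (a i) ((Q \<circ> T \<circ> x) i)))"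
    unfolding equiv_seq_def by blast
  obtain B where B: "B > 0" "\<And>x. norm (Q x) \<le> B * norm x" using op_bound[OF Q] by blast
  have T': "T \<in> bounded_ops scl" using T by (simp add: SS_def)
  have "spreading_basic (x \<circ> Suc)" using spreading_basic_subseq[OF x] by (simp add: strict_mono_Suc_iff)
  then obtain L \<delta> where L: "basic_with_const L (x \<circ> Suc)" and \<delta>: "\<delta> > 0" "\<And>n. \<delta> \<le> norm ((x \<circ> Suc) n)"
    unfolding spreading_basic_def by blast
  have "T \<notin> SS scl"
  proof (rule not_SS_if_bounded_below[OF T', of "1 / (K * B)"])
    show "1 / (K * B) > 0" using K(1) B(1) by simp
    fix a :: "nat \<Rightarrow> 'k" and n
    define v where "v = (\<Sum>i<n. scl (a i) ((x \<circ> Suc) i))"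
    have "approx_within K (norm v) (norm (\<Sum>i<n. scl (a i) ((Q \<circ> T \<circ> x) (Suc i))))"
      using K(2)[of "\<lambda>i. a (i - 1)" n] by (simp add: v_def sum.atLeast1_atMost_eq)
    moreover have "Q (T v) = (\<Sum>i<n. scl (a i) ((Q \<circ> T \<circ> x) (Suc i)))" by (simp add: v_def op_sum[OF Q] op_sum[OF T'])
    ultimately have "norm v / K \<le> norm (Q (T v))" by (simp add: approx_within_def)
    also have "\<dots> \<le> B * norm (T v)" by (rule B(2))
    finally show "1 / (K * B) * norm v \<le> norm (T v)"
      using K(1) B(1) by (simp add: field_simps)
    fix i assume "i < n"
    then have "norm (a i) * \<delta> \<le> 2 * L * norm v"
      unfolding v_def using \<delta>(2) by (intro coefficient_bound basic_with_constD[OF L])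
    then show "norm (a i) \<le> 2 * L / \<delta> * norm v" using \<delta>(1) by (simp add: field_simps)
  qed
  then show False using T by blast
qed

end

theorem theorem4p1:
  fixes scl :: "'k::real_or_complex \<Rightarrow> 'a::banach \<Rightarrow> 'a"
    and u :: "'o::wellorder \<Rightarrow> nat \<Rightarrow> 'o"
    and \<xi> :: 'o
    and n :: nat
  assumes "banach_over scl"
    and "countable {..<\<xi>}" and "\<not> ord_zero \<xi>"
    and "fundamental_sequences u \<xi>"
  shows
    "(finite (SP1w scl // equiv_xi scl u \<xi>) \<and> card (SP1w scl // equiv_xi scl u \<xi>) = n \<longrightarrow>
       (\<forall>S T. S \<in> SS scl \<and> (\<forall>i\<in>{1..n}. T i \<in> SS_xi scl u \<xi>) \<longrightarrow>
          compact_op (op_product T n \<circ> S)) \<and>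
       (\<not> ell1_embeds scl \<longrightarrow>
          (if n = 0 then \<forall>S\<in>SS scl. compact_op S
           else \<forall>T. (\<forall>i\<in>{1..n}. T i \<in> SS_xi scl u \<xi>) \<longrightarrow> compact_op (op_product T n))))
     \<and>
     (finite (SP1w scl // equiv_seq scl) \<and> card (SP1w scl // equiv_seq scl) = n \<longrightarrow>
       (\<forall>T. (\<forall>i\<in>{1..n+1}. T i \<in> SS scl) \<longrightarrow> compact_op (op_product T (n+1))) \<and>
       (\<not> ell1_embeds scl \<longrightarrow>
          (if n = 0 then \<forall>S\<in>SS scl. compact_op S
           else \<forall>T. (\<forall>i\<in>{1..n}. T i \<in> SS scl) \<longrightarrow> compact_op (op_product T n))))"
proof -
  interpret banach_over scl by (rule assms(1))
  have xi: "S \<in> SS scl \<Longrightarrow> compact_op (op_product T n \<circ> S)"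
      "\<not> ell1_embeds scl \<Longrightarrow> compact_op (op_product T n)"
    if "finite (SP1w scl // equiv_xi scl u \<xi>)" "card (SP1w scl // equiv_xi scl u \<xi>) = n"
      and T: "\<forall>i\<in>{1..n}. T i \<in> SS_xi scl u \<xi>" for S T
  proof -
    have "T k \<in> bounded_ops scl" if "k \<in> {1..n}" for k
      using T that by (auto simp: SS_xi_def)
    moreover have "(x, Q \<circ> T k \<circ> x) \<notin> equiv_xi scl u \<xi>"
      if "k \<in> {1..n}" "Q \<in> bounded_ops scl" "spreading_basic x" for k Q x
      using not_equiv_xi_image_SS_xi[OF _ that(2,3)] T that(1) by blast
    ultimately show "S \<in> SS scl \<Longrightarrow> compact_op (op_product T n \<circ> S)"
      "\<not> ell1_embeds scl \<Longrightarrow> compact_op (op_product T n)"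
      using compact_products[OF equiv_equiv_xi that(1,2)] by blast+
  qed
  have seq: "S \<in> SS scl \<Longrightarrow> compact_op (op_product T n \<circ> S)"
      "\<not> ell1_embeds scl \<Longrightarrow> compact_op (op_product T n)"
    if "finite (SP1w scl // equiv_seq scl)" "card (SP1w scl // equiv_seq scl) = n"
      and T: "\<forall>i\<in>{1..n}. T i \<in> SS scl" for S T
  proof -
    have "T k \<in> bounded_ops scl" if "k \<in> {1..n}" for k
      using T that by (auto simp: SS_def)
    moreover have "(x, Q \<circ> T k \<circ> x) \<notin> equiv_seq scl"
      if "k \<in> {1..n}" "Q \<in> bounded_ops scl" "spreading_basic x" for k Q x
      using not_equiv_seq_image_SS[OF _ that(2,3)] T that(1) by blast
    ultimately show "S \<in> SS scl \<Longrightarrow> compact_op (op_product T n \<circ> S)"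
      "\<not> ell1_embeds scl \<Longrightarrow> compact_op (op_product T n)"
      using compact_products[OF equiv_equiv_seq that(1,2)] by blast+
  qed
  show ?thesis
  proof (intro conjI impI allI)
    fix S T assume "finite (SP1w scl // equiv_xi scl u \<xi>) \<and> card (SP1w scl // equiv_xi scl u \<xi>) = n"
      "S \<in> SS scl \<and> (\<forall>i\<in>{1..n}. T i \<in> SS_xi scl u \<xi>)"
    then show "compact_op (op_product T n \<circ> S)" using xi(1) by blast
  next
    assume fin: "finite (SP1w scl // equiv_xi scl u \<xi>) \<and> card (SP1w scl // equiv_xi scl u \<xi>) = n"
      and "\<not> ell1_embeds scl"
    then show "if n = 0 then \<forall>S\<in>SS scl. compact_op S
        else \<forall>T. (\<forall>i\<in>{1..n}. T i \<in> SS_xi scl u \<xi>) \<longrightarrow> compact_op (op_product T n)"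
      using xi(1)[of "\<lambda>_. id"] xi(2) by auto
  next
    fix T assume "finite (SP1w scl // equiv_seq scl) \<and> card (SP1w scl // equiv_seq scl) = n"
      and T: "\<forall>i\<in>{1..n+1}. T i \<in> SS scl"
    moreover have "\<forall>i\<in>{1..n}. (T \<circ> Suc) i \<in> SS scl" "T 1 \<in> SS scl" using T by auto
    ultimately have "compact_op (op_product (T \<circ> Suc) n \<circ> T 1)" using seq(1) by blast
    then show "compact_op (op_product T (n+1))" using op_product_Suc_right[of T n] by simp
  next
    assume "finite (SP1w scl // equiv_seq scl) \<and> card (SP1w scl // equiv_seq scl) = n"
      and "\<not> ell1_embeds scl"
    then show "if n = 0 then \<forall>S\<in>SS scl. compact_op S
        else \<forall>T. (\<forall>i\<in>{1..n}. T i \<in> SS scl) \<longrightarrow> compact_op (op_product T n)"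
      using seq(1)[of "\<lambda>_. id"] seq(2) by auto
  qed
qed

end
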